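(* Let $m>1/2$ and $b>0$ be fixed. Consider the problem on the entire real line of finding a number $a>0$ and a function $\Phi:\mathbb R\to\mathbb R$ with $$(\Phi''+\Phi\Phi')'=\frac{2m-1}{m}(\Phi')^2,\quad -\infty<\tau<\infty,$$ $$\lim_{\tau\to-\infty}e^{-\varepsilon\tau}[\Phi(\tau)+a]=\lim_{\tau\to-\infty}e^{-\varepsilon\tau}\Phi'(\tau)=\lim_{\tau\to-\infty}e^{-\varepsilon\tau}\Phi''(\tau)=0\quad\forall\,\varepsilon\in(0,a),$$ $$\Phi(0)=0,\qquad \lim_{\tau\to\infty}\Phi(\tau)/\tau^m=b.$$ This problem has a unique solution $\Phi_m(\tau,a,b)$, where $a=a(m,b)>0$, and the following assertions are valid. (i) $\Phi_m(\tau,a,b)$ is a convex monotone increasing function, belonging to the Lyapunov family (see context) for some $d=d(m,a,b)>0$ and satisfying the restrictions $$a[e^{a\tau}-1]\le\Phi_m(\tau,a,b)\le a\tanh(a\tau/2),\quad -\infty<\tau\le0,$$ $$a\tanh(a\tau/2)<\Phi_m(\tau,a,b)<a[e^{a\tau}-1],\quad \tau>0.$$ (ii) For large $\tau>0$, with certain constants $D=D(m,a,b)$ and $\tau_s=\tau_s(m,a,b)$, as $\tau\to\infty$, $$\Phi_m(\tau,a,b)=(\tau+\tau_s)^m\Big\{b+v_{\rm par}\Big(\tfrac{(\tau+\tau_s)^{m+1}}{m+1},b\Big)+D(\tau+\tau_s)^{\gamma}\exp\Big(-\tfrac{b(\tau+\tau_s)^{m+1}}{m+1}\Big)[1+o(1)]\Big\},$$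 where $\gamma=(-4m^2-6m+4)/(m+1)$ and $v_{\rm par}$ is as in the context. (iii) The solution may be obtained as follows. Fix $a=1$ and let $\Phi_m(\tau,1)$ be the solution of the boundary value problem on $(-\infty,0]$ formed by the same ODE, the same limit conditions at $-\infty$ (with $a=1$) and $\Phi(0)=0$; it exists, is unique, and belongs to the Lyapunov family with $a=1$ and some $d=d_m(1)$. Extended to the right, this solution satisfies $\lim_{\tau\to\infty}\Phi_m(\tau,1)/\tau^m=b_m(1)>0$. Then $$\Phi_m(\tau,a,b)=a\,\Phi_m(a\tau,1),\quad\tau\in\mathbb R,$$ where $a=a(m,b)=[b/b_m(1)]^{1/(m+1)}$, and the corresponding Lyapunov parameter is $d=d_m(a(m,b))=a(m,b)\,d_m(1)$.
   Context: Lyapunov family: for $a>0$, $m\neq0$ and a parameter $d\in\mathbb R$, $\Phi_m(\tau,a,d)$ denotes the solution of the ODE given for $|d\,e^{a\tau}|$ small (i.e. near $\tau=-\infty$) by the convergent series $$\Phi_m(\tau,a,d)=-a+\sum_{l=1}^\infty h_l d^l e^{la\tau},\quad h_1=1,\quad h_l=\frac{1}{al^2(l-1)}\sum_{k=1}^{l-1}k\Big(\frac{(m-1)(l-k)}{m}-k\Big)h_kh_{l-k}\ (l\ge2),$$ and continued to the right as a solution of the ODE. The function $v_{\rm par}(\xi,b)$: a (fixed) particular solution, for large $\xi$, of $$\dddot v+\Big[\tfrac{6m}{(m+1)\xi}+b\Big]\ddot v+\Big[\tfrac{(7m-4)m}{(m+1)^2\xi^2}+\tfrac{(m+2)b}{(m+1)\xi}\Big]\dot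 v+\tfrac{m(m-1)(m-2)}{(m+1)^3\xi^3}v+\tfrac{m(m-1)(m-2)b}{(m+1)^3\xi^3}=-v\ddot v-\tfrac{m+2}{(m+1)\xi}v\dot v+\tfrac{m-1}{m}\dot v^2$$ with $v,\dot v,\ddot v\to0$ as $\xi\to\infty$, having as asymptotic expansion for large $\xi$ the formal series $\sum_{k\ge1}v_k\xi^{-k}$ satisfying this equation; its first coefficient is $v_1=-(m-1)(m-2)/(m+1)^2$ and the remaining ones are determined by formal substitution. (The equation is the ODE for $\Phi$ rewritten via $\Phi(\tau)=\tau^m[b+v(\xi)]$, $\xi=\tau^{m+1}/(m+1)$.) For $m=1$ and $m=2$ one has $v_{\rm par}\equiv0$.
   Formalization: Convexity of the solution on the whole line is asserted only for m ≥ 1; for 1/2 < m < 1 it is asserted on (−∞,0] only, since there Φ(0)=0, Φ(−1)<0 and Φ(τ)/τ^m → b with m<1 make convexity on all of ℝ impossible. *)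

theory Defs
  imports "HOL-Analysis.Analysis" "HOL-Real_Asymp.Real_Asymp"
begin

text \<open>
  One-sided at endpoints of \<open>S\<close>, so that the same definitions serve the problem on the
  whole line (\<open>S = UNIV\<close>) and the one on the closed half-line \<open>S = {..0}\<close>.
\<close>

definition deriv_on :: "real set \<Rightarrow> (real \<Rightarrow> real) \<Rightarrow> real \<Rightarrow> real" where
  "deriv_on S f x = vector_derivative f (at x within S)"

definition solves_ode :: "real \<Rightarrow> real set \<Rightarrow> (real \<Rightarrow> real) \<Rightarrow> bool" where
  "solves_ode m S \<Phi> \<longleftrightarrow>
     \<Phi> differentiable_on S \<and>
     deriv_on S \<Phi> differentiable_on S \<and>
     deriv_on S (deriv_on S \<Phi>) differentiable_on S \<and>
     (\<forall>\<tau>\<in>S. deriv_on S (\<lambda>t. deriv_on S (deriv_on S \<Phi>) t + \<Phi> t * deriv_on S \<Phi> t) \<tau>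
              = (2 * m - 1) / m * (deriv_on S \<Phi> \<tau>)\<^sup>2)"

definition limits_at_minus_infinity :: "real \<Rightarrow> real set \<Rightarrow> (real \<Rightarrow> real) \<Rightarrow> bool" where
  "limits_at_minus_infinity a S \<Phi> \<longleftrightarrow>
     (\<forall>\<epsilon>. 0 < \<epsilon> \<and> \<epsilon> < a \<longrightarrow>
        ((\<lambda>\<tau>. exp (- \<epsilon> * \<tau>) * (\<Phi> \<tau> + a)) \<longlongrightarrow> 0) at_bot \<and>
        ((\<lambda>\<tau>. exp (- \<epsilon> * \<tau>) * deriv_on S \<Phi> \<tau>) \<longlongrightarrow> 0) at_bot \<and>
        ((\<lambda>\<tau>. exp (- \<epsilon> * \<tau>) * deriv_on S (deriv_on S \<Phi>) \<tau>) \<longlongrightarrow> 0) at_bot)"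

definition whole_line_problem :: "real \<Rightarrow> real \<Rightarrow> real \<Rightarrow> (real \<Rightarrow> real) \<Rightarrow> bool" where
  "whole_line_problem m b a \<Phi> \<longleftrightarrow>
     a > 0 \<and> solves_ode m UNIV \<Phi> \<and> limits_at_minus_infinity a UNIV \<Phi> \<and>
     \<Phi> 0 = 0 \<and> ((\<lambda>\<tau>. \<Phi> \<tau> / \<tau> powr m) \<longlongrightarrow> b) at_top"

text \<open>Only the values of \<open>\<Phi>\<close> on \<open>{..0}\<close> matter here.\<close>

definition half_line_problem :: "real \<Rightarrow> real \<Rightarrow> (real \<Rightarrow> real) \<Rightarrow> bool" where
  "half_line_problem m a \<Phi> \<longleftrightarrow>
     solves_ode m {..0} \<Phi> \<and> limits_at_minus_infinity a {..0} \<Phi> \<and> \<Phi> 0 = 0"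

text \<open>
  Coefficients \<open>h\<^sub>l\<close> of the Lyapunov series. The series starts at \<open>l = 1\<close>; the value
  at \<open>l = 0\<close> is a dummy.
\<close>

function lyapunov_coeff :: "real \<Rightarrow> real \<Rightarrow> nat \<Rightarrow> real" where
  "lyapunov_coeff m a l =
     (if l = 0 then 0 else if l = 1 then 1 else
        1 / (a * (real l)\<^sup>2 * (real l - 1)) *
        (\<Sum>k\<in>{1..<l}. real k * ((m - 1) * real (l - k) / m - real k)
                        * lyapunov_coeff m a k * lyapunov_coeff m a (l - k)))"
  by pat_completeness auto
termination by (relation "Wellfounded.measure (\<lambda>(m, a, l). l)") auto

declare lyapunov_coeff.simps [simp del]

text \<open>
  \<open>\<Phi>\<close> is the member \<open>\<Phi>\<^sub>m(\<cdot>, a, d)\<close> of the Lyapunov family on \<open>S\<close>: the series represents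
  it where \<open>\<bar>d e\<^bsup>a\<tau>\<^esup>\<bar>\<close> is small, and elsewhere it is the continuation as a solution of the
  equation.
\<close>

definition lyapunov_family ::
  "real \<Rightarrow> real \<Rightarrow> real \<Rightarrow> real set \<Rightarrow> (real \<Rightarrow> real) \<Rightarrow> bool" where
  "lyapunov_family m a d S \<Phi> \<longleftrightarrow>
     solves_ode m S \<Phi> \<and>
     (\<exists>\<delta>>0. \<forall>\<tau>\<in>S. \<bar>d * exp (a * \<tau>)\<bar> < \<delta> \<longrightarrow>
        (\<lambda>n. lyapunov_coeff m a (Suc n) * d ^ Suc n * exp (real (Suc n) * a * \<tau>))
          sums (\<Phi> \<tau> + a))"

text \<open>
  The equation for \<open>v\<close>, obtained from that for \<open>\<Phi>\<close> by \<open>\<Phi>(\<tau>) = \<tau>\<^sup>m (b + v(\<xi>))\<close>,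
  \<open>\<xi> = \<tau>\<^bsup>m+1\<^esup> / (m + 1)\<close>.
\<close>

definition v_equation_at :: "real \<Rightarrow> real \<Rightarrow> (real \<Rightarrow> real) \<Rightarrow> real \<Rightarrow> bool" where
  "v_equation_at m b v \<xi> \<longleftrightarrow>
     deriv (deriv (deriv v)) \<xi>
     + (6 * m / ((m + 1) * \<xi>) + b) * deriv (deriv v) \<xi>
     + ((7 * m - 4) * m / ((m + 1)\<^sup>2 * \<xi>\<^sup>2) + (m + 2) * b / ((m + 1) * \<xi>)) * deriv v \<xi>
     + m * (m - 1) * (m - 2) / ((m + 1) ^ 3 * \<xi> ^ 3) * v \<xi>
     + m * (m - 1) * (m - 2) * b / ((m + 1) ^ 3 * \<xi> ^ 3)
     = - v \<xi> * deriv (deriv v) \<xi>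
       - (m + 2) / ((m + 1) * \<xi>) * v \<xi> * deriv v \<xi>
       + (m - 1) / m * (deriv v \<xi>)\<^sup>2"

text \<open>
  A formal series \<open>\<Sum>k\<ge>1. v\<^sub>k \<xi>\<^bsup>-k\<^esup>\<close> is encoded as the formal power series in \<open>X = 1 / \<xi>\<close> with
  the same coefficients; \<open>d/d\<xi>\<close> then acts as \<open>- X\<^sup>2 d/dX\<close>.
\<close>

definition fps_xi_deriv :: "real fps \<Rightarrow> real fps" where
  "fps_xi_deriv F = - (fps_X ^ 2 * fps_deriv F)"

definition formal_v_series :: "real \<Rightarrow> real \<Rightarrow> real fps \<Rightarrow> bool" where
  "formal_v_series m b V \<longleftrightarrow>
     fps_nth V 0 = 0 \<and>
     fps_nth V 1 = - (m - 1) * (m - 2) / (m + 1)\<^sup>2 \<and>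
     (let V1 = fps_xi_deriv V; V2 = fps_xi_deriv V1; V3 = fps_xi_deriv V2 in
       V3
       + (fps_const (6 * m / (m + 1)) * fps_X + fps_const b) * V2
       + (fps_const ((7 * m - 4) * m / (m + 1)\<^sup>2) * fps_X ^ 2
          + fps_const ((m + 2) * b / (m + 1)) * fps_X) * V1
       + fps_const (m * (m - 1) * (m - 2) / (m + 1) ^ 3) * fps_X ^ 3 * V
       + fps_const (m * (m - 1) * (m - 2) * b / (m + 1) ^ 3) * fps_X ^ 3
       = - V * V2
         - fps_const ((m + 2) / (m + 1)) * fps_X * V * V1
         + fps_const ((m - 1) / m) * V1 ^ 2)"

text \<open>
  \<open>v\<close> is an admissible choice of \<open>v\<^sub>p\<^sub>a\<^sub>r(\<cdot>, b)\<close>. The conditions other than the last leave open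
  the addition of exponentially small terms, so they do not single out one function; for
  \<open>m = 1\<close> and \<open>m = 2\<close> the choice is the zero solution.
\<close>

definition is_v_par :: "real \<Rightarrow> real \<Rightarrow> (real \<Rightarrow> real) \<Rightarrow> bool" where
  "is_v_par m b v \<longleftrightarrow>
     (\<exists>\<xi>\<^sub>0>0. \<forall>\<xi>>\<xi>\<^sub>0.
        v differentiable at \<xi> \<and> deriv v differentiable at \<xi> \<and>
        deriv (deriv v) differentiable at \<xi> \<and>
        v_equation_at m b v \<xi>) \<and>
     (v \<longlongrightarrow> 0) at_top \<and> (deriv v \<longlongrightarrow> 0) at_top \<and> (deriv (deriv v) \<longlongrightarrow> 0) at_top \<and>
     (\<exists>V. formal_v_series m b V \<and>
        (\<forall>n. (\<lambda>\<xi>. v \<xi> - (\<Sum>k=1..n. fps_nth V k / \<xi> ^ k)) \<in> O[at_top](\<lambda>\<xi>. 1 / \<xi> ^ Suc n))) \<and>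
     (m = 1 \<or> m = 2 \<longrightarrow> eventually (\<lambda>\<xi>. v \<xi> = 0) at_top)"

text \<open>
  For \<open>m < 1\<close> a solution of the whole-line problem cannot be convex on all of the line: it is
  \<open>0\<close> at \<open>0\<close> and negative to the left of it, so convexity would force at least linear growth,
  against \<open>\<Phi> \<tau> / \<tau> powr m \<longlongrightarrow> b\<close>.
\<close>

lemma not_convex_if_sublinear:
  fixes f :: "real \<Rightarrow> real"
  assumes "m < 1" "f 0 = 0" "f (-1) < 0" "((\<lambda>\<tau>. f \<tau> / \<tau> powr m) \<longlongrightarrow> b) at_top"
  shows "\<not> convex_on UNIV f"
proof
  assume conv: "convex_on UNIV f"
  define c where "c = - f (-1)"
  have c: "c > 0" using assms(3) by (simp add: c_def)
  have lin: "f t \<ge> c * t" if "t > 0" for t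
  proof -
    have eq: "(1 - 1 / (1 + t)) *\<^sub>R (-1) + (1 / (1 + t)) *\<^sub>R t = (0::real)"
      using that by (simp add: field_simps)
    have "f ((1 - 1 / (1 + t)) *\<^sub>R (-1) + (1 / (1 + t)) *\<^sub>R t)
            \<le> (1 - 1 / (1 + t)) * f (-1) + (1 / (1 + t)) * f t"
      using that by (intro convex_onD[OF conv]) auto
    then have "0 \<le> (1 - 1 / (1 + t)) * f (-1) + (1 / (1 + t)) * f t"
      unfolding eq assms(2) .
    also have "1 - 1 / (1 + t) = t / (1 + t)" using that by (simp add: field_simps)
    finally have "0 \<le> (t * f (-1) + f t) / (1 + t)" by (simp add: add_divide_distrib)
    then have "0 \<le> t * f (-1) + f t" using that by (simp add: zero_le_divide_iff)
    then show ?thesis by (simp add: c_def mult.commute)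
  qed
  have lower: "eventually (\<lambda>t. c * t powr (1 - m) \<le> f t / t powr m) at_top"
    using eventually_gt_at_top[of 0]
  proof eventually_elim
    case (elim t)
    have "c * t powr (1 - m) = c * t / t powr m" using elim by (simp add: powr_diff)
    also have "\<dots> \<le> f t / t powr m" using lin[OF elim] by (intro divide_right_mono) auto
    finally show ?case .
  qed
  have "filterlim (\<lambda>t::real. t powr (1 - m)) at_top at_top"
    using assms(1) by real_asymp
  then have "filterlim (\<lambda>t. c * t powr (1 - m)) at_top at_top"
    by (intro filterlim_tendsto_pos_mult_at_top[OF tendsto_const c])
  then have "filterlim (\<lambda>t. f t / t powr m) at_top at_top"
    using lower by (rule filterlim_at_top_mono)
  then show False
    using assms(4) not_tendsto_and_filterlim_at_infinity
      filterlim_at_top_imp_at_infinity trivial_limit_at_top_linorder by blast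
qed

end

theory Submission
  imports Defs
begin

text \<open>
  With \<open>k = (m - 1) / m\<close> the equation is \<open>\<Phi>''' + \<Phi> \<Phi>'' = k \<Phi>'\<^sup>2\<close>. It is invariant under shifts and under
  \<open>\<Phi>(\<tau>) \<leadsto> a \<Phi>(a \<tau>)\<close>, so it suffices to treat \<open>a = 1\<close>. The decay conditions at \<open>-\<infinity>\<close> single out
  the unstable manifold of the equilibrium \<open>-1\<close>, which is parametrized by \<open>d = lim e\<^bsup>-\<tau>\<^esup> (\<Phi> + 1)\<close>: up
  to a shift there are only the constant, a branch \<open>d < 0\<close> that stays below \<open>-1\<close>, and the Lyapunov
  series with \<open>d = 1\<close>, which is global, increasing and crosses \<open>0\<close> once. At \<open>+\<infinity>\<close> the quotient by the
  two symmetries is a first order equation with an attracting slow curve, along which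
  \<open>\<Phi>' \<Phi>\<^bsup>-k\<^esup>\<close> has a positive limit, whence \<open>\<Phi> ~ b \<tau>\<^sup>m\<close>. A function \<open>v\<^sub>p\<^sub>a\<^sub>r\<close> gives a second
  solution with the same growth, and two such solutions differ, after a shift, by an exponentially
  small mode.
\<close>


section \<open>Real analysis on half-lines\<close>

text \<open>The triple \<open>f\<close>, \<open>g\<close>, \<open>h\<close> stands for a solution
  and its first two derivatives. The hypothesis \<open>m > 1 / 2\<close> says exactly
  \<open>-1 < k < 1\<close>, and the two ends do different work: \<open>1 + k > 0\<close> makes
  \<open>J = f'' + f f'\<close>, whose derivative is \<open>(1 + k) f'^2\<close>, increasing, while
  \<open>k < 1\<close> decides the sign of the derivative of \<open>f'' / f'\<close> near minus
  infinity and keeps \<open>G\<close> below \<open>1\<close> near plus infinity. The obstacle at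
  minus infinity is that all constants are equilibria: the linearization at \<open>-1\<close> has
  the eigenvalues \<open>0, 0, 1\<close>. The two neutral directions are removed by integrating
  exact identities from minus infinity: \<open>J\<close> and then
  \<open>Q = f' - (f + 1) + (f + 1)^2 / 2\<close>, with \<open>Q' = J\<close>, are quadratically
  small there. The power in the final expansion has two sources: the small mode is a constant times
  \<open>exp (- F) t^(2 - 4 m)\<close>, with \<open>F\<close> a primitive of the comparison
  solution, and the coefficient of \<open>1 / \<xi>\<close> in \<open>v_par\<close> puts a logarithm
  into \<open>F\<close>.\<close>

lemma barrier_nonneg:
  fixes N N' :: "real \<Rightarrow> real"
  assumes d: "\<And>t. a \<le> t \<Longrightarrow> t \<le> b \<Longrightarrow> (N has_real_derivative N' t) (at t)"
    and a: "N a \<ge> 0"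
    and pos: "\<And>t. a \<le> t \<Longrightarrow> t \<le> b \<Longrightarrow> (\<And>u. a \<le> u \<Longrightarrow> u \<le> t \<Longrightarrow> N u \<ge> 0) \<Longrightarrow> N t = 0 \<Longrightarrow> N' t > 0"
    and t: "a \<le> t" "t \<le> b"
  shows "N t \<ge> 0"
proof (rule ccontr)
  assume neg: "\<not> N t \<ge> 0"
  define S where "S = {u \<in> {a..t}. N u < 0}"
  define i where "i = Inf S"
  have tS: "t \<in> S" using neg t by (auto simp: S_def)
  have bdd: "bdd_below S" by (auto simp: S_def intro: bdd_belowI[of _ a])
  have ai: "a \<le> i" unfolding i_def using tS by (intro cInf_greatest) (auto simp: S_def)
  have it: "i \<le> t" unfolding i_def using tS bdd by (intro cInf_lower)
  have before: "N u \<ge> 0" if "a \<le> u" "u < i" for u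
  proof (rule ccontr)
    assume "\<not> N u \<ge> 0"
    then have "u \<in> S" using that it by (auto simp: S_def)
    then have "i \<le> u" unfolding i_def using bdd by (intro cInf_lower)
    with that show False by simp
  qed
  have cont: "isCont N i" using d[of i] ai it t by (intro DERIV_isCont) auto
  have Ni: "N i \<ge> 0"
  proof (rule ccontr)
    assume ni: "\<not> N i \<ge> 0"
    then have "i \<noteq> a" using a by auto
    then have "a < i" using ai by simp
    have "eventually (\<lambda>u. N u < 0) (at i)"
      using cont ni by (intro order_tendstoD(2)[of N "N i"]) (auto simp: isCont_def)
    then have "eventually (\<lambda>u. N u < 0) (at_left i)" by (simp add: eventually_at_split)
    then have "eventually (\<lambda>u. N u < 0 \<and> u > a \<and> u < i) (at_left i)"
      using eventually_at_left_real[OF \<open>a < i\<close>] by eventually_elim auto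
    then obtain u where "N u < 0" "u > a" "u < i"
      using eventually_happens trivial_limit_at_left_real by blast
    with before[of u] show False by simp
  qed
  have "N i \<le> 0 \<and> \<not> N' i > 0"
  proof -
    have near: "\<exists>s. i \<le> s \<and> s < i + e \<and> s \<in> S" if "e > 0" for e
      using cInf_lessD[of S "i + e"] tS that cInf_lower[OF _ bdd] unfolding i_def by fastforce
    have 1: "N i \<le> 0"
    proof (rule ccontr)
      assume ni: "\<not> N i \<le> 0"
      have "eventually (\<lambda>u. N u > 0) (at i)"
        using cont ni by (intro order_tendstoD(1)[of N "N i"]) (auto simp: isCont_def)
      then obtain e where e: "e > 0" "\<And>u. u \<noteq> i \<Longrightarrow> dist u i < e \<Longrightarrow> N u > 0"
        unfolding eventually_at by auto
      obtain s where "i \<le> s" "s < i + e" "s \<in> S" using near[OF e(1)] by auto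
      then show False using e(2)[of s] ni by (cases "s = i") (auto simp: S_def dist_real_def)
    qed
    have "\<not> N' i > 0"
    proof
      assume "N' i > 0"
      then obtain e where e: "e > 0" "\<And>h. 0 < h \<Longrightarrow> h < e \<Longrightarrow> N i < N (i + h)"
        using DERIV_pos_inc_right[of N "N' i" i] d[of i] ai it t by auto
      obtain s where s: "i \<le> s" "s < i + e" "s \<in> S" using near[OF e(1)] by auto
      then show False using e(2)[of "s - i"] \<open>N i \<ge> 0\<close> by (cases "s = i") (auto simp: S_def)
    qed
    with 1 show ?thesis by blast
  qed
  moreover have "N u \<ge> 0" if "a \<le> u" "u \<le> i" for u
    using before[of u] \<open>N i \<ge> 0\<close> that by (cases "u = i") auto
  ultimately have "N' i > 0" using pos[of i] ai it t Ni by auto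
  then show False using \<open>N i \<le> 0 \<and> \<not> N' i > 0\<close> by blast
qed

lemma barrier_pos:
  fixes N N' :: "real \<Rightarrow> real"
  assumes d: "\<And>t. a \<le> t \<Longrightarrow> t \<le> b \<Longrightarrow> (N has_real_derivative N' t) (at t)"
    and a: "N a > 0"
    and pos: "\<And>t. a \<le> t \<Longrightarrow> t \<le> b \<Longrightarrow> (\<And>u. a \<le> u \<Longrightarrow> u < t \<Longrightarrow> N u > 0) \<Longrightarrow> N t = 0 \<Longrightarrow> N' t > 0"
    and t: "a \<le> t" "t \<le> b"
  shows "N t > 0"
proof (rule ccontr)
  assume neg: "\<not> N t > 0"
  define S where "S = {u \<in> {a..t}. N u \<le> 0}"
  define i where "i = Inf S"
  have tS: "t \<in> S" using neg t by (auto simp: S_def)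
  have bdd: "bdd_below S" by (auto simp: S_def intro: bdd_belowI[of _ a])
  have cN: "continuous_on {a..t} N"
    using d t by (intro continuous_at_imp_continuous_on ballI DERIV_isCont[OF d]) auto
  have "closed ({a..t} \<inter> N -` {..0})"
    using cN by (intro continuous_closed_preimage) auto
  moreover have "{a..t} \<inter> N -` {..0} = S" by (auto simp: S_def)
  ultimately have "closed S" by simp
  then have iS: "i \<in> S" unfolding i_def using tS bdd by (intro closed_contains_Inf) auto
  have before: "N u > 0" if "a \<le> u" "u < i" for u
  proof (rule ccontr)
    assume "\<not> N u > 0"
    then have "u \<in> S" using that iS by (auto simp: S_def)
    then have "i \<le> u" unfolding i_def using bdd by (intro cInf_lower)
    with that show False by simp
  qed
  have ai: "a < i" using iS a by (cases "i = a") (auto simp: S_def)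
  have "N i = 0"
  proof (rule ccontr)
    assume "N i \<noteq> 0"
    hence "N i < 0" using iS by (auto simp: S_def)
    moreover have "isCont N i" using d[of i] iS t by (intro DERIV_isCont) (auto simp: S_def)
    ultimately have "eventually (\<lambda>u. N u < 0) (at i)"
      by (intro order_tendstoD(2)[of N "N i"]) (auto simp: isCont_def)
    then have "eventually (\<lambda>u. N u < 0) (at_left i)" by (simp add: eventually_at_split)
    then have "eventually (\<lambda>u. N u < 0 \<and> u > a \<and> u < i) (at_left i)"
      using eventually_at_left_real[OF ai] by eventually_elim auto
    then obtain u where "N u < 0" "u > a" "u < i"
      using eventually_happens trivial_limit_at_left_real by blast
    with before[of u] show False by simp
  qed
  then have "N' i > 0" using pos[of i] before iS t by (auto simp: S_def)
  then obtain e where e: "e > 0" "\<And>h. 0 < h \<Longrightarrow> h < e \<Longrightarrow> N (i - h) < N i"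
    using DERIV_pos_inc_left[of N "N' i" i] d[of i] iS t by (auto simp: S_def)
  define h where "h = min (e / 2) (i - a)"
  have "0 < h" "h < e" "a \<le> i - h" using e(1) ai by (auto simp: h_def)
  then show False using e(2)[of h] before[of "i - h"] \<open>N i = 0\<close> by auto
qed

lemma nondecreasing_bounded_convergent_at_top:
  fixes f :: "real \<Rightarrow> real"
  assumes mono: "\<And>x y. T \<le> x \<Longrightarrow> x \<le> y \<Longrightarrow> f x \<le> f y" and bd: "\<And>x. T \<le> x \<Longrightarrow> f x \<le> B"
  obtains L where "(f \<longlongrightarrow> L) at_top"
proof
  have bdd: "bdd_above (f ` {T..})" using bd by (auto intro: bdd_aboveI[of _ B])
  show "(f \<longlongrightarrow> Sup (f ` {T..})) at_top"
  proof (rule order_tendstoI)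
    fix a assume "a < Sup (f ` {T..})"
    then obtain x where x: "x \<ge> T" "a < f x" using less_cSupD[of "f ` {T..}" a] by auto
    show "eventually (\<lambda>x. a < f x) at_top"
      using eventually_ge_at_top[of x] by eventually_elim (use x mono in force)
  next
    fix a assume a: "Sup (f ` {T..}) < a"
    show "eventually (\<lambda>x. f x < a) at_top"
      using eventually_ge_at_top[of T]
      by eventually_elim (use cSup_upper[OF _ bdd] a in force)
  qed
qed

text \<open>A bounded primitive \<open>q\<close> replaces an integrable majorant. Both
  \<open>f + q\<close> and \<open>q - f\<close> are nondecreasing; the second, with the bound on
  \<open>q\<close>, keeps the first bounded, so \<open>q\<close> and \<open>f + q\<close>
  converge.\<close>

lemma dominated_derivative_convergent_at_top:
  fixes f q :: "real \<Rightarrow> real"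
  assumes f: "\<And>t. T \<le> t \<Longrightarrow> (f has_real_derivative f' t) (at t)"
    and q: "\<And>t. T \<le> t \<Longrightarrow> (q has_real_derivative q' t) (at t)"
    and le: "\<And>t. T \<le> t \<Longrightarrow> \<bar>f' t\<bar> \<le> q' t" and B: "\<And>t. T \<le> t \<Longrightarrow> q t \<le> B"
  obtains L where "(f \<longlongrightarrow> L) at_top"
proof -
  have mq: "q x \<le> q y" if "T \<le> x" "x \<le> y" for x y
  proof (rule DERIV_nonneg_imp_nondecreasing[OF that(2)])
    fix z assume "x \<le> z" "z \<le> y"
    then have "(q has_real_derivative q' z) (at z)" "q' z \<ge> 0" using q[of z] le[of z] that by auto
    then show "\<exists>y. (q has_real_derivative y) (at z) \<and> 0 \<le> y" by blast
  qed
  have mfq: "f x + q x \<le> f y + q y" if "T \<le> x" "x \<le> y" for x y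
  proof (rule DERIV_nonneg_imp_nondecreasing[OF that(2)])
    fix z assume "x \<le> z" "z \<le> y"
    then have "((\<lambda>x. f x + q x) has_real_derivative f' z + q' z) (at z)" "f' z + q' z \<ge> 0"
      using q[of z] f[of z] le[of z] that by (auto intro!: DERIV_add)
    then show "\<exists>y. ((\<lambda>x. f x + q x) has_real_derivative y) (at z) \<and> 0 \<le> y" by blast
  qed
  have mfq': "q x - f x \<le> q y - f y" if "T \<le> x" "x \<le> y" for x y
  proof (rule DERIV_nonneg_imp_nondecreasing[OF that(2)])
    fix z assume "x \<le> z" "z \<le> y"
    then have "((\<lambda>x. q x - f x) has_real_derivative q' z - f' z) (at z)" "q' z - f' z \<ge> 0"
      using q[of z] f[of z] le[of z] that by (auto intro!: DERIV_diff)
    then show "\<exists>y. ((\<lambda>x. q x - f x) has_real_derivative y) (at z) \<and> 0 \<le> y" by blast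
  qed
  obtain L1 where L1: "(q \<longlongrightarrow> L1) at_top"
    using nondecreasing_bounded_convergent_at_top[of T q B] mq B by blast
  have "f x + q x \<le> f T - q T + 2 * B" if "T \<le> x" for x
    using mfq'[OF _ that] B[OF that] by simp
  then obtain L2 where "((\<lambda>x. f x + q x) \<longlongrightarrow> L2) at_top"
    using nondecreasing_bounded_convergent_at_top[of T "\<lambda>x. f x + q x"] mfq by metis
  from tendsto_diff[OF this L1] show ?thesis by (intro that[of "L2 - L1"]) simp
qed

lemma exp_bounded_derivative_convergent_at_bot:
  fixes f :: "real \<Rightarrow> real"
  assumes f: "\<And>t. t \<le> T \<Longrightarrow> (f has_real_derivative f' t) (at t)"
    and le: "\<And>t. t \<le> T \<Longrightarrow> \<bar>f' t\<bar> \<le> C * exp (k * t)" and k: "k > 0"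
  obtains L where "(f \<longlongrightarrow> L) at_bot"
proof -
  have C: "C \<ge> 0" using le[of T] by (smt (verit) exp_gt_zero mult_neg_pos order_refl)
  obtain L where "((\<lambda>t. f (- t)) \<longlongrightarrow> L) at_top"
  proof (rule dominated_derivative_convergent_at_top[of "- T" "\<lambda>t. f (- t)" "\<lambda>t. - f' (- t)"
        "\<lambda>t. - (C / k) * exp (- (k * t))" "\<lambda>t. C * exp (- (k * t))" 0])
    show "((\<lambda>t. f (- t)) has_real_derivative - f' (- t)) (at t)" if "- T \<le> t" for t
      using DERIV_chain2[OF f[of "- t"] DERIV_minus[OF DERIV_ident]] that by simp
  qed (use le[of "- _"] C k in \<open>auto intro!: derivative_eq_intros simp: field_simps\<close>)
  then show ?thesis using that by (simp add: filterlim_at_bot_mirror)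
qed

text \<open>The functions \<open>C / k * exp (k t) + f\<close> and
  \<open>C / k * exp (k t) - f\<close> are nondecreasing, and are compared with their limits at
  minus infinity. This is integration from minus infinity: each use keeps the rate \<open>k\<close>
  and divides the constant by \<open>k\<close>.\<close>

lemma exp_bounded_derivative_bound_at_bot:
  fixes f :: "real \<Rightarrow> real"
  assumes f: "\<And>t. t \<le> T \<Longrightarrow> (f has_real_derivative f' t) (at t)"
    and le: "\<And>t. t \<le> T \<Longrightarrow> \<bar>f' t\<bar> \<le> C * exp (k * t)" and k: "k > 0"
    and L: "(f \<longlongrightarrow> L) at_bot" and t: "t \<le> T"
  shows "\<bar>f t - L\<bar> \<le> C / k * exp (k * t)"
proof -
  have e0: "((\<lambda>u. C / k * exp (k * u)) \<longlongrightarrow> C / k * 0) at_bot"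
    using k by (intro tendsto_mult tendsto_const) real_asymp
  have 1: "f u + C / k * exp (k * u) \<le> f t + C / k * exp (k * t)" if "u \<le> t" for u
  proof (rule DERIV_nonneg_imp_nondecreasing[OF that])
    fix z assume z: "u \<le> z" "z \<le> t"
    have "((\<lambda>u. f u + C / k * exp (k * u)) has_real_derivative f' z + C * exp (k * z)) (at z)"
      using k z t by (auto intro!: derivative_eq_intros f)
    moreover have "f' z + C * exp (k * z) \<ge> 0" using le[of z] z t by auto
    ultimately show "\<exists>y. ((\<lambda>u. f u + C / k * exp (k * u)) has_real_derivative y) (at z) \<and> 0 \<le> y" by blast
  qed
  have 2: "C / k * exp (k * u) - f u \<le> C / k * exp (k * t) - f t" if "u \<le> t" for u
  proof (rule DERIV_nonneg_imp_nondecreasing[OF that])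
    fix z assume z: "u \<le> z" "z \<le> t"
    have "((\<lambda>u. C / k * exp (k * u) - f u) has_real_derivative C * exp (k * z) - f' z) (at z)"
      using k z t by (auto intro!: derivative_eq_intros f)
    moreover have "C * exp (k * z) - f' z \<ge> 0" using le[of z] z t by auto
    ultimately show "\<exists>y. ((\<lambda>u. C / k * exp (k * u) - f u) has_real_derivative y) (at z) \<and> 0 \<le> y" by blast
  qed
  have "L + C / k * 0 \<le> f t + C / k * exp (k * t)"
    by (rule tendsto_upperbound[OF tendsto_add[OF L e0]])
       (use 1 in \<open>auto intro: eventually_mono[OF eventually_le_at_bot[of t]]\<close>)
  moreover have "C / k * 0 - L \<le> C / k * exp (k * t) - f t"
    by (rule tendsto_upperbound[OF tendsto_diff[OF e0 L]])
       (use 2 in \<open>auto intro: eventually_mono[OF eventually_le_at_bot[of t]]\<close>)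
  ultimately show ?thesis by simp
qed

text \<open>The rule for the form \<open>0 / 0\<close>. Since \<open>g' < 0\<close> and
  \<open>g\<close> tends to \<open>0\<close>, \<open>g\<close> is positive; for \<open>c\<close> on
  either side of \<open>L\<close> the function \<open>f - c g\<close> is eventually monotone with
  limit \<open>0\<close>, which fixes its sign.\<close>

lemma lhopital_zero_at_top:
  fixes f g :: "real \<Rightarrow> real"
  assumes f: "eventually (\<lambda>t. (f has_real_derivative f' t) (at t)) at_top"
    and g: "eventually (\<lambda>t. (g has_real_derivative g' t) (at t)) at_top"
    and g0: "eventually (\<lambda>t. g' t < 0) at_top"
    and f_lim: "(f \<longlongrightarrow> 0) at_top" and g_lim: "(g \<longlongrightarrow> 0) at_top"
    and lim: "((\<lambda>t. f' t / g' t) \<longlongrightarrow> L) at_top"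
  shows "((\<lambda>t. f t / g t) \<longlongrightarrow> L) at_top"
proof -
  obtain T where T: "\<And>t. t \<ge> T \<Longrightarrow> (f has_real_derivative f' t) (at t)"
     "\<And>t. t \<ge> T \<Longrightarrow> (g has_real_derivative g' t) (at t)" "\<And>t. t \<ge> T \<Longrightarrow> g' t < 0"
    using eventually_conj[OF f eventually_conj[OF g g0]] unfolding eventually_at_top_linorder by auto
  have gpos: "g t > 0" if "t \<ge> T" for t
  proof -
    have dec: "g v < g u" if "u < v" "u \<ge> T" for u v
    proof (rule DERIV_neg_imp_decreasing[OF that(1)])
      fix x assume "u \<le> x"
      then show "\<exists>y. (g has_real_derivative y) (at x) \<and> y < 0" using T(2,3)[of x] that by auto
    qed
    have "0 \<le> g (t + 1)"
      by (rule tendsto_upperbound[OF g_lim])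
         (use dec[of "t + 1"] that in \<open>auto intro!: eventually_mono[OF eventually_gt_at_top[of "t + 1"]] less_imp_le\<close>)
    also have "g (t + 1) < g t" using dec[of t "t + 1"] that by simp
    finally show ?thesis .
  qed
  have upper: "eventually (\<lambda>t. f t / g t \<le> c) at_top"
    if "L < c" for c
  proof -
    have "eventually (\<lambda>t. f' t / g' t < c) at_top" using lim that by (rule order_tendstoD)
    then obtain T1 where T1: "\<And>t. t \<ge> T1 \<Longrightarrow> f' t / g' t < c" unfolding eventually_at_top_linorder by auto
    show ?thesis using eventually_ge_at_top[of "max T T1"]
    proof eventually_elim
      case (elim t)
      have "f t - c * g t \<le> f u - c * g u" if "u > t" for u
      proof (rule DERIV_nonneg_imp_nondecreasing[of t u "\<lambda>z. f z - c * g z"])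
        fix z assume "t \<le> z"
        then have "((\<lambda>z. f z - c * g z) has_real_derivative f' z - c * g' z) (at z)"
          using elim T by (intro DERIV_diff DERIV_cmult) auto
        moreover have "f' z - c * g' z \<ge> 0"
          using T1[of z] T(3)[of z] elim \<open>t \<le> z\<close> by (simp add: divide_less_eq)
        ultimately show "\<exists>y. ((\<lambda>z. f z - c * g z) has_real_derivative y) (at z) \<and> 0 \<le> y" by blast
      qed (use that in auto)
      then have "f t - c * g t \<le> 0 - c * 0"
        by (intro tendsto_lowerbound[OF tendsto_diff[OF f_lim tendsto_mult[OF tendsto_const g_lim]]]
             eventually_mono[OF eventually_gt_at_top[of t]]) auto
      then show ?case using gpos[of t] elim by (simp add: divide_le_eq)
    qed
  qed
  have lower: "eventually (\<lambda>t. f t / g t \<ge> c) at_top"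
    if "L > c" for c
  proof -
    have "eventually (\<lambda>t. f' t / g' t > c) at_top" using lim that by (rule order_tendstoD)
    then obtain T1 where T1: "\<And>t. t \<ge> T1 \<Longrightarrow> f' t / g' t > c" unfolding eventually_at_top_linorder by auto
    show ?thesis using eventually_ge_at_top[of "max T T1"]
    proof eventually_elim
      case (elim t)
      have "c * g t - f t \<le> c * g u - f u" if "u > t" for u
      proof (rule DERIV_nonneg_imp_nondecreasing[of t u "\<lambda>z. c * g z - f z"])
        fix z assume "t \<le> z"
        then have "((\<lambda>z. c * g z - f z) has_real_derivative c * g' z - f' z) (at z)"
          using elim T by (intro DERIV_diff DERIV_cmult) auto
        moreover have "c * g' z - f' z \<ge> 0"
          using T1[of z] T(3)[of z] elim \<open>t \<le> z\<close> by (simp add: less_divide_eq)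
        ultimately show "\<exists>y. ((\<lambda>z. c * g z - f z) has_real_derivative y) (at z) \<and> 0 \<le> y" by blast
      qed (use that in auto)
      then have "c * g t - f t \<le> c * 0 - 0"
        by (intro tendsto_lowerbound[OF tendsto_diff[OF tendsto_mult[OF tendsto_const g_lim] f_lim]]
             eventually_mono[OF eventually_gt_at_top[of t]]) auto
      then show ?case using gpos[of t] elim by (simp add: le_divide_eq)
    qed
  qed
  show ?thesis
  proof (rule order_tendstoI)
    fix a assume "a < L"
    then have "L > (a + L) / 2" "a < (a + L) / 2" by auto
    then show "eventually (\<lambda>t. a < f t / g t) at_top"
      using eventually_mono[OF lower[OF \<open>L > (a + L) / 2\<close>]] by (meson less_le_trans)
  next
    fix a assume "L < a"
    then have "L < (a + L) / 2" "a > (a + L) / 2" by auto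
    then show "eventually (\<lambda>t. a > f t / g t) at_top"
      using eventually_mono[OF upper[OF \<open>L < (a + L) / 2\<close>]] by (meson le_less_trans)
  qed
qed

lemma antiderivative_exists:
  fixes f :: "real \<Rightarrow> real"
  assumes "\<And>t. t > T \<Longrightarrow> isCont f t"
  obtains F where "\<And>t. t > T \<Longrightarrow> (F has_real_derivative f t) (at t)"
  using einterval_antiderivative[of "ereal T" \<infinity> f] assms
  by (auto simp: has_real_derivative_iff_has_vector_derivative)

section \<open>The initial value problem\<close>

text \<open>The equation \<open>f''' + f f'' = k f'\<^sup>2\<close> as a first order system, with \<open>k = (m - 1) / m\<close> in the application.\<close>

definition ode_sol :: "real \<Rightarrow> real set \<Rightarrow> (real \<Rightarrow> real) \<Rightarrow> (real \<Rightarrow> real) \<Rightarrow> (real \<Rightarrow> real) \<Rightarrow> bool" where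
  "ode_sol k S f g h \<longleftrightarrow> (\<forall>t\<in>S. (f has_real_derivative g t) (at t) \<and>
     (g has_real_derivative h t) (at t) \<and>
     (h has_real_derivative k * (g t)\<^sup>2 - f t * h t) (at t))"

lemma ode_solD:
  assumes "ode_sol k S f g h" "t \<in> S"
  shows "(f has_real_derivative g t) (at t)" "(g has_real_derivative h t) (at t)"
    "(h has_real_derivative k * (g t)\<^sup>2 - f t * h t) (at t)"
  using assms by (auto simp: ode_sol_def)

lemma ode_sol_subset: "ode_sol k S f g h \<Longrightarrow> S' \<subseteq> S \<Longrightarrow> ode_sol k S' f g h"
  by (auto simp: ode_sol_def)

lemma ode_sol_shift:
  assumes "ode_sol k S f g h"
  shows "ode_sol k {t. t + c \<in> S} (\<lambda>t. f (t + c)) (\<lambda>t. g (t + c)) (\<lambda>t. h (t + c))"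
  using assms unfolding ode_sol_def by (auto simp: DERIV_shift)

lemma ode_sol_scale:
  assumes "ode_sol k S f g h"
  shows "ode_sol k {t. a * t \<in> S} (\<lambda>t. a * f (a * t)) (\<lambda>t. a^2 * g (a * t)) (\<lambda>t. a^3 * h (a * t))"
  unfolding ode_sol_def
proof (intro ballI conjI)
  fix t assume "t \<in> {t. a * t \<in> S}"
  then have d: "(f has_real_derivative g (a * t)) (at (a * t))"
    "(g has_real_derivative h (a * t)) (at (a * t))"
    "(h has_real_derivative k * (g (a * t))\<^sup>2 - f (a * t) * h (a * t)) (at (a * t))"
    using ode_solD[OF assms] by auto
  have a: "((*) a has_real_derivative a) (at t)" by (auto intro!: derivative_eq_intros)
  show "((\<lambda>t. a * f (a * t)) has_real_derivative a^2 * g (a * t)) (at t)"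
    using DERIV_cmult[OF DERIV_chain2[OF d(1) a], of a] by (simp add: power2_eq_square mult_ac)
  show "((\<lambda>t. a^2 * g (a * t)) has_real_derivative a^3 * h (a * t)) (at t)"
    using DERIV_cmult[OF DERIV_chain2[OF d(2) a], of "a^2"] by (simp add: power2_eq_square power3_eq_cube mult_ac)
  show "((\<lambda>t. a^3 * h (a * t)) has_real_derivative
      k * (a^2 * g (a * t))\<^sup>2 - a * f (a * t) * (a^3 * h (a * t))) (at t)"
    using DERIV_cmult[OF DERIV_chain2[OF d(3) a], of "a^3"]
    by (simp add: power2_eq_square power3_eq_cube algebra_simps)
qed

lemma ode_sol_cong_open:
  assumes s: "ode_sol k S f g h" and op: "open U" "U \<subseteq> S"
    and eq: "\<And>t. t \<in> U \<Longrightarrow> f' t = f t" "\<And>t. t \<in> U \<Longrightarrow> g' t = g t" "\<And>t. t \<in> U \<Longrightarrow> h' t = h t"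
  shows "ode_sol k U f' g' h'"
  unfolding ode_sol_def
proof (intro ballI conjI)
  fix t assume t: "t \<in> U"
  then have tS: "t \<in> S" using op by auto
  show "(f' has_real_derivative g' t) (at t)"
    using has_field_derivative_transform_within_open[OF ode_solD(1)[OF s tS] op(1) t, of f'] eq t by simp
  show "(g' has_real_derivative h' t) (at t)"
    using has_field_derivative_transform_within_open[OF ode_solD(2)[OF s tS] op(1) t, of g'] eq t by simp
  show "(h' has_real_derivative k * (g' t)\<^sup>2 - f' t * h' t) (at t)"
    using has_field_derivative_transform_within_open[OF ode_solD(3)[OF s tS] op(1) t, of h'] eq t by simp
qed

lemma ode_sol_derivs_eq:
  assumes s1: "ode_sol k S f1 g1 h1" and s2: "ode_sol k S f2 g2 h2" and op: "open S"
    and eq: "\<And>t. t \<in> S \<Longrightarrow> f1 t = f2 t" and t: "t \<in> S"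
  shows "g1 t = g2 t" "h1 t = h2 t"
proof -
  have g: "g1 t = g2 t" if t: "t \<in> S" for t
    using has_field_derivative_transform_within_open[OF ode_solD(1)[OF s1 t] op t, of f2]
      ode_solD(1)[OF s2 t] eq DERIV_unique by blast
  show "g1 t = g2 t" using g t .
  show "h1 t = h2 t"
    using has_field_derivative_transform_within_open[OF ode_solD(2)[OF s1 t] op t, of g2]
      ode_solD(2)[OF s2 t] g DERIV_unique by blast
qed

section \<open>Uniqueness for the initial value problem\<close>

lemma gronwall_zero:
  fixes V :: "real \<Rightarrow> real"
  assumes V: "\<And>t. a \<le> t \<Longrightarrow> t \<le> b \<Longrightarrow> (V has_real_derivative V' t) (at t)"
    and le: "\<And>t. a \<le> t \<Longrightarrow> t \<le> b \<Longrightarrow> V' t \<le> C * V t" and "V a = 0" "a \<le> b" "V b \<ge> 0"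
  shows "V b = 0"
proof -
  have "V b * exp (- C * b) \<le> V a * exp (- C * a)"
  proof (rule DERIV_nonpos_imp_nonincreasing[OF \<open>a \<le> b\<close>])
    fix t assume t: "a \<le> t" "t \<le> b"
    have "((\<lambda>t. V t * exp (- C * t)) has_real_derivative (V' t - C * V t) * exp (- C * t)) (at t)"
      by (auto intro!: derivative_eq_intros V t simp: algebra_simps)
    moreover have "(V' t - C * V t) * exp (- C * t) \<le> 0"
      using le[OF t] by (intro mult_nonpos_nonneg) auto
    ultimately show "\<exists>y. ((\<lambda>t. V t * exp (- C * t)) has_real_derivative y) (at t) \<and> y \<le> 0" by blast
  qed
  then show ?thesis using assms by (simp add: mult_le_0_iff)
qed

text \<open>Gronwall for the squared distance \<open>V\<close>. The nonlinear terms are linear in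
  the differences, by \<open>g1^2 - g2^2 = (g1 + g2) y\<close> and
  \<open>f1 h1 - f2 h2 = f1 z + h2 x\<close>, with coefficients bounded by \<open>B\<close> on the
  compact interval; \<open>2 u v <= u^2 + v^2\<close> then gives the rate
  \<open>2 + 4 B\<close>.\<close>

lemma ode_sol_unique_forward:
  assumes s1: "ode_sol k S f1 g1 h1" and s2: "ode_sol k S f2 g2 h2" and sub: "{a..b} \<subseteq> S" "a \<le> b"
    and eq: "f1 a = f2 a" "g1 a = g2 a" "h1 a = h2 a"
  shows "f1 b = f2 b" "g1 b = g2 b" "h1 b = h2 b"
proof -
  note d1 = ode_solD[OF s1] and d2 = ode_solD[OF s2]
  have cont: "continuous_on {a..b} f1" "continuous_on {a..b} g1" "continuous_on {a..b} g2" "continuous_on {a..b} h2"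
    using sub d1 d2 by (intro continuous_at_imp_continuous_on ballI; blast intro: DERIV_isCont)+
  obtain B where B: "\<And>t. t \<in> {a..b} \<Longrightarrow> \<bar>f1 t\<bar> + \<bar>h2 t\<bar> + \<bar>k * (g1 t + g2 t)\<bar> \<le> B"
  proof -
    have "continuous_on {a..b} (\<lambda>t. \<bar>f1 t\<bar> + \<bar>h2 t\<bar> + \<bar>k * (g1 t + g2 t)\<bar>)"
      using cont by (intro continuous_intros)
    then obtain x where "\<forall>y\<in>{a..b}. \<bar>f1 y\<bar> + \<bar>h2 y\<bar> + \<bar>k * (g1 y + g2 y)\<bar> \<le> \<bar>f1 x\<bar> + \<bar>h2 x\<bar> + \<bar>k * (g1 x + g2 x)\<bar>"
      using continuous_attains_sup[of "{a..b}" "\<lambda>t. \<bar>f1 t\<bar> + \<bar>h2 t\<bar> + \<bar>k * (g1 t + g2 t)\<bar>"] sub(2)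
      by auto
    then show ?thesis using that by blast
  qed
  define x y z where "x = (\<lambda>t. f1 t - f2 t)" and "y = (\<lambda>t. g1 t - g2 t)" and "z = (\<lambda>t. h1 t - h2 t)"
  define V where "V = (\<lambda>t. (x t)\<^sup>2 + (y t)\<^sup>2 + (z t)\<^sup>2)"
  define V' where "V' = (\<lambda>t. 2 * x t * y t + 2 * y t * z t
      + 2 * z t * (k * (g1 t + g2 t) * y t - f1 t * z t - h2 t * x t))"
  have "V b = 0"
  proof (rule gronwall_zero[of a b V V' "2 + 4 * B"])
    fix t assume "a \<le> t" "t \<le> b"
    then have t: "t \<in> S" "t \<in> {a..b}" using sub by auto
    show "(V has_real_derivative V' t) (at t)" unfolding V_def V'_def x_def y_def z_def
      by (auto intro!: derivative_eq_intros d1[OF t(1)] d2[OF t(1)] simp: power2_eq_square algebra_simps)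
    have b: "\<bar>f1 t\<bar> \<le> B" "\<bar>h2 t\<bar> \<le> B" "\<bar>k * (g1 t + g2 t)\<bar> \<le> B" "B \<ge> 0" using B[OF t(2)] by linarith+
    have sq: "2 * \<bar>u * v\<bar> \<le> u\<^sup>2 + v\<^sup>2" for u v :: real
      using sum_squares_bound[of "\<bar>u\<bar>" "\<bar>v\<bar>"] by (simp add: abs_mult)
    have p: "2 * (c * (u * v)) \<le> B * (u\<^sup>2 + v\<^sup>2)" if "\<bar>c\<bar> \<le> B" for c u v :: real
    proof -
      have "2 * (c * (u * v)) \<le> 2 * (\<bar>c\<bar> * \<bar>u * v\<bar>)" by (simp add: abs_mult[symmetric])
      also have "\<dots> = \<bar>c\<bar> * (2 * \<bar>u * v\<bar>)" by simp
      also have "\<dots> \<le> B * (u\<^sup>2 + v\<^sup>2)" using that sq b(4) by (intro mult_mono) auto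
      finally show ?thesis .
    qed
    have "V' t = 2 * (x t * y t) + 2 * (y t * z t) + 2 * ((k * (g1 t + g2 t)) * (z t * y t))
       + 2 * ((- f1 t) * (z t * z t)) + 2 * ((- h2 t) * (z t * x t))"
      by (simp add: V'_def algebra_simps)
    also have "\<dots> \<le> ((x t)\<^sup>2 + (y t)\<^sup>2) + ((y t)\<^sup>2 + (z t)\<^sup>2) + B * ((z t)\<^sup>2 + (y t)\<^sup>2)
       + B * ((z t)\<^sup>2 + (z t)\<^sup>2) + B * ((z t)\<^sup>2 + (x t)\<^sup>2)"
      using sq[of "x t" "y t"] sq[of "y t" "z t"] b by (intro add_mono p) auto
    also have "\<dots> \<le> (2 + 4 * B) * V t"
      using b(4) by (auto simp: V_def algebra_simps)
    finally show "V' t \<le> (2 + 4 * B) * V t" .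
  qed (use eq sub in \<open>auto simp: V_def x_def y_def z_def\<close>)
  then have "x b = 0 \<and> y b = 0 \<and> z b = 0"
    by (simp add: V_def add_nonneg_eq_0_iff)
  then show "f1 b = f2 b" "g1 b = g2 b" "h1 b = h2 b" by (auto simp: x_def y_def z_def)
qed

lemma ode_sol_unique_extension:
  assumes s1: "ode_sol k {..<T} f1 g1 h1" and s2: "ode_sol k {..<T} f2 g2 h2"
    and T0: "T0 \<le> T" and eq: "\<And>t. t < T0 \<Longrightarrow> f1 t = f2 t" and t: "t < T"
  shows "f1 t = f2 t" "g1 t = g2 t" "h1 t = h2 t"
proof -
  have sub: "ode_sol k {..<T0} f1 g1 h1" "ode_sol k {..<T0} f2 g2 h2"
    using s1 s2 T0 by (auto elim: ode_sol_subset)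
  have e: "g1 u = g2 u" "h1 u = h2 u" if "u < T0" for u
    using ode_sol_derivs_eq[OF sub] eq that by auto
  have "f1 t = f2 t \<and> g1 t = g2 t \<and> h1 t = h2 t"
  proof (cases "t < T0")
    case True then show ?thesis using e eq by auto
  next
    case False
    \<comment> \<open>The forward argument starts at \<open>T0 - 1\<close>: agreement, and with it
      agreement of the derivatives, is known only strictly to the left of \<open>T0\<close>.\<close>
    have "{T0 - 1..t} \<subseteq> {..<T}" using t by auto
    with False show ?thesis
      using ode_sol_unique_forward[OF s1 s2, of "T0 - 1" t] e[of "T0 - 1"] eq[of "T0 - 1"] t by auto
  qed
  then show "f1 t = f2 t" "g1 t = g2 t" "h1 t = h2 t" by auto
qed

section \<open>Local existence by power series\<close>

lemma fps_conv_radius_ge_geometric: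
  fixes F :: "real fps"
  assumes M: "M > 0" and le: "\<And>n. \<bar>fps_nth F n\<bar> \<le> C * M ^ n"
  shows "fps_conv_radius F \<ge> ereal (1 / M)"
  unfolding fps_conv_radius_def
proof (rule conv_radius_geI_ex')
  fix r :: real assume r: "0 < r" "ereal r < ereal (1 / M)"
  show "summable (\<lambda>n. fps_nth F n * of_real r ^ n)"
  proof (rule summable_comparison_test')
    have "norm (M * r) < 1" using r M by (simp add: field_simps)
    then show "summable (\<lambda>n. C * (M * r) ^ n)" by (intro summable_mult summable_geometric)
    show "norm (fps_nth F n * of_real r ^ n) \<le> C * (M * r) ^ n" for n
      using mult_right_mono[OF le[of n], of "r ^ n"] r by (simp add: abs_mult power_mult_distrib mult_ac)
  qed
qed

text \<open>A bound \<open>\<bar>c\<^sub>n\<bar> \<le> M\<^bsup>n+1\<^esup>\<close> on the Taylor coefficients propagates through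
  their recursion because \<open>f\<close> has weight one under the scaling \<open>f \<leadsto> a f(a t)\<close>.\<close>

function taylor_coeff :: "real \<Rightarrow> real \<Rightarrow> real \<Rightarrow> real \<Rightarrow> nat \<Rightarrow> real" where
  "taylor_coeff k x y z n = (if n = 0 then x else if n = 1 then y else if n = 2 then z / 2 else
     (\<Sum>j\<in>{..n - 3}. k * (real (j + 1) * taylor_coeff k x y z (j + 1)) *
           (real (n - 3 - j + 1) * taylor_coeff k x y z (n - 3 - j + 1))
         - taylor_coeff k x y z j * (real (n - 3 - j + 1) * real (n - 3 - j + 2) * taylor_coeff k x y z (n - 3 - j + 2)))
       / (real n * real (n - 1) * real (n - 2)))"
  by pat_completeness auto
termination by (relation "Wellfounded.measure (\<lambda>(k, x, y, z, n). n)") auto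
declare taylor_coeff.simps [simp del]

lemma taylor_coeff_Suc3:
  "taylor_coeff k x y z (n + 3) = (\<Sum>j\<in>{..n}. k * (real (j + 1) * taylor_coeff k x y z (j + 1)) *
           (real (n - j + 1) * taylor_coeff k x y z (n - j + 1))
         - taylor_coeff k x y z j * (real (n - j + 1) * real (n - j + 2) * taylor_coeff k x y z (n - j + 2)))
       / (real (n + 3) * real (n + 2) * real (n + 1))"
proof -
  have e: "n + 3 \<noteq> 0" "n + 3 \<noteq> 1" "n + 3 \<noteq> 2" "n + 3 - 3 = n" "n + 3 - 1 = n + 2" "n + 3 - 2 = n + 1" by auto
  show ?thesis by (subst taylor_coeff.simps) (simp only: e if_False)
qed

lemma taylor_coeff_initial [simp]:
  "taylor_coeff k x y z 0 = x" "taylor_coeff k x y z (Suc 0) = y" "taylor_coeff k x y z 2 = z / 2"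
  by (subst taylor_coeff.simps, simp)+

lemma taylor_coeff_bound:
  assumes k: "\<bar>k\<bar> \<le> 1" and M: "M > 0" "\<bar>x\<bar> \<le> M" "\<bar>y\<bar> \<le> M\<^sup>2" "\<bar>z\<bar> \<le> M ^ 3"
  shows "\<bar>taylor_coeff k x y z n\<bar> \<le> M ^ (n + 1)"
proof (induction n rule: less_induct)
  case (less n)
  let ?c = "taylor_coeff k x y z"
  have "n = 0 \<or> n = 1 \<or> n = 2 \<or> (\<exists>p. n = p + 3)" by presburger
  then consider "n = 0" | "n = 1" | "n = 2" | p where "n = p + 3" by blast
  then show ?case
  proof cases
    case 4
    have t: "\<bar>k * (real (j + 1) * ?c (j + 1)) * (real (p - j + 1) * ?c (p - j + 1))
         - ?c j * (real (p - j + 1) * real (p - j + 2) * ?c (p - j + 2))\<bar>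
         \<le> real (p - j + 1) * real (p + 3) * M ^ (p + 4)" if j: "j \<le> p" for j
    proof -
      have "\<bar>k * (real (j + 1) * ?c (j + 1)) * (real (p - j + 1) * ?c (p - j + 1))\<bar>
        = \<bar>k\<bar> * (real (j + 1) * \<bar>?c (j + 1)\<bar>) * (real (p - j + 1) * \<bar>?c (p - j + 1)\<bar>)"
        by (simp add: abs_mult)
      also have "\<dots> \<le> 1 * (real (j + 1) * M ^ (j + 2)) * (real (p - j + 1) * M ^ (p - j + 2))"
        using k M less[of "j + 1"] less[of "p - j + 1"] j 4
        by (intro mult_mono) (auto simp: numeral_2_eq_2)
      also have "\<dots> = real (j + 1) * real (p - j + 1) * M ^ ((j + 2) + (p - j + 2))"
        by (simp only: power_add mult_ac mult_1)
      also have "(j + 2) + (p - j + 2) = p + 4" using j by simp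
      finally have 1: "\<bar>k * (real (j + 1) * ?c (j + 1)) * (real (p - j + 1) * ?c (p - j + 1))\<bar>
         \<le> real (j + 1) * real (p - j + 1) * M ^ (p + 4)" .
      have "\<bar>?c j * (real (p - j + 1) * real (p - j + 2) * ?c (p - j + 2))\<bar>
        = \<bar>?c j\<bar> * (real (p - j + 1) * real (p - j + 2) * \<bar>?c (p - j + 2)\<bar>)"
        by (simp add: abs_mult)
      also have "\<dots> \<le> M ^ (j + 1) * (real (p - j + 1) * real (p - j + 2) * M ^ (p - j + 3))"
        using M less[of "j"] less[of "p - j + 2"] j 4
        by (intro mult_mono) (auto simp: numeral_eq_Suc)
      also have "\<dots> = real (p - j + 1) * real (p - j + 2) * M ^ ((j + 1) + (p - j + 3))"
        by (simp only: power_add mult_ac)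
      also have "(j + 1) + (p - j + 3) = p + 4" using j by simp
      finally have 2: "\<bar>?c j * (real (p - j + 1) * real (p - j + 2) * ?c (p - j + 2))\<bar>
         \<le> real (p - j + 1) * real (p - j + 2) * M ^ (p + 4)" .
      have "real (j + 1) * real (p - j + 1) * M ^ (p + 4) + real (p - j + 1) * real (p - j + 2) * M ^ (p + 4)
         = real (p - j + 1) * real (p + 3) * M ^ (p + 4)"
        using j by (simp add: of_nat_diff algebra_simps)
      with 1 2 show ?thesis by linarith
    qed
    \<comment> \<open>Summed over \<open>j\<close>, the bounds give
      \<open>(p + 1) (p + 2) (p + 3) / 2\<close>, half of the denominator of the recursion, so the
      constant in the bound does not grow.\<close>
    have s: "(\<Sum>j\<le>p. real (p - j + 1)) = real (p + 1) * real (p + 2) / 2"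
    proof -
      have "(\<Sum>j\<le>p. real (p - j + 1)) = (\<Sum>j\<le>p. real (j + 1))"
        by (rule sum.reindex_bij_witness[of _ "\<lambda>j. p - j" "\<lambda>j. p - j"]) auto
      also have "\<dots> = real (p + 1) * real (p + 2) / 2" by (induction p) (auto simp: field_simps)
      finally show ?thesis .
    qed
    let ?S = "\<Sum>j\<le>p. k * (real (j + 1) * ?c (j + 1)) * (real (p - j + 1) * ?c (p - j + 1))
         - ?c j * (real (p - j + 1) * real (p - j + 2) * ?c (p - j + 2))"
    have "\<bar>?S\<bar> \<le> (\<Sum>j\<le>p. real (p - j + 1) * real (p + 3) * M ^ (p + 4))"
      by (rule order_trans[OF sum_abs sum_mono]) (use t in auto)
    also have "\<dots> = (\<Sum>j\<le>p. real (p - j + 1)) * (real (p + 3) * M ^ (p + 4))"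
      by (simp only: sum_distrib_right mult.assoc)
    also have "\<dots> \<le> (real (p + 3) * real (p + 2) * real (p + 1)) * M ^ (p + 4)"
      unfolding s using M by (simp add: field_simps)
    finally have "\<bar>?S\<bar> / (real (p + 3) * real (p + 2) * real (p + 1)) \<le> M ^ (p + 4)"
      by (subst divide_le_eq) (auto simp: mult.commute)
    then show ?thesis unfolding 4 taylor_coeff_Suc3 by (simp add: abs_divide abs_mult add.commute)
  qed (use M in \<open>auto simp: power2_eq_square numeral_3_eq_3\<close>)
qed

text \<open>The recursion of the coefficients is the equation for the formal series, and evaluation
  inside the disc transfers it to functions. What matters later is that the radius
  \<open>1 / M\<close> depends only on the size of the data, measured with the weights
  \<open>1, 2, 3\<close> of the scaling.\<close>

lemma ode_sol_local:
  assumes k: "\<bar>k\<bar> \<le> 1" and M: "M > 0" "\<bar>x\<bar> \<le> M" "\<bar>y\<bar> \<le> M\<^sup>2" "\<bar>z\<bar> \<le> M ^ 3"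
  obtains f g h where "ode_sol k {t0 - 1 / M<..<t0 + 1 / M} f g h" "f t0 = x" "g t0 = y" "h t0 = z"
proof -
  define F where "F = Abs_fps (taylor_coeff k x y z)"
  define F1 where "F1 = fps_deriv F"
  define F2 where "F2 = fps_deriv F1"
  define F3 where "F3 = fps_deriv F2"
  have eq: "F3 + F * F2 = fps_const k * F1 * F1"
  proof (rule fps_ext)
    fix n
    have "fps_nth F3 n = real (n + 3) * real (n + 2) * real (n + 1) * taylor_coeff k x y z (n + 3)"
      by (simp add: F3_def F2_def F1_def F_def eval_nat_numeral)
    also have "\<dots> = (\<Sum>j\<in>{..n}. k * (real (j + 1) * taylor_coeff k x y z (j + 1)) *
           (real (n - j + 1) * taylor_coeff k x y z (n - j + 1))
         - taylor_coeff k x y z j * (real (n - j + 1) * real (n - j + 2) * taylor_coeff k x y z (n - j + 2)))"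
      unfolding taylor_coeff_Suc3 times_divide_eq_right by (rule nonzero_mult_div_cancel_left) simp
    also have "\<dots> = fps_nth (fps_const k * F1 * F1) n - fps_nth (F * F2) n"
      by (simp only: fps_mult_left_const_nth mult.assoc)
         (simp add: fps_mult_nth sum_subtractf F2_def F1_def F_def atLeast0AtMost sum_distrib_left
           mult_ac eval_nat_numeral)
    finally show "fps_nth (F3 + F * F2) n = fps_nth (fps_const k * F1 * F1) n" by simp
  qed
  have r: "fps_conv_radius F \<ge> ereal (1 / M)"
    by (rule fps_conv_radius_ge_geometric[of _ _ M])
       (use taylor_coeff_bound[OF k M] M in \<open>auto simp: F_def\<close>)
  have r1: "fps_conv_radius F1 \<ge> ereal (1 / M)" "fps_conv_radius F2 \<ge> ereal (1 / M)" "fps_conv_radius F3 \<ge> ereal (1 / M)"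
    using r fps_conv_radius_deriv[of F] fps_conv_radius_deriv[of F1] fps_conv_radius_deriv[of F2]
    unfolding F1_def[symmetric] F2_def[symmetric] F3_def[symmetric] by (meson order_trans)+
  have D: "((\<lambda>t. eval_fps G (t - t0)) has_real_derivative eval_fps (fps_deriv G) (t - t0)) (at t)"
    if "fps_conv_radius G \<ge> ereal (1 / M)" "\<bar>t - t0\<bar> < 1 / M" for G t
  proof -
    have "ereal (norm (t - t0)) < fps_conv_radius G" using that by (metis ereal_less_eq(3) less_ereal.simps(1) order_less_le_trans real_norm_def)
    from has_field_derivative_eval_fps[OF this, of UNIV]
    show ?thesis using DERIV_shift[of "eval_fps G" _ t "- t0"] by simp
  qed
  have e: "eval_fps F3 u = k * (eval_fps F1 u)\<^sup>2 - eval_fps F u * eval_fps F2 u" if "\<bar>u\<bar> < 1 / M" for u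
  proof -
    have lt: "ereal (norm u) < ereal (1 / M)" using that by simp
    have n: "ereal (norm u) < fps_conv_radius F" "ereal (norm u) < fps_conv_radius F1"
      "ereal (norm u) < fps_conv_radius F2" "ereal (norm u) < fps_conv_radius F3"
      using lt r r1 by (meson order_less_le_trans)+
    have nn: "ereal (norm u) < fps_conv_radius (F * F2)" "ereal (norm u) < fps_conv_radius (fps_const k * F1)"
      using n order_less_le_trans[OF _ fps_conv_radius_mult[of F F2]] order_less_le_trans[OF _ fps_conv_radius_mult[of "fps_const k" F1]]
      by auto
    have "eval_fps (F3 + F * F2) u = eval_fps (fps_const k * F1 * F1) u" using eq by simp
    then have "eval_fps F3 u + eval_fps F u * eval_fps F2 u = k * eval_fps F1 u * eval_fps F1 u"
      using n nn by (simp add: eval_fps_add eval_fps_mult)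
    then show ?thesis by (simp add: power2_eq_square algebra_simps)
  qed
  show ?thesis
  proof (rule that[of "\<lambda>t. eval_fps F (t - t0)" "\<lambda>t. eval_fps F1 (t - t0)" "\<lambda>t. eval_fps F2 (t - t0)"])
    show "ode_sol k {t0 - 1 / M<..<t0 + 1 / M} (\<lambda>t. eval_fps F (t - t0))
       (\<lambda>t. eval_fps F1 (t - t0)) (\<lambda>t. eval_fps F2 (t - t0))"
      unfolding ode_sol_def
    proof (intro ballI conjI)
      fix t assume "t \<in> {t0 - 1 / M<..<t0 + 1 / M}"
      then have t: "\<bar>t - t0\<bar> < 1 / M" by auto
      show "((\<lambda>t. eval_fps F (t - t0)) has_real_derivative eval_fps F1 (t - t0)) (at t)"
        using D[OF r t] by (simp add: F1_def)
      show "((\<lambda>t. eval_fps F1 (t - t0)) has_real_derivative eval_fps F2 (t - t0)) (at t)"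
        using D[OF r1(1) t] by (simp add: F2_def)
      show "((\<lambda>t. eval_fps F2 (t - t0)) has_real_derivative
         k * (eval_fps F1 (t - t0))\<^sup>2 - eval_fps F (t - t0) * eval_fps F2 (t - t0)) (at t)"
        using D[OF r1(2) t] e[OF t] by (simp add: F3_def)
    qed
  qed (simp_all add: eval_fps_at_0 F_def F1_def F2_def numeral_2_eq_2[symmetric])
qed

text \<open>If the times of existence were bounded with supremum \<open>T1\<close>, the a priori
  bound up to \<open>T1\<close> would give one radius \<open>1 / M\<close> for all restarts, and a
  restart close to \<open>T1\<close> would pass it. The bound is required only for solutions that
  continue \<open>f0\<close>, because in the application it depends on the behaviour at minus
  infinity.\<close>

lemma ode_sol_global:
  assumes k: "\<bar>k\<bar> \<le> 1" and base: "ode_sol k {..<T0} f0 g0 h0"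
    and apriori: "\<And>T. \<exists>M\<ge>1. \<forall>T' f g h. T0 \<le> T' \<and> T' \<le> T \<and> ode_sol k {..<T'} f g h \<and> (\<forall>t<T0. f t = f0 t) \<longrightarrow>
        (\<forall>t. T0 - 1 \<le> t \<and> t < T' \<longrightarrow> \<bar>f t\<bar> \<le> M \<and> \<bar>g t\<bar> \<le> M\<^sup>2 \<and> \<bar>h t\<bar> \<le> M ^ 3)"
  obtains f g h where "ode_sol k UNIV f g h" "\<And>t. t < T0 \<Longrightarrow> f t = f0 t"
proof -
  define A where "A = {T. T \<ge> T0 \<and> (\<exists>f g h. ode_sol k {..<T} f g h \<and> (\<forall>t<T0. f t = f0 t))}"
  have T0A: "T0 \<in> A" using base by (auto simp: A_def)
  have "\<not> bdd_above A"
  proof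
    assume bdd: "bdd_above A"
    define T1 where "T1 = Sup A"
    have T1: "T \<le> T1" if "T \<in> A" for T unfolding T1_def using bdd that by (intro cSup_upper)
    obtain M where M: "M \<ge> 1" and Mb: "\<And>T' f g h t. T0 \<le> T' \<Longrightarrow> T' \<le> T1 \<Longrightarrow> ode_sol k {..<T'} f g h \<Longrightarrow>
       (\<forall>t<T0. f t = f0 t) \<Longrightarrow> T0 - 1 \<le> t \<Longrightarrow> t < T' \<Longrightarrow> \<bar>f t\<bar> \<le> M \<and> \<bar>g t\<bar> \<le> M\<^sup>2 \<and> \<bar>h t\<bar> \<le> M ^ 3"
      using apriori[of T1] by blast
    have "T1 - 1 / (4 * M) < T1" using M by simp
    then obtain T where T: "T \<in> A" "T > T1 - 1 / (4 * M)"
      unfolding T1_def using less_cSupD[of A] T0A by blast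
    then obtain f g h where s: "ode_sol k {..<T} f g h" "\<forall>t<T0. f t = f0 t" and TT: "T \<ge> T0"
      by (auto simp: A_def)
    \<comment> \<open>\<open>T\<close> misses \<open>T1\<close> by less than
      \<open>1 / (4 M)\<close> and the restart at \<open>t0\<close> gives away
      \<open>1 / (8 M)\<close>, so the new solution of radius \<open>1 / M\<close> still passes
      \<open>T1\<close>. Since \<open>1 / (8 M) <= 1\<close>, the restart lies in the range of the a
      priori bound.\<close>
    define t0 where "t0 = T - 1 / (8 * M)"
    have "1 / (8 * M) \<le> 1" using M by simp
    then have t0: "T0 - 1 \<le> t0" using TT unfolding t0_def by linarith
    have t0T: "t0 < T" using M by (simp add: t0_def)
    have bd: "\<bar>f t0\<bar> \<le> M" "\<bar>g t0\<bar> \<le> M\<^sup>2" "\<bar>h t0\<bar> \<le> M ^ 3"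
      using Mb[OF TT T1[OF T(1)] s t0 t0T] by auto
    obtain F G H where L: "ode_sol k {t0 - 1 / M<..<t0 + 1 / M} F G H" "F t0 = f t0" "G t0 = g t0" "H t0 = h t0"
      using M by (elim ode_sol_local[OF k _ bd, of t0, OF order_less_le_trans[OF zero_less_one]])
    define T2 where "T2 = t0 + 1 / M"
    have T2: "T2 > T1" "T2 > T"
    proof -
      have "1 / M - 1 / (8 * M) - 1 / (4 * M) > 0" "1 / M - 1 / (8 * M) > 0" using M by (auto simp: field_simps)
      then show "T2 > T1" "T2 > T" using T(2) unfolding T2_def t0_def by linarith+
    qed
    have Mpos: "1 / M > 0" using M by simp
    have agree: "F t = f t \<and> G t = g t \<and> H t = h t" if "t0 \<le> t" "t < T" for t
    proof -
      have "ode_sol k {t0..<T} f g h" using s(1) by (rule ode_sol_subset) auto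
      moreover have "ode_sol k {t0..<T} F G H" using L(1) by (rule ode_sol_subset) (use Mpos T2 in \<open>auto simp: T2_def\<close>)
      moreover have "{t0..t} \<subseteq> {t0..<T}" using that by auto
      ultimately show ?thesis
        using ode_sol_unique_forward[of k "{t0..<T}" F G H f g h t0 t] that L by blast
    qed
    define f' g' h' where "f' = (\<lambda>t. if t < T then f t else F t)"
      and "g' = (\<lambda>t. if t < T then g t else G t)" and "h' = (\<lambda>t. if t < T then h t else H t)"
    have 1: "ode_sol k {..<T} f' g' h'"
      using s(1) by (rule ode_sol_cong_open) (auto simp: f'_def g'_def h'_def)
    have 2: "ode_sol k {t0<..<T2} f' g' h'"
    proof (rule ode_sol_cong_open[OF L(1)])
      show "{t0<..<T2} \<subseteq> {t0 - 1 / M<..<t0 + 1 / M}" unfolding T2_def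
        using Mpos by (simp add: greaterThanLessThan_subseteq_greaterThanLessThan)
    qed (simp_all add: f'_def g'_def h'_def agree)
    have "ode_sol k {..<T2} f' g' h'"
      unfolding ode_sol_def
    proof
      fix t assume "t \<in> {..<T2}"
      then have "t \<in> {..<T} \<or> t \<in> {t0<..<T2}" using t0T by auto
      then show "(f' has_real_derivative g' t) (at t) \<and> (g' has_real_derivative h' t) (at t) \<and>
         (h' has_real_derivative k * (g' t)\<^sup>2 - f' t * h' t) (at t)"
        using 1 2 unfolding ode_sol_def by blast
    qed
    moreover have "\<forall>t<T0. f' t = f0 t" using s(2) TT by (auto simp: f'_def)
    moreover have "T0 \<le> T2" using T2 TT by linarith
    ultimately have "T2 \<in> A" unfolding A_def by blast
    then have "T2 \<le> T1" by (rule T1)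
    then show False using T2 by linarith
  qed
  have ex: "\<exists>f g h. ode_sol k {..<T0 + real n} f g h \<and> (\<forall>t<T0. f t = f0 t)" for n
  proof -
    obtain T where "T \<in> A" "T > T0 + real n"
      using \<open>\<not> bdd_above A\<close> unfolding bdd_above_def by (meson not_le)
    then obtain f g h where "ode_sol k {..<T} f g h" "\<forall>t<T0. f t = f0 t" by (auto simp: A_def)
    moreover have "{..<T0 + real n} \<subseteq> {..<T}" using \<open>T > T0 + real n\<close> by auto
    ultimately show ?thesis using ode_sol_subset by blast
  qed
  obtain F G H where FGH: "\<And>n. ode_sol k {..<T0 + real n} (F n) (G n) (H n)" "\<And>n t. t < T0 \<Longrightarrow> F n t = f0 t"
    using ex by metis
  have agree: "F n t = F p t \<and> G n t = G p t \<and> H n t = H p t" if "t < T0 + real n" "t < T0 + real p" for n p t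
  proof -
    define q where "q = min n p"
    have q: "ode_sol k {..<T0 + real q} (F n) (G n) (H n)" "ode_sol k {..<T0 + real q} (F p) (G p) (H p)"
      by (rule ode_sol_subset[OF FGH(1)]; auto simp: q_def)+
    have "t < T0 + real q" using that by (auto simp: q_def min_def)
    then show ?thesis using ode_sol_unique_extension[OF q, of T0 t] FGH(2) by auto
  qed
  \<comment> \<open>The value at \<open>t\<close> is taken from a solution indexed by
    \<open>N t\<close>; the \<open>Suc\<close> puts \<open>t\<close> strictly inside its open
    domain.\<close>
  define N where "N = (\<lambda>t. Suc (nat \<lceil>t - T0\<rceil>))"
  have N: "t < T0 + real (N t)" for t unfolding N_def by linarith
  show ?thesis
  proof (rule that[of "\<lambda>t. F (N t) t" "\<lambda>t. G (N t) t" "\<lambda>t. H (N t) t"])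
    have s: "ode_sol k {..<T0 + real (N t)} (\<lambda>t. F (N t) t) (\<lambda>t. G (N t) t) (\<lambda>t. H (N t) t)" for t
    proof (rule ode_sol_cong_open[OF FGH(1)[of "N t"]])
      fix u assume "u \<in> {..<T0 + real (N t)}"
      then have "u < T0 + real (N t)" by simp
      from agree[OF N[of u] this]
      show "F (N u) u = F (N t) u" "G (N u) u = G (N t) u" "H (N u) u = H (N t) u" by blast+
    qed auto
    show "ode_sol k UNIV (\<lambda>t. F (N t) t) (\<lambda>t. G (N t) t) (\<lambda>t. H (N t) t)"
      unfolding ode_sol_def
    proof
      fix t :: real
      have "t \<in> {..<T0 + real (N t)}" using N by auto
      then show "((\<lambda>t. F (N t) t) has_real_derivative G (N t) t) (at t) \<and>
         ((\<lambda>t. G (N t) t) has_real_derivative H (N t) t) (at t) \<and>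
         ((\<lambda>t. H (N t) t) has_real_derivative k * (G (N t) t)\<^sup>2 - F (N t) t * H (N t) t) (at t)"
        using s[of t] unfolding ode_sol_def by blast
    qed
    show "F (N t) t = f0 t" if "t < T0" for t using FGH(2) that by blast
  qed
qed

section \<open>The Lyapunov series\<close>

lemma lyapunov_coeff_0 [simp]: "lyapunov_coeff m a 0 = 0"
  by (subst lyapunov_coeff.simps) simp

lemma lyapunov_coeff_1 [simp]: "lyapunov_coeff m a (Suc 0) = 1"
  by (subst lyapunov_coeff.simps) simp

lemma lyapunov_coeff_rec:
  assumes "l \<ge> 2" "a > 0"
  shows "a * (real l)\<^sup>2 * (real l - 1) * lyapunov_coeff m a l =
     (\<Sum>k\<in>{1..<l}. real k * ((m - 1) * real (l - k) / m - real k) * lyapunov_coeff m a k * lyapunov_coeff m a (l - k))"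
proof -
  have l: "l \<noteq> 0" "l \<noteq> 1" using assms by auto
  have nz: "a * (real l)\<^sup>2 * (real l - 1) \<noteq> 0" using assms by auto
  have "lyapunov_coeff m a l = 1 / (a * (real l)\<^sup>2 * (real l - 1)) * 
     (\<Sum>k\<in>{1..<l}. real k * ((m - 1) * real (l - k) / m - real k) * lyapunov_coeff m a k * lyapunov_coeff m a (l - k))"
    by (subst lyapunov_coeff.simps) (simp only: l if_False)
  then show ?thesis using nz by (simp only: mult.assoc[symmetric]) simp
qed

text \<open>The recursion is quadratic and carries one factor \<open>1 / a\<close>, so the
  coefficient of index \<open>l\<close> is proportional to \<open>a\<close> to the power
  \<open>1 - l\<close>. This is the coefficient form of the scaling and the reason why the Lyapunov
  parameter is multiplied by \<open>a\<close>.\<close>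

lemma lyapunov_coeff_scale:
  assumes a: "a > 0" and l: "l \<ge> 1"
  shows "lyapunov_coeff m a l * a ^ (l - 1) = lyapunov_coeff m 1 l"
  using l
proof (induction l rule: less_induct)
  case (less l)
  show ?case
  proof (cases "l = 1")
    case False
    then have l2: "l \<ge> 2" using less.prems by simp
    have "a * ((real l)\<^sup>2 * (real l - 1) * (lyapunov_coeff m a l * a ^ (l - 1)))
       = (a * (real l)\<^sup>2 * (real l - 1) * lyapunov_coeff m a l) * a ^ (l - 1)" by simp
    also have "\<dots> = (\<Sum>k\<in>{1..<l}. real k * ((m - 1) * real (l - k) / m - real k) * lyapunov_coeff m a k * lyapunov_coeff m a (l - k)) * a ^ (l - 1)"
      using lyapunov_coeff_rec[OF l2 a] by simp
    also have "\<dots> = (\<Sum>k\<in>{1..<l}. a * (real k * ((m - 1) * real (l - k) / m - real k) * lyapunov_coeff m 1 k * lyapunov_coeff m 1 (l - k)))"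
      unfolding sum_distrib_right
    proof (intro sum.cong refl)
      fix k assume k: "k \<in> {1..<l}"
      have "a ^ (l - 1) = a ^ (Suc ((k - 1) + (l - k - 1)))" using k by (intro arg_cong[where f = "power a"]) auto
      also have "\<dots> = a * a ^ (k - 1) * a ^ (l - k - 1)" by (simp add: power_add)
      finally have p: "a ^ (l - 1) = a * a ^ (k - 1) * a ^ (l - k - 1)" .
      have e: "lyapunov_coeff m 1 k = lyapunov_coeff m a k * a ^ (k - 1)"
        "lyapunov_coeff m 1 (l - k) = lyapunov_coeff m a (l - k) * a ^ (l - k - 1)"
        using less.IH[of k] less.IH[of "l - k"] k by auto
      show "real k * ((m - 1) * real (l - k) / m - real k) * lyapunov_coeff m a k * lyapunov_coeff m a (l - k) * a ^ (l - 1)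
         = a * (real k * ((m - 1) * real (l - k) / m - real k) * lyapunov_coeff m 1 k * lyapunov_coeff m 1 (l - k))"
        unfolding p e by (simp only: mult_ac)
    qed
    also have "\<dots> = a * ((real l)\<^sup>2 * (real l - 1) * lyapunov_coeff m 1 l)"
      using lyapunov_coeff_rec[OF l2, of 1 m] by (simp add: sum_distrib_left)
    finally show ?thesis using a l2 by simp
  qed simp
qed

text \<open>For a bound of the form \<open>A q^l\<close> the estimate of the recursion reproduces
  itself with \<open>A = 2\<close>, since the bracket is at most \<open>l\<close> and the sum of
  \<open>k\<close> below \<open>l\<close> is \<open>l (l - 1) / 2\<close>. The value
  \<open>1\<close> at \<open>l = 1\<close> then gives \<open>q = 1 / 2\<close>, hence a radius of
  convergence of at least \<open>2\<close>.\<close>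

lemma lyapunov_coeff_bound:
  assumes m: "\<bar>(m - 1) / m\<bar> \<le> 1"
  shows "\<bar>lyapunov_coeff m 1 l\<bar> \<le> 2 * (1 / 2) ^ l"
proof (induction l rule: less_induct)
  case (less l)
  let ?h = "lyapunov_coeff m 1"
  consider "l = 0" | "l = 1" | "l \<ge> 2" by linarith
  then show ?case
  proof cases
    case 3
    have t: "\<bar>real i * ((m - 1) * real (l - i) / m - real i) * ?h i * ?h (l - i)\<bar> \<le> real i * (real l * (4 * (1 / 2) ^ l))"
      if i: "i \<in> {1..<l}" for i
    proof -
      have "\<bar>(m - 1) * real (l - i) / m - real i\<bar> \<le> \<bar>(m - 1) / m * real (l - i)\<bar> + \<bar>real i\<bar>"
        by (metis abs_triangle_ineq4 times_divide_eq_left)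
      also have "\<dots> \<le> 1 * real (l - i) + real i"
        using mult_right_mono[OF m, of "real (l - i)"] by (simp only: abs_mult abs_of_nat add_le_cancel_right)
      also have "\<dots> = real l" using i by (simp add: of_nat_diff)
      finally have 1: "\<bar>(m - 1) * real (l - i) / m - real i\<bar> \<le> real l" .
      have "\<bar>real i * ((m - 1) * real (l - i) / m - real i) * ?h i * ?h (l - i)\<bar>
        = real i * \<bar>(m - 1) * real (l - i) / m - real i\<bar> * \<bar>?h i\<bar> * \<bar>?h (l - i)\<bar>" by (simp add: abs_mult)
      also have "\<dots> \<le> real i * real l * (2 * (1 / 2) ^ i) * (2 * (1 / 2) ^ (l - i))"
        using 1 less[of i] less[of "l - i"] i by (intro mult_mono) auto
      also have "\<dots> = real i * (real l * (4 * ((1 / 2) ^ i * (1 / 2) ^ (l - i))))" by simp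
      also have "(1 / 2) ^ i * (1 / 2) ^ (l - i) = (1 / 2 :: real) ^ l"
        using i by (simp add: power_add[symmetric])
      finally show ?thesis .
    qed
    have s: "2 * (\<Sum>i\<in>{1..<l}. real i) = real l * (real l - 1)"
    proof -
      have "2 * (\<Sum>i\<in>{1..<Suc n}. real i) = real (Suc n) * real n" for n
        by (induction n) (auto simp: algebra_simps)
      from this[of "l - 1"] show ?thesis using 3 by (simp add: of_nat_diff)
    qed
    have "(real l)\<^sup>2 * (real l - 1) * \<bar>?h l\<bar> = \<bar>1 * (real l)\<^sup>2 * (real l - 1) * ?h l\<bar>"
      using 3 by (simp add: abs_mult)
    also have "\<dots> = \<bar>\<Sum>i\<in>{1..<l}. real i * ((m - 1) * real (l - i) / m - real i) * ?h i * ?h (l - i)\<bar>"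
      by (subst lyapunov_coeff_rec[OF 3]) auto
    also have "\<dots> \<le> (\<Sum>i\<in>{1..<l}. real i * (real l * (4 * (1 / 2) ^ l)))"
      by (rule order_trans[OF sum_abs sum_mono]) (use t in auto)
    also have "\<dots> = (2 * (\<Sum>i\<in>{1..<l}. real i)) * (real l * (2 * (1 / 2) ^ l))"
      by (simp add: sum_distrib_right[symmetric])
    also have "\<dots> = (real l)\<^sup>2 * (real l - 1) * (2 * (1 / 2) ^ l)"
      unfolding s power2_eq_square by (simp only: mult_ac)
    finally show ?thesis using 3 by (simp add: mult_le_cancel_left)
  qed auto
qed

text \<open>\<open>z d/dz\<close>; it becomes the derivative under the substitution \<open>z = e\<^sup>t\<close>.\<close>

definition fps_euler :: "real fps \<Rightarrow> real fps" where "fps_euler F = fps_X * fps_deriv F"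

lemma fps_euler_nth: "fps_nth (fps_euler F) n = real n * fps_nth F n"
  by (cases n) (auto simp: fps_euler_def)

lemma fps_conv_radius_euler: "fps_conv_radius (fps_euler F) \<ge> fps_conv_radius F"
  using fps_conv_radius_mult[of fps_X "fps_deriv F"] fps_conv_radius_deriv[of F]
  unfolding fps_euler_def by (simp add: order_trans)

lemma eval_fps_exp_deriv:
  assumes "ereal (exp t) < fps_conv_radius F"
  shows "((\<lambda>t. eval_fps F (exp t)) has_real_derivative eval_fps (fps_euler F) (exp t)) (at t)"
proof -
  have n: "ereal (norm (exp t)) < fps_conv_radius F" using assms by simp
  have "eval_fps (fps_euler F) (exp t) = eval_fps (fps_deriv F) (exp t) * exp t"
    unfolding fps_euler_def using n order_less_le_trans[OF n fps_conv_radius_deriv]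
    by (subst eval_fps_mult) auto
  then show ?thesis
    using DERIV_chain2[OF has_field_derivative_eval_fps[OF n, of UNIV] DERIV_exp[of t]] by simp
qed

text \<open>For \<open>f = -1 + F (exp t)\<close> the derivative acts on \<open>F\<close> as
  \<open>fps_euler\<close>, and the equation becomes \<open>F3 + F F2 = F2 + k F1^2\<close>. Its
  coefficient of index \<open>l\<close> is the Lyapunov recursion, because \<open>F3 - F2\<close>
  has the coefficient \<open>l^2 (l - 1)\<close> times the one of \<open>F\<close>.\<close>

lemma lyapunov_series_solution:
  assumes k: "k = (m - 1) / m" "\<bar>k\<bar> \<le> 1"
  obtains f g h where "ode_sol k {..<ln 2} f g h"
    "\<And>t. t < ln 2 \<Longrightarrow> (\<lambda>n. lyapunov_coeff m 1 (Suc n) * exp t ^ Suc n) sums (f t + 1)"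
    "((\<lambda>t. exp (- t) * (f t + 1)) \<longlongrightarrow> 1) at_bot"
    "((\<lambda>t. exp (- t) * g t) \<longlongrightarrow> 1) at_bot"
    "((\<lambda>t. exp (- t) * h t) \<longlongrightarrow> 1) at_bot"
proof -
  define F where "F = Abs_fps (lyapunov_coeff m 1)"
  define F1 where "F1 = fps_euler F"
  define F2 where "F2 = fps_euler F1"
  define F3 where "F3 = fps_euler F2"
  have eq: "F3 + F * F2 = F2 + fps_const k * F1 * F1"
  proof (rule fps_ext)
    fix l
    let ?h = "lyapunov_coeff m 1"
    have "fps_nth F3 l - fps_nth F2 l = 1 * (real l)\<^sup>2 * (real l - 1) * ?h l"
      by (simp add: F3_def F2_def F1_def F_def fps_euler_nth power2_eq_square algebra_simps)
    \<comment> \<open>The dummy value \<open>0\<close> at index \<open>0\<close> lets the sum run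
      over all of \<open>0..l\<close>, the range of a Cauchy product.\<close>
    also have "\<dots> = (\<Sum>i=0..l. real i * ((m - 1) * real (l - i) / m - real i) * ?h i * ?h (l - i))"
    proof (cases "l \<ge> 2")
      case True
      have "1 * (real l)\<^sup>2 * (real l - 1) * ?h l
        = (\<Sum>i\<in>{1..<l}. real i * ((m - 1) * real (l - i) / m - real i) * ?h i * ?h (l - i))"
        using lyapunov_coeff_rec[OF True, of 1 m] by simp
      also have "\<dots> = (\<Sum>i=0..l. real i * ((m - 1) * real (l - i) / m - real i) * ?h i * ?h (l - i))"
        by (rule sum.mono_neutral_left) (auto simp: not_less_eq_eq Suc_le_eq)
      finally show ?thesis .
    next
      case False
      then have "l = 0 \<or> l = Suc 0" by auto
      then show ?thesis by auto
    qed
    also have "\<dots> = (\<Sum>i=0..l. k * (real i * ?h i * (real (l - i) * ?h (l - i))))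
        - (\<Sum>i=0..l. real i * (real i * ?h i) * ?h (l - i))"
      unfolding sum_subtractf[symmetric]
    proof (intro sum.cong refl)
      fix i
      have "(m - 1) * real (l - i) / m = k * real (l - i)" by (simp add: k)
      then show "real i * ((m - 1) * real (l - i) / m - real i) * ?h i * ?h (l - i)
         = k * (real i * ?h i * (real (l - i) * ?h (l - i))) - real i * (real i * ?h i) * ?h (l - i)"
        by (simp only: right_diff_distrib left_diff_distrib mult_ac)
    qed
    also have "(\<Sum>i=0..l. k * (real i * ?h i * (real (l - i) * ?h (l - i)))) = fps_nth (fps_const k * F1 * F1) l"
      by (simp only: fps_mult_left_const_nth mult.assoc)
         (simp add: fps_mult_nth F1_def F_def fps_euler_nth sum_distrib_left mult_ac)
    also have "(\<Sum>i=0..l. real i * (real i * ?h i) * ?h (l - i)) = fps_nth (F2 * F) l"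
      by (simp add: fps_mult_nth F1_def F_def F2_def fps_euler_nth)
    finally show "fps_nth (F3 + F * F2) l = fps_nth (F2 + fps_const k * F1 * F1) l" by (simp add: mult.commute)
  qed
  have r: "fps_conv_radius F \<ge> ereal 2"
    using fps_conv_radius_ge_geometric[of "1 / 2" F 2] lyapunov_coeff_bound[of m] k by (simp add: F_def)
  have r1: "fps_conv_radius F1 \<ge> ereal 2" "fps_conv_radius F2 \<ge> ereal 2" "fps_conv_radius F3 \<ge> ereal 2"
    using r fps_conv_radius_euler[of F] fps_conv_radius_euler[of F1] fps_conv_radius_euler[of F2]
    unfolding F1_def[symmetric] F2_def[symmetric] F3_def[symmetric] by (meson order_trans)+
  have e2: "ereal (exp t) < ereal 2" if "t < ln 2" for t :: real
  proof -
    have "exp t < exp (ln 2)" using that by (subst exp_less_cancel_iff)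
    then show ?thesis by simp
  qed
  have n: "ereal (norm (exp t)) < fps_conv_radius F" "ereal (norm (exp t)) < fps_conv_radius F1"
      "ereal (norm (exp t)) < fps_conv_radius F2" "ereal (norm (exp t)) < fps_conv_radius F3" if "t < ln 2" for t :: real
    using order_less_le_trans[OF e2[OF that]] r r1 by simp_all
  have e: "eval_fps F3 (exp t) = eval_fps F2 (exp t) + k * (eval_fps F1 (exp t))\<^sup>2 - eval_fps F (exp t) * eval_fps F2 (exp t)"
    if "t < ln 2" for t
  proof -
    note n = n[OF that]
    have nn: "ereal (norm (exp t)) < fps_conv_radius (F * F2)" "ereal (norm (exp t)) < fps_conv_radius (fps_const k * F1)"
      "ereal (norm (exp t)) < fps_conv_radius (fps_const k * F1 * F1)"
      using n order_less_le_trans[OF _ fps_conv_radius_mult[of F F2]] order_less_le_trans[OF _ fps_conv_radius_mult[of "fps_const k" F1]]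
        order_less_le_trans[OF _ fps_conv_radius_mult[of "fps_const k * F1" F1]] by auto
    have "eval_fps (F3 + F * F2) (exp t) = eval_fps (F2 + fps_const k * F1 * F1) (exp t)" using eq by simp
    then have "eval_fps F3 (exp t) + eval_fps F (exp t) * eval_fps F2 (exp t) = eval_fps F2 (exp t) + k * eval_fps F1 (exp t) * eval_fps F1 (exp t)"
      using n nn by (simp add: eval_fps_add eval_fps_mult)
    then show ?thesis by (simp add: power2_eq_square algebra_simps)
  qed
  \<comment> \<open>A series without constant term is divided by its variable, so the limit is its
    coefficient of index \<open>1\<close>. \<open>F\<close>, \<open>F1\<close> and \<open>F2\<close>
    share this coefficient, as \<open>fps_euler\<close> multiplies it by \<open>1\<close>.\<close>
  have lim: "((\<lambda>t. exp (- t) * eval_fps G (exp t)) \<longlongrightarrow> fps_nth G 1) at_bot"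
    if G: "fps_conv_radius G \<ge> ereal 2" "fps_nth G 0 = 0" for G :: "real fps"
  proof -
    have "ereal 0 < fps_conv_radius G" by (rule order_less_le_trans[OF _ G(1)]) simp
    then have "isCont (eval_fps (fps_shift 1 G)) 0"
      by (intro DERIV_isCont[OF has_field_derivative_eval_fps]) simp
    then have "(eval_fps (fps_shift 1 G) \<longlongrightarrow> eval_fps (fps_shift 1 G) 0) (at 0)" by (simp add: isCont_def)
    moreover have "filterlim (exp :: real \<Rightarrow> real) (at 0) at_bot"
      by (intro filterlim_atI exp_at_bot) auto
    ultimately have "((\<lambda>t. eval_fps (fps_shift 1 G) (exp t)) \<longlongrightarrow> fps_nth G 1) at_bot"
      by (auto dest: filterlim_compose simp: eval_fps_at_0)
    moreover have "eventually (\<lambda>t. eval_fps (fps_shift 1 G) (exp t) = exp (- t) * eval_fps G (exp t)) at_bot"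
      using eventually_gt_at_bot[of "ln 2"]
    proof eventually_elim
      case (elim t)
      have "G = fps_X * fps_shift 1 G"
      proof (rule fps_ext)
        fix n show "fps_nth G n = fps_nth (fps_X * fps_shift 1 G) n" using G(2) by (cases n) auto
      qed
      moreover have "ereal (norm (exp t)) < fps_conv_radius (fps_shift 1 G)"
        using order_less_le_trans[OF e2[of t] G(1)] elim by simp
      ultimately have "eval_fps G (exp t) = exp t * eval_fps (fps_shift 1 G) (exp t)"
        using eval_fps_mult[of "exp t" fps_X "fps_shift 1 G"] by simp
      then show ?case by (simp add: exp_minus field_simps)
    qed
    ultimately show ?thesis by (rule Lim_transform_eventually)
  qed
  show ?thesis
  proof (rule that[of "\<lambda>t. -1 + eval_fps F (exp t)" "\<lambda>t. eval_fps F1 (exp t)" "\<lambda>t. eval_fps F2 (exp t)"])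
    show "ode_sol k {..<ln 2} (\<lambda>t. -1 + eval_fps F (exp t)) (\<lambda>t. eval_fps F1 (exp t)) (\<lambda>t. eval_fps F2 (exp t))"
      unfolding ode_sol_def
    proof (intro ballI conjI)
      fix t :: real assume "t \<in> {..<ln 2}"
      then have t: "t < ln 2" by simp
      show "((\<lambda>t. -1 + eval_fps F (exp t)) has_real_derivative eval_fps F1 (exp t)) (at t)"
        using DERIV_add[OF DERIV_const[of "-1::real" "at t"] eval_fps_exp_deriv[of t F]] n(1)[OF t] by (simp add: F1_def)
      show "((\<lambda>t. eval_fps F1 (exp t)) has_real_derivative eval_fps F2 (exp t)) (at t)"
        using eval_fps_exp_deriv[of t F1] n(2)[OF t] by (simp add: F2_def)
      show "((\<lambda>t. eval_fps F2 (exp t)) has_real_derivative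
         k * (eval_fps F1 (exp t))\<^sup>2 - (-1 + eval_fps F (exp t)) * eval_fps F2 (exp t)) (at t)"
        by (rule DERIV_cong[OF eval_fps_exp_deriv[of t F2]])
           (use n(3)[OF t] e[OF t] in \<open>simp_all add: F3_def algebra_simps\<close>)
    qed
    show "(\<lambda>n. lyapunov_coeff m 1 (Suc n) * exp t ^ Suc n) sums (-1 + eval_fps F (exp t) + 1)" if "t < ln 2" for t
    proof -
      have "(\<lambda>n. fps_nth F n * exp t ^ n) sums eval_fps F (exp t)"
        using sums_eval_fps[OF n(1)[OF that]] .
      then show ?thesis using sums_Suc_iff[of "\<lambda>n. fps_nth F n * exp t ^ n" "eval_fps F (exp t)"] by (simp add: F_def)
    qed
    show "((\<lambda>t. exp (- t) * (- 1 + eval_fps F (exp t) + 1)) \<longlongrightarrow> 1) at_bot"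
      using lim[OF r] by (simp add: F_def)
    show "((\<lambda>t. exp (- t) * eval_fps F1 (exp t)) \<longlongrightarrow> 1) at_bot"
      using lim[OF r1(1)] by (simp add: F_def F1_def fps_euler_nth)
    show "((\<lambda>t. exp (- t) * eval_fps F2 (exp t)) \<longlongrightarrow> 1) at_bot"
      using lim[OF r1(2)] by (simp add: F_def F1_def F2_def fps_euler_nth)
  qed
qed

section \<open>The unstable manifold of the equilibrium\<close>

text \<open>The parameter \<open>d\<close>, of either sign or zero, labels the solutions on the
  unstable manifold. The error rate \<open>3 / 2\<close> is twice \<open>3 / 4\<close>: decay at the
  rate \<open>3 / 4 < 1\<close> makes quadratic terms decay at \<open>3 / 2 > 1\<close>, fast enough
  to isolate the term \<open>d exp t\<close>.\<close>

definition unstable :: "real \<Rightarrow> (real \<Rightarrow> real) \<Rightarrow> (real \<Rightarrow> real) \<Rightarrow> (real \<Rightarrow> real) \<Rightarrow> bool" where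
  "unstable d f g h \<longleftrightarrow> (\<exists>C T. \<forall>t\<le>T. \<bar>f t + 1 - d * exp t\<bar> \<le> C * exp (3 / 2 * t) \<and>
     \<bar>g t - d * exp t\<bar> \<le> C * exp (3 / 2 * t) \<and> \<bar>h t - d * exp t\<bar> \<le> C * exp (3 / 2 * t))"

text \<open>Decay at the rate \<open>3 / 4\<close> is upgraded to an expansion by integrating exact
  identities from minus infinity. The derivative of \<open>J = h + f g\<close> is quadratic in
  \<open>g\<close>, so \<open>J\<close> is of order \<open>exp (3 / 2 t)\<close>; the same order
  passes to \<open>Q\<close>, to \<open>g - (f + 1)\<close>, and, divided by \<open>exp t\<close>,
  to the derivative of \<open>exp (- t) (f + 1)\<close>, whose limit is \<open>d\<close>.\<close>

lemma unstableI_decay: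
  assumes s: "ode_sol k {..<T} f g h" and k: "\<bar>k\<bar> \<le> 1"
    and f0: "((\<lambda>t. exp (- (3 / 4) * t) * (f t + 1)) \<longlongrightarrow> 0) at_bot"
    and g0: "((\<lambda>t. exp (- (3 / 4) * t) * g t) \<longlongrightarrow> 0) at_bot"
    and h0: "((\<lambda>t. exp (- (3 / 4) * t) * h t) \<longlongrightarrow> 0) at_bot"
  obtains d where "unstable d f g h"
proof -
  have ev: "eventually (\<lambda>t. \<bar>u t\<bar> \<le> exp (3 / 4 * t)) at_bot"
    if "((\<lambda>t. exp (- (3 / 4) * t) * u t) \<longlongrightarrow> 0) at_bot" for u :: "real \<Rightarrow> real"
  proof -
    have "eventually (\<lambda>t. \<bar>exp (- (3 / 4) * t) * u t\<bar> < 1) at_bot"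
      using tendstoD[OF that, of 1] by (simp add: dist_real_def)
    then show ?thesis
    proof eventually_elim
      case (elim t)
      then have "exp (- (3 / 4 * t)) * \<bar>u t\<bar> < 1" by (simp add: abs_mult)
      then show ?case by (simp add: exp_minus field_simps)
    qed
  qed
  have "eventually (\<lambda>t. t < T \<and> t \<le> 0 \<and> \<bar>f t + 1\<bar> \<le> exp (3 / 4 * t) \<and> \<bar>g t\<bar> \<le> exp (3 / 4 * t) \<and> \<bar>h t\<bar> \<le> exp (3 / 4 * t)) at_bot"
    using ev[OF f0] ev[OF g0] ev[OF h0] eventually_gt_at_bot[of T] eventually_le_at_bot[of 0] by eventually_elim auto
  then obtain T1 where T1: "\<And>t. t \<le> T1 \<Longrightarrow> t < T" "T1 \<le> 0" and b: "\<And>t. t \<le> T1 \<Longrightarrow> \<bar>f t + 1\<bar> \<le> exp (3 / 4 * t)"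
      "\<And>t. t \<le> T1 \<Longrightarrow> \<bar>g t\<bar> \<le> exp (3 / 4 * t)" "\<And>t. t \<le> T1 \<Longrightarrow> \<bar>h t\<bar> \<le> exp (3 / 4 * t)"
    unfolding eventually_at_bot_linorder by (auto intro: order_refl)
  have D: "(f has_real_derivative g t) (at t)" "(g has_real_derivative h t) (at t)"
    "(h has_real_derivative k * (g t)\<^sup>2 - f t * h t) (at t)" if "t \<le> T1" for t
    using ode_solD[OF s] T1(1)[OF that] by auto
  have e0: "((\<lambda>t. exp (3 / 4 * t)) \<longlongrightarrow> (0::real)) at_bot" by real_asymp
  have z: "(u \<longlongrightarrow> 0) at_bot" if "\<And>t. t \<le> T1 \<Longrightarrow> \<bar>u t\<bar> \<le> exp (3 / 4 * t)" for u :: "real \<Rightarrow> real"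
    by (rule tendsto_0_le[OF e0, of _ 1]) (use that in \<open>auto intro: eventually_mono[OF eventually_le_at_bot[of T1]]\<close>)
  have lims: "((\<lambda>t. f t + 1) \<longlongrightarrow> 0) at_bot" "(g \<longlongrightarrow> 0) at_bot" "(h \<longlongrightarrow> 0) at_bot"
    by (rule z; use b in blast)+
  have flim: "(f \<longlongrightarrow> -1) at_bot" using tendsto_diff[OF lims(1) tendsto_const[of 1]] by simp
  have prod: "\<bar>x * y\<bar> \<le> exp (3 / 2 * t)" if "\<bar>x\<bar> \<le> exp (3 / 4 * t)" "\<bar>y\<bar> \<le> exp (3 / 4 * t)" for x y t :: real
  proof -
    have "\<bar>x * y\<bar> \<le> exp (3 / 4 * t) * exp (3 / 4 * t)" unfolding abs_mult using that by (intro mult_mono) auto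
    also have "\<dots> = exp (3 / 2 * t)" by (simp add: exp_add[symmetric])
    finally show ?thesis .
  qed
  define J where "J = (\<lambda>t. h t + f t * g t)"
  have J': "(J has_real_derivative (1 + k) * (g t)\<^sup>2) (at t)" if "t \<le> T1" for t
    unfolding J_def by (auto intro!: derivative_eq_intros D[OF that] simp: power2_eq_square algebra_simps)
  have J: "\<bar>J t\<bar> \<le> 4 / 3 * exp (3 / 2 * t)" if t: "t \<le> T1" for t
  proof -
    have "\<bar>(1 + k) * (g t)\<^sup>2\<bar> \<le> 2 * exp (3 / 2 * t)" if "t \<le> T1" for t
    proof -
      have "\<bar>1 + k\<bar> * \<bar>g t * g t\<bar> \<le> 2 * exp (3 / 2 * t)"
        using prod[OF b(2)[OF that] b(2)[OF that]] k by (intro mult_mono) auto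
      then show ?thesis by (simp add: abs_mult power2_eq_square)
    qed
    moreover have "(J \<longlongrightarrow> 0) at_bot"
      unfolding J_def using tendsto_add[OF lims(3) tendsto_mult[OF flim lims(2)]] by simp
    ultimately show ?thesis
      using exp_bounded_derivative_bound_at_bot[of T1 J _ 2 "3 / 2" 0 t, OF J'] t by simp
  qed
  \<comment> \<open>\<open>Q\<close> is a primitive of \<open>J\<close>, written as a function of
    \<open>f + 1\<close> so that it vanishes at minus infinity; its linear part
    \<open>g - (f + 1)\<close> vanishes on the unstable direction.\<close>
  define Q where "Q = (\<lambda>t. g t - (f t + 1) + (f t + 1)\<^sup>2 / 2)"
  have Q': "(Q has_real_derivative J t) (at t)" if "t \<le> T1" for t
    unfolding Q_def J_def by (auto intro!: derivative_eq_intros D[OF that] simp: algebra_simps)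
  have Q: "\<bar>Q t\<bar> \<le> 8 / 9 * exp (3 / 2 * t)" if t: "t \<le> T1" for t
  proof -
    have "(Q \<longlongrightarrow> 0 - 0 + 0\<^sup>2 / 2) at_bot" unfolding Q_def by (intro tendsto_intros lims) auto
    then have "(Q \<longlongrightarrow> 0) at_bot" by simp
    from exp_bounded_derivative_bound_at_bot[of T1 Q J "4 / 3" "3 / 2" 0 t, OF Q' J _ this t]
    show ?thesis by simp
  qed
  have gu: "\<bar>g t - (f t + 1)\<bar> \<le> 2 * exp (3 / 2 * t)" if t: "t \<le> T1" for t
  proof -
    have "\<bar>(f t + 1)\<^sup>2\<bar> \<le> exp (3 / 2 * t)" using prod[OF b(1)[OF t] b(1)[OF t]] by (simp add: power2_eq_square)
    then show ?thesis using Q[OF t] exp_gt_zero[of "3 / 2 * t"] unfolding Q_def by linarith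
  qed
  define p where "p = (\<lambda>t. exp (- t) * (f t + 1))"
  have p': "(p has_real_derivative exp (- t) * (g t - (f t + 1))) (at t)" if "t \<le> T1" for t
    unfolding p_def by (auto intro!: derivative_eq_intros D[OF that] simp: algebra_simps)
  have p'b: "\<bar>exp (- t) * (g t - (f t + 1))\<bar> \<le> 2 * exp (1 / 2 * t)" if "t \<le> T1" for t
  proof -
    have "\<bar>exp (- t) * (g t - (f t + 1))\<bar> \<le> exp (- t) * (2 * exp (3 / 2 * t))"
      unfolding abs_mult using gu[OF that] by (intro mult_mono) auto
    also have "\<dots> = 2 * (exp (-t) * exp (3 / 2 * t))" by simp
    also have "exp (-t) * exp (3 / 2 * t) = exp (1 / 2 * t)" by (simp add: exp_add[symmetric])
    finally show ?thesis .
  qed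
  obtain d where d: "(p \<longlongrightarrow> d) at_bot"
    using exp_bounded_derivative_convergent_at_bot[of T1 p, OF p' p'b] by auto
  have pd: "\<bar>p t - d\<bar> \<le> 4 * exp (1 / 2 * t)" if "t \<le> T1" for t
    using exp_bounded_derivative_bound_at_bot[of T1 p, OF p' p'b _ d that] by simp
  have fd: "\<bar>f t + 1 - d * exp t\<bar> \<le> 4 * exp (3 / 2 * t)" if "t \<le> T1" for t
  proof -
    have "f t + 1 - d * exp t = exp t * (p t - d)" by (simp add: p_def exp_minus field_simps)
    also have "\<bar>\<dots>\<bar> \<le> exp t * (4 * exp (1 / 2 * t))"
      unfolding abs_mult using pd[OF that] by (intro mult_mono) auto
    also have "\<dots> = 4 * (exp t * exp (1 / 2 * t))" by simp
    also have "exp t * exp (1 / 2 * t) = exp (3 / 2 * t)" by (simp add: exp_add[symmetric])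
    finally show ?thesis .
  qed
  have gd: "\<bar>g t - d * exp t\<bar> \<le> 6 * exp (3 / 2 * t)" if "t \<le> T1" for t
    using fd[OF that] gu[OF that] by (simp add: abs_le_iff)
  have hd: "\<bar>h t - d * exp t\<bar> \<le> 9 * exp (3 / 2 * t)" if "t \<le> T1" for t
  proof -
    have "\<bar>(f t + 1) * g t\<bar> \<le> exp (3 / 2 * t)" using prod b that by blast
    moreover have "h t = J t + g t - (f t + 1) * g t" by (simp add: J_def algebra_simps)
    ultimately show ?thesis using J[OF that] gd[OF that] exp_gt_zero[of "3 / 2 * t"] by (simp only: abs_le_iff) linarith
  qed
  have "unstable d f g h"
    unfolding unstable_def
  proof (intro exI allI impI conjI)
    fix t assume t: "t \<le> T1"
    show "\<bar>f t + 1 - d * exp t\<bar> \<le> 9 * exp (3 / 2 * t)" "\<bar>g t - d * exp t\<bar> \<le> 9 * exp (3 / 2 * t)" "\<bar>h t - d * exp t\<bar> \<le> 9 * exp (3 / 2 * t)"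
      using fd[OF t] gd[OF t] hd[OF t] exp_gt_zero[of "3 / 2 * t"] by linarith+
  qed
  then show ?thesis by (rule that)
qed

lemma unstable_lims:
  assumes "unstable d f g h"
  shows "((\<lambda>t. exp (- t) * (f t + 1)) \<longlongrightarrow> d) at_bot" "((\<lambda>t. exp (- t) * g t) \<longlongrightarrow> d) at_bot"
    "((\<lambda>t. exp (- t) * h t) \<longlongrightarrow> d) at_bot"
proof -
  obtain C T where CT: "\<And>t. t \<le> T \<Longrightarrow> \<bar>f t + 1 - d * exp t\<bar> \<le> C * exp (3 / 2 * t)"
     "\<And>t. t \<le> T \<Longrightarrow> \<bar>g t - d * exp t\<bar> \<le> C * exp (3 / 2 * t)" "\<And>t. t \<le> T \<Longrightarrow> \<bar>h t - d * exp t\<bar> \<le> C * exp (3 / 2 * t)"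
    using assms unfolding unstable_def by blast
  have *: "((\<lambda>t. exp (- t) * u t) \<longlongrightarrow> d) at_bot" if "\<And>t. t \<le> T \<Longrightarrow> \<bar>u t - d * exp t\<bar> \<le> C * exp (3 / 2 * t)" for u :: "real \<Rightarrow> real"
  proof -
    have "((\<lambda>t. C * exp (1 / 2 * t)) \<longlongrightarrow> C * 0) at_bot" by (intro tendsto_mult tendsto_const) real_asymp
    then have z: "((\<lambda>t. C * exp (1 / 2 * t)) \<longlongrightarrow> 0) at_bot" by simp
    have "((\<lambda>t. exp (- t) * u t - d) \<longlongrightarrow> 0) at_bot"
    proof (rule tendsto_0_le[OF z, of _ 1])
      show "eventually (\<lambda>t. norm (exp (- t) * u t - d) \<le> norm (C * exp (1 / 2 * t)) * 1) at_bot"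
        using eventually_le_at_bot[of T]
      proof eventually_elim
        case (elim t)
        have "exp (- t) * u t - d = exp (- t) * (u t - d * exp t)" by (simp add: exp_minus field_simps)
        also have "\<bar>\<dots>\<bar> \<le> exp (- t) * (C * exp (3 / 2 * t))"
          unfolding abs_mult using that[OF elim] by (intro mult_mono) auto
        also have "\<dots> = C * (exp (- t) * exp (3 / 2 * t))" by simp
        also have "exp (- t) * exp (3 / 2 * t) = exp (1 / 2 * t)" by (simp add: exp_add[symmetric])
        finally show ?case by (simp add: abs_mult) (metis abs_ge_self abs_mult abs_exp_cancel order_trans)
      qed
    qed
    from tendsto_add[OF this tendsto_const[of d]] show ?thesis by simp
  qed
  show "((\<lambda>t. exp (- t) * (f t + 1)) \<longlongrightarrow> d) at_bot" "((\<lambda>t. exp (- t) * g t) \<longlongrightarrow> d) at_bot"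
    "((\<lambda>t. exp (- t) * h t) \<longlongrightarrow> d) at_bot"
    using *[of "\<lambda>t. f t + 1"] *[of g] *[of h] CT by auto
qed

lemma decay_mult_exp:
  assumes "((\<lambda>t. exp (- t) * u t) \<longlongrightarrow> d) at_bot" "\<epsilon> < 1"
  shows "((\<lambda>t. exp (- \<epsilon> * t) * u t) \<longlongrightarrow> (0::real)) at_bot"
proof -
  have "((\<lambda>t. exp ((1 - \<epsilon>) * t)) \<longlongrightarrow> 0) at_bot" using assms(2) by real_asymp
  from tendsto_mult[OF this assms(1)]
  show ?thesis by (simp add: mult.assoc[symmetric] exp_add[symmetric] algebra_simps)
qed

lemma unstable_tendsto:
  assumes "unstable d f g h"
  shows "(f \<longlongrightarrow> - 1) at_bot" "(g \<longlongrightarrow> 0) at_bot" "(h \<longlongrightarrow> 0) at_bot"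
  using tendsto_diff[OF decay_mult_exp[OF unstable_lims(1)[OF assms], of 0] tendsto_const[of 1]]
    decay_mult_exp[OF unstable_lims(2)[OF assms], of 0] decay_mult_exp[OF unstable_lims(3)[OF assms], of 0]
  by simp_all

text \<open>A contraction in the norm weighted by \<open>exp (- t)\<close>. If the differences of
  \<open>f\<close> and \<open>g\<close> are at most \<open>M exp t\<close>, integrating the
  identities for \<open>J\<close> and \<open>Q\<close> from minus infinity gives the bound
  \<open>4 K M exp (2 t)\<close>, and far to the left this is at most half of the assumed one.
  Iteration makes the bound \<open>0\<close>.\<close>

lemma unstable_unique_near_bot:
  assumes s1: "ode_sol k {..<T} f1 g1 h1" and s2: "ode_sol k {..<T} f2 g2 h2" and k: "\<bar>k\<bar> \<le> 1"
    and u1: "unstable d f1 g1 h1" and u2: "unstable d f2 g2 h2"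
  obtains T0 where "T0 \<le> T" "\<And>t. t < T0 \<Longrightarrow> f1 t = f2 t"
proof -
  obtain C1 S1 where C1: "\<And>t. t \<le> S1 \<Longrightarrow> \<bar>f1 t + 1 - d * exp t\<bar> \<le> C1 * exp (3 / 2 * t)"
     "\<And>t. t \<le> S1 \<Longrightarrow> \<bar>g1 t - d * exp t\<bar> \<le> C1 * exp (3 / 2 * t)" using u1 unfolding unstable_def by blast
  obtain C2 S2 where C2: "\<And>t. t \<le> S2 \<Longrightarrow> \<bar>f2 t + 1 - d * exp t\<bar> \<le> C2 * exp (3 / 2 * t)"
     "\<And>t. t \<le> S2 \<Longrightarrow> \<bar>g2 t - d * exp t\<bar> \<le> C2 * exp (3 / 2 * t)" using u2 unfolding unstable_def by blast
  define C where "C = max \<bar>C1\<bar> \<bar>C2\<bar>"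
  define K where "K = \<bar>d\<bar> + C + 1"
  have K: "K \<ge> 1" "C \<ge> 0" by (auto simp: K_def C_def)
  \<comment> \<open>The term \<open>- ln (8 * K)\<close> makes \<open>8 K exp t <= 1\<close>, the
    contraction factor \<open>1 / 2\<close>; \<open>T1 <= 0\<close> makes
    \<open>exp (3 / 2 t)\<close> smaller than \<open>exp t\<close>.\<close>
  define T1 where "T1 = min (min S1 S2) (min (min 0 (T - 1)) (- ln (8 * K)))"
  have T1: "T1 \<le> S1" "T1 \<le> S2" "T1 \<le> 0" "T1 < T" "T1 \<le> - ln (8 * K)" by (auto simp: T1_def)
  have small: "8 * K * exp t \<le> 1" if "t \<le> T1" for t
  proof -
    have "exp t \<le> exp (- ln (8 * K))" using that T1 by (subst exp_le_cancel_iff) linarith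
    then show ?thesis using K by (simp add: exp_minus field_simps)
  qed
  have cle: "c * exp (3 / 2 * t) \<le> C * exp (3 / 2 * t)" if "c = C1 \<or> c = C2" for c t
    using that by (intro mult_right_mono) (auto simp: C_def)
  have D: "(f1 has_real_derivative g1 t) (at t)" "(g1 has_real_derivative h1 t) (at t)"
    "(h1 has_real_derivative k * (g1 t)\<^sup>2 - f1 t * h1 t) (at t)" 
    "(f2 has_real_derivative g2 t) (at t)" "(g2 has_real_derivative h2 t) (at t)"
    "(h2 has_real_derivative k * (g2 t)\<^sup>2 - f2 t * h2 t) (at t)" if "t \<le> T1" for t
    using ode_solD[OF s1] ode_solD[OF s2] that T1 by auto
  have cl: "\<bar>f1 t + 1 - d * exp t\<bar> \<le> C * exp (3 / 2 * t)" "\<bar>g1 t - d * exp t\<bar> \<le> C * exp (3 / 2 * t)"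
    "\<bar>f2 t + 1 - d * exp t\<bar> \<le> C * exp (3 / 2 * t)" "\<bar>g2 t - d * exp t\<bar> \<le> C * exp (3 / 2 * t)" if "t \<le> T1" for t
    using C1[of t] C2[of t] that T1 cle[of C1 t] cle[of C2 t] by linarith+
  have e32: "exp (3 / 2 * t) \<le> exp t" if "t \<le> T1" for t
    using that T1 by (subst exp_le_cancel_iff) auto
  have bK: "\<bar>x\<bar> \<le> K * exp t" if "\<bar>x - d * exp t\<bar> \<le> C * exp (3 / 2 * t)" "t \<le> T1" for x t
  proof -
    have "\<bar>x\<bar> \<le> \<bar>d * exp t\<bar> + C * exp (3 / 2 * t)" using that by linarith
    also have "\<dots> \<le> \<bar>d\<bar> * exp t + C * exp t"
      using e32[OF that(2)] K by (intro add_mono mult_left_mono) (auto simp: abs_mult)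
    also have "\<dots> \<le> K * exp t" by (simp add: K_def algebra_simps)
    finally show ?thesis .
  qed
  have bd: "\<bar>f1 t + 1\<bar> \<le> K * exp t" "\<bar>g1 t\<bar> \<le> K * exp t" "\<bar>f2 t + 1\<bar> \<le> K * exp t" "\<bar>g2 t\<bar> \<le> K * exp t"
    if "t \<le> T1" for t using cl[OF that] bK that by blast+
  note l1 = unstable_tendsto[OF u1] and l2 = unstable_tendsto[OF u2]
  have step: "\<forall>t\<le>T1. \<bar>f1 t - f2 t\<bar> \<le> M / 2 * exp t \<and> \<bar>g1 t - g2 t\<bar> \<le> M / 2 * exp t"
    if M: "M \<ge> 0" and H: "\<forall>t\<le>T1. \<bar>f1 t - f2 t\<bar> \<le> M * exp t \<and> \<bar>g1 t - g2 t\<bar> \<le> M * exp t" for M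
  proof -
    have ee: "exp t * exp t = exp (2 * t)" for t :: real by (simp add: exp_add[symmetric])
    define J where "J = (\<lambda>t. h1 t + f1 t * g1 t - (h2 t + f2 t * g2 t))"
    define J' where "J' = (\<lambda>t. (1 + k) * ((g1 t + g2 t) * (g1 t - g2 t)))"
    have dJ: "(J has_real_derivative J' t) (at t)" if "t \<le> T1" for t
      unfolding J_def J'_def by (auto intro!: derivative_eq_intros D[OF that] simp: power2_eq_square algebra_simps)
    have bJ': "\<bar>J' t\<bar> \<le> 4 * K * M * exp (2 * t)" if "t \<le> T1" for t
    proof -
      have "\<bar>J' t\<bar> = \<bar>1 + k\<bar> * (\<bar>g1 t + g2 t\<bar> * \<bar>g1 t - g2 t\<bar>)" by (simp add: J'_def abs_mult)
      also have "\<dots> \<le> 2 * ((2 * K * exp t) * (M * exp t))"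
        using k bd[OF that] H that K by (intro mult_mono) auto
      also have "\<dots> = 4 * K * M * (exp t * exp t)" by simp
      finally show ?thesis unfolding ee .
    qed
    have "(J \<longlongrightarrow> 0 + - 1 * 0 - (0 + - 1 * 0)) at_bot" unfolding J_def by (intro tendsto_intros l1 l2)
    then have J0: "(J \<longlongrightarrow> 0) at_bot" by simp
    have bJ: "\<bar>J t\<bar> \<le> 2 * K * M * exp (2 * t)" if "t \<le> T1" for t
      using exp_bounded_derivative_bound_at_bot[of T1 J J' "4 * K * M" 2 0 t, OF dJ bJ' _ J0 that] by simp
    define Q where "Q = (\<lambda>t. (g1 t - f1 t + (f1 t + 1)\<^sup>2 / 2) - (g2 t - f2 t + (f2 t + 1)\<^sup>2 / 2))"
    have dQ: "(Q has_real_derivative J t) (at t)" if "t \<le> T1" for t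
      unfolding Q_def J_def by (auto intro!: derivative_eq_intros D[OF that] simp: algebra_simps add_divide_distrib)
    have "(Q \<longlongrightarrow> (0 - (-1) + (- 1 + 1)\<^sup>2 / 2) - (0 - (-1) + (- 1 + 1)\<^sup>2 / 2)) at_bot"
      unfolding Q_def by (intro tendsto_intros l1 l2) auto
    then have Q0: "(Q \<longlongrightarrow> 0) at_bot" by simp
    have bQ: "\<bar>Q t\<bar> \<le> K * M * exp (2 * t)" if "t \<le> T1" for t
      using exp_bounded_derivative_bound_at_bot[of T1 Q J "2 * K * M" 2 0 t, OF dQ bJ _ Q0 that] by simp
    define \<delta> where "\<delta> = (\<lambda>t. f1 t - f2 t)"
    define \<gamma> where "\<gamma> = (\<lambda>t. g1 t - g2 t)"
    have bgd: "\<bar>\<gamma> t - \<delta> t\<bar> \<le> 2 * K * M * exp (2 * t)" if "t \<le> T1" for t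
    proof -
      have "\<bar>((f1 t + 1) + (f2 t + 1)) * \<delta> t / 2\<bar> = \<bar>(f1 t + 1) + (f2 t + 1)\<bar> * \<bar>\<delta> t\<bar> / 2" by (simp add: abs_mult)
      also have "\<dots> \<le> (2 * K * exp t) * (M * exp t) / 2"
        using bd[OF that] H that K unfolding \<delta>_def by (intro divide_right_mono mult_mono) auto
      also have "\<dots> = K * M * (exp t * exp t)" by simp
      finally have "\<bar>((f1 t + 1) + (f2 t + 1)) * \<delta> t / 2\<bar> \<le> K * M * exp (2 * t)" unfolding ee .
      moreover have "\<gamma> t - \<delta> t = Q t - ((f1 t + 1) + (f2 t + 1)) * \<delta> t / 2"
        unfolding Q_def \<gamma>_def \<delta>_def by (simp add: power2_eq_square field_simps)
      ultimately show ?thesis using bQ[OF that] by linarith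
    qed
    define p where "p = (\<lambda>t. exp (- t) * \<delta> t)"
    have dp: "(p has_real_derivative exp (- t) * (\<gamma> t - \<delta> t)) (at t)" if "t \<le> T1" for t
      unfolding p_def \<delta>_def \<gamma>_def by (auto intro!: derivative_eq_intros D[OF that] simp: algebra_simps)
    have bp': "\<bar>exp (- t) * (\<gamma> t - \<delta> t)\<bar> \<le> 2 * K * M * exp (1 * t)" if "t \<le> T1" for t
    proof -
      have "\<bar>exp (- t) * (\<gamma> t - \<delta> t)\<bar> \<le> exp (- t) * (2 * K * M * exp (2 * t))"
        unfolding abs_mult using bgd[OF that] by (intro mult_mono) auto
      also have "\<dots> = 2 * K * M * (exp (- t) * exp (2 * t))" by simp
      also have "exp (- t) * exp (2 * t) = exp (1 * t)" by (simp add: exp_add[symmetric])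
      finally show ?thesis .
    qed
    \<comment> \<open>Here the common parameter \<open>d\<close> enters: it makes \<open>p\<close>
      vanish at minus infinity, so that the multiple of \<open>exp t\<close> left undetermined by
      the relation between \<open>\<gamma>\<close> and \<open>\<delta>\<close> is zero.\<close>
    have "((\<lambda>t. exp (- t) * (f1 t + 1) - exp (- t) * (f2 t + 1)) \<longlongrightarrow> d - d) at_bot"
      using unstable_lims[OF u1] unstable_lims[OF u2] by (intro tendsto_diff)
    then have p0: "(p \<longlongrightarrow> 0) at_bot" by (simp add: p_def \<delta>_def algebra_simps)
    have b\<delta>: "\<bar>\<delta> t\<bar> \<le> 2 * K * M * exp (2 * t)" if "t \<le> T1" for t
    proof -
      have "\<bar>p t\<bar> \<le> 2 * K * M * exp t"
        using exp_bounded_derivative_bound_at_bot[of T1 p _ "2 * K * M" 1 0 t, OF dp bp' _ p0 that] by simp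
      then have "exp t * \<bar>p t\<bar> \<le> exp t * (2 * K * M * exp t)" by (intro mult_left_mono) auto
      also have "exp t * \<bar>p t\<bar> = \<bar>\<delta> t\<bar>" by (simp add: p_def abs_mult exp_minus field_simps)
      also have "exp t * (2 * K * M * exp t) = 2 * K * M * (exp t * exp t)" by simp
      finally show ?thesis unfolding ee .
    qed
    show ?thesis
    proof (intro allI impI)
      fix t assume t: "t \<le> T1"
      have "4 * K * M * exp (2 * t) = (8 * K * exp t) * (M / 2 * exp t)" unfolding ee[symmetric] by simp
      also have "\<dots> \<le> 1 * (M / 2 * exp t)" using small[OF t] M by (intro mult_right_mono) auto
      finally have s: "4 * K * M * exp (2 * t) \<le> M / 2 * exp t" by simp
      have "0 \<le> 2 * K * M * exp (2 * t)" using K M by simp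
      then show "\<bar>f1 t - f2 t\<bar> \<le> M / 2 * exp t \<and> \<bar>g1 t - g2 t\<bar> \<le> M / 2 * exp t"
        using b\<delta>[OF t] bgd[OF t] s unfolding \<delta>_def \<gamma>_def by linarith
    qed
  qed
  have it: "\<forall>t\<le>T1. \<bar>f1 t - f2 t\<bar> \<le> (2 * C * (1 / 2) ^ n) * exp t \<and> \<bar>g1 t - g2 t\<bar> \<le> (2 * C * (1 / 2) ^ n) * exp t" for n
  proof (induction n)
    case 0
    show ?case
    proof (intro allI impI)
      fix t assume t: "t \<le> T1"
      have "C * exp (3 / 2 * t) \<le> C * exp t" using e32[OF t] K by (intro mult_left_mono) auto
      then show "\<bar>f1 t - f2 t\<bar> \<le> (2 * C * (1 / 2) ^ 0) * exp t \<and> \<bar>g1 t - g2 t\<bar> \<le> (2 * C * (1 / 2) ^ 0) * exp t"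
        using cl[OF t] by simp linarith
    qed
  next
    case (Suc n)
    from step[OF _ Suc] K show ?case by simp
  qed
  have "f1 t = f2 t" if "t < T1" for t
  proof -
    have "(\<lambda>n. (2 * C * (1 / 2) ^ n) * exp t) \<longlonglongrightarrow> (2 * C * 0) * exp t"
      by (intro tendsto_intros LIMSEQ_realpow_zero) auto
    then have "\<bar>f1 t - f2 t\<bar> \<le> (2 * C * 0) * exp t"
      by (rule tendsto_lowerbound) (use it that in \<open>auto intro!: always_eventually less_imp_le\<close>)
    then show ?thesis by simp
  qed
  then show ?thesis using T1 by (intro that[of T1]) auto
qed

lemma unstable_unique:
  assumes s1: "ode_sol k {..<T} f1 g1 h1" and s2: "ode_sol k {..<T} f2 g2 h2" and k: "\<bar>k\<bar> \<le> 1"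
    and u1: "unstable d f1 g1 h1" and u2: "unstable d f2 g2 h2" and t: "t < T"
  shows "f1 t = f2 t"
  using unstable_unique_near_bot[OF s1 s2 k u1 u2] ode_sol_unique_extension(1)[OF s1 s2 _ _ t] by metis

section \<open>The two branches of the unstable manifold, by the sign of \<open>d\<close>\<close>

lemma less_limit_at_bot_if_decreasing:
  fixes f :: "real \<Rightarrow> real"
  assumes f: "\<And>t. t \<le> T \<Longrightarrow> (f has_real_derivative f' t) (at t)" "\<And>t. t \<le> T \<Longrightarrow> f' t < 0"
    and L: "(f \<longlongrightarrow> L) at_bot" and t: "t \<le> T"
  shows "f t < L"
proof -
  have dec: "f v < f u" if "u < v" "v \<le> T" for u v
  proof (rule DERIV_neg_imp_decreasing[OF that(1)])
    fix x assume "x \<le> v"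
    then show "\<exists>y. (f has_real_derivative y) (at x) \<and> y < 0" using f[of x] that by auto
  qed
  have "f (t - 1) \<le> L"
    by (rule tendsto_lowerbound[OF L])
       (use dec t in \<open>auto intro!: eventually_mono[OF eventually_gt_at_bot[of "t - 1"]] less_imp_le\<close>)
  then show ?thesis using dec[of "t - 1" t] t by simp
qed

lemma greater_limit_at_bot_if_increasing:
  fixes f :: "real \<Rightarrow> real"
  assumes f: "\<And>t. t \<le> T \<Longrightarrow> (f has_real_derivative f' t) (at t)" "\<And>t. t \<le> T \<Longrightarrow> f' t > 0"
    and L: "(f \<longlongrightarrow> L) at_bot" and t: "t \<le> T"
  shows "f t > L"
  using less_limit_at_bot_if_decreasing[of T "\<lambda>t. - f t" "\<lambda>t. - f' t" "- L" t] assms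
  by (auto intro: DERIV_minus tendsto_minus)

text \<open>With \<open>r = f'' / f'\<close> the derivative \<open>D = r'\<close> satisfies \<open>D' = - (f + 2 r) D - (1 - k) r f'\<close>,
  which is why \<open>k < 1\<close> decides the sign of \<open>D\<close> near \<open>-\<infinity>\<close>.\<close>

lemma ode_sol_ratio_deriv:
  assumes s: "ode_sol k S f g h" and t: "t \<in> S" and g: "g t \<noteq> 0"
  shows "((\<lambda>t. h t / g t) has_real_derivative (k * g t - f t * (h t / g t) - (h t / g t)\<^sup>2)) (at t)"
    and "((\<lambda>t. k * g t - f t * (h t / g t) - (h t / g t)\<^sup>2) has_real_derivative
       - (f t + 2 * (h t / g t)) * (k * g t - f t * (h t / g t) - (h t / g t)\<^sup>2) - (1 - k) * (h t / g t) * g t) (at t)"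
proof -
  note D = ode_solD[OF s t]
  show r: "((\<lambda>t. h t / g t) has_real_derivative (k * g t - f t * (h t / g t) - (h t / g t)\<^sup>2)) (at t)"
    by (rule DERIV_cong[OF DERIV_divide[OF D(3,2) g]]) (use g in \<open>simp add: field_simps power2_eq_square\<close>)
  show "((\<lambda>t. k * g t - f t * (h t / g t) - (h t / g t)\<^sup>2) has_real_derivative
       - (f t + 2 * (h t / g t)) * (k * g t - f t * (h t / g t) - (h t / g t)\<^sup>2) - (1 - k) * (h t / g t) * g t) (at t)"
  proof (rule DERIV_cong[OF DERIV_diff[OF DERIV_diff[OF DERIV_cmult[OF D(2)] DERIV_mult[OF D(1) r]] DERIV_power[OF r]]])
    define u where "u = h t / g t"
    have h: "h t = u * g t" using g by (simp add: u_def)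
    show "k * h t - (g t * (h t / g t) + (k * g t - f t * (h t / g t) - (h t / g t)\<^sup>2) * f t)
       - real 2 * ((k * g t - f t * (h t / g t) - (h t / g t)\<^sup>2) * (h t / g t) ^ (2 - Suc 0))
       = - (f t + 2 * (h t / g t)) * (k * g t - f t * (h t / g t) - (h t / g t)\<^sup>2) - (1 - k) * (h t / g t) * g t"
      unfolding u_def[symmetric] h by (simp add: power2_eq_square algebra_simps)
  qed
qed

text \<open>Linear equation for \<open>D\<close> with an integrating factor: for a primitive
  \<open>A\<close> of \<open>f + 2 r\<close>, the product \<open>d D exp A\<close> has the
  derivative \<open>- (1 - k) r (d g) exp A < 0\<close> and vanishes at minus infinity, hence
  \<open>d D < 0\<close>. Then \<open>d r\<close> decreases from its limit \<open>d\<close>.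
  Multiplying by \<open>d\<close> treats both branches at once.\<close>

lemma unstable_ratio:
  assumes s: "ode_sol k {..<T} f g h" and u: "unstable d f g h" and k: "k < 1" and d: "d \<noteq> 0"
  obtains T1 where "T1 < T" "\<And>t. t \<le> T1 \<Longrightarrow> d * g t > 0" "\<And>t. t \<le> T1 \<Longrightarrow> h t / g t > 0"
    "\<And>t. t \<le> T1 \<Longrightarrow> d * (k * g t - f t * (h t / g t) - (h t / g t)\<^sup>2) < 0"
    "\<And>t. t \<le> T1 \<Longrightarrow> d * (h t / g t) < d"
proof -
  note L = unstable_lims[OF u] and L0 = unstable_tendsto[OF u]
  define r where "r = (\<lambda>t. h t / g t)"
  define D where "D = (\<lambda>t. k * g t - f t * (h t / g t) - (h t / g t)\<^sup>2)"
  have "((\<lambda>t. (exp (- t) * h t) / (exp (- t) * g t)) \<longlongrightarrow> d / d) at_bot"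
    using d by (intro tendsto_divide L)
  then have r1: "(r \<longlongrightarrow> 1) at_bot" using d by (simp add: r_def)
  have "(D \<longlongrightarrow> k * 0 - (- 1) * 1 - 1\<^sup>2) at_bot" unfolding D_def
    using r1[unfolded r_def] by (intro tendsto_intros L0) auto
  then have D0: "(D \<longlongrightarrow> 0) at_bot" by simp
  have "((\<lambda>t. d * (exp (- t) * g t)) \<longlongrightarrow> d * d) at_bot" by (intro tendsto_intros L)
  moreover have "d * d > 0" using d by (simp add: zero_less_mult_iff) linarith
  ultimately have "eventually (\<lambda>t. d * (exp (- t) * g t) > 0) at_bot" by (rule order_tendstoD)
  then have 1: "eventually (\<lambda>t. d * g t > 0) at_bot"
    by eventually_elim (simp add: zero_less_mult_iff mult_less_0_iff)
  have 2: "eventually (\<lambda>t. r t > 1 / 2) at_bot" using order_tendstoD(1)[OF r1, of "1 / 2"] by simp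
  have "((\<lambda>t. f t + 2 * r t) \<longlongrightarrow> - 1 + 2 * 1) at_bot" by (intro tendsto_intros L0 r1)
  then have 3: "eventually (\<lambda>t. f t + 2 * r t > 0) at_bot" by (intro order_tendstoD(1)) auto
  have "eventually (\<lambda>t. t < T \<and> d * g t > 0 \<and> r t > 1 / 2 \<and> f t + 2 * r t > 0) at_bot"
    using 1 2 3 eventually_gt_at_bot[of T] by eventually_elim auto
  then obtain T0 where T0: "\<And>t. t \<le> T0 \<Longrightarrow> t < T \<and> d * g t > 0 \<and> r t > 1 / 2 \<and> f t + 2 * r t > 0"
    unfolding eventually_at_bot_linorder by auto
  have gnz: "g t \<noteq> 0" if "t \<le> T0" for t using T0[OF that] by auto
  have dr: "(r has_real_derivative D t) (at t)" "(D has_real_derivative - (f t + 2 * r t) * D t - (1 - k) * r t * g t) (at t)"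
    if "t \<le> T0" for t
    using ode_sol_ratio_deriv[OF s _ gnz[OF that]] T0[OF that] unfolding r_def D_def by auto
  obtain A where A: "\<And>t. t < T0 \<Longrightarrow> (A has_real_derivative f t + 2 * r t) (at t)"
  proof -
    have "isCont (\<lambda>t. f t + 2 * r t) t" if "t < T0" for t
      using DERIV_isCont[OF dr(1)[of t]] DERIV_isCont[OF ode_solD(1)[OF s, of t]] T0[of t] that
      by (intro continuous_intros) auto
    then show ?thesis using einterval_antiderivative[of "- \<infinity>" "ereal T0" "\<lambda>t. f t + 2 * r t"] that
      by (auto simp: has_real_derivative_iff_has_vector_derivative)
  qed
  define T1 where "T1 = T0 - 1"
  \<comment> \<open>Since \<open>f + 2 r\<close> is positive near minus infinity, \<open>A\<close>
    is increasing and \<open>exp A\<close> stays bounded to the left; so \<open>E\<close> vanishes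
    at minus infinity together with \<open>D\<close>.\<close>
  have Ale: "A t \<le> A T1" if "t \<le> T1" for t
  proof (rule DERIV_nonneg_imp_nondecreasing[OF that])
    fix x assume "x \<le> T1"
    then have "x < T0" by (simp add: T1_def)
    then show "\<exists>y. (A has_real_derivative y) (at x) \<and> 0 \<le> y" using A[of x] T0[of x] by (auto intro: less_imp_le)
  qed
  define E where "E = (\<lambda>t. d * D t * exp (A t))"
  have dE: "(E has_real_derivative - ((1 - k) * (r t * (d * g t)) * exp (A t))) (at t)" if "t \<le> T1" for t
    unfolding E_def using that
    by (auto intro!: derivative_eq_intros A dr simp: T1_def algebra_simps)
  have E': "- ((1 - k) * (r t * (d * g t)) * exp (A t)) < 0" if "t \<le> T1" for t
    using T0[of t] that k by (simp add: T1_def)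
  have "((\<lambda>t. d * D t * exp (A T1)) \<longlongrightarrow> d * 0 * exp (A T1)) at_bot" by (intro tendsto_intros D0)
  then have "((\<lambda>t. d * D t * exp (A T1)) \<longlongrightarrow> 0) at_bot" by simp
  then have "(E \<longlongrightarrow> 0) at_bot"
  proof (rule tendsto_0_le[of _ _ _ 1])
    show "eventually (\<lambda>t. norm (E t) \<le> norm (d * D t * exp (A T1)) * 1) at_bot"
      using eventually_le_at_bot[of T1]
      by eventually_elim (use Ale in \<open>auto simp: E_def abs_mult intro!: mult_left_mono\<close>)
  qed
  then have "E t < 0" if "t \<le> T1" for t
    using less_limit_at_bot_if_decreasing[of T1 E _ 0 t, OF dE E'] that by blast
  then have Dneg: "d * D t < 0" if "t \<le> T1" for t
    using that by (simp add: E_def mult_less_0_iff zero_less_mult_iff)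
  have rd: "((\<lambda>t. d * r t) \<longlongrightarrow> d) at_bot" using tendsto_mult[OF tendsto_const[of d] r1] by simp
  have dr1: "d * r t < d" if "t \<le> T1" for t
    by (rule less_limit_at_bot_if_decreasing[of T1 "\<lambda>t. d * r t" "\<lambda>t. d * D t", OF _ Dneg rd that])
       (auto intro!: DERIV_cmult dr simp: T1_def)
  show ?thesis
  proof (rule that[of T1])
    show "T1 < T" using T0[of T0] by (simp add: T1_def)
    show "d * g t > 0" if "t \<le> T1" for t using T0[of t] that by (auto simp: T1_def)
    show "h t / g t > 0" if "t \<le> T1" for t
    proof -
      have "r t > 1 / 2" using T0[of t] that by (simp add: T1_def)
      then have "r t > 0" by linarith
      then show ?thesis by (simp add: r_def)
    qed
  qed (use Dneg dr1 in \<open>auto simp: D_def r_def\<close>)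
qed

text \<open>As long as \<open>g < 0\<close>, the derivative \<open>D\<close> of
  \<open>r = h / g\<close> stays positive: at a zero of \<open>D\<close> its derivative is
  \<open>- (1 - k) r g > 0\<close>. So \<open>r\<close> increases from a positive value,
  \<open>h = r g\<close> is negative, and \<open>g\<close> decreases and cannot come back to
  \<open>0\<close>. This rules out \<open>d < 0\<close> for a solution that has to reach
  \<open>0\<close>.\<close>

lemma unstable_negative_branch:
  assumes s: "ode_sol k {..<T} f g h" and u: "unstable d f g h" and k: "k < 1" and d: "d < 0" and t: "t < T"
  shows "g t < 0" "f t < - 1"
proof -
  define r where "r = (\<lambda>t. h t / g t)"
  define D where "D = (\<lambda>t. k * g t - f t * (h t / g t) - (h t / g t)\<^sup>2)"
  obtain T1 where T1: "T1 < T" "\<And>t. t \<le> T1 \<Longrightarrow> d * g t > 0" "\<And>t. t \<le> T1 \<Longrightarrow> r t > 0" "\<And>t. t \<le> T1 \<Longrightarrow> d * D t < 0"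
    using unstable_ratio[OF s u k] d unfolding r_def D_def by (metis less_irrefl)
  have gn: "g t < 0" "D t > 0" if "t \<le> T1" for t
    using T1(2,4)[OF that] d by (auto simp: zero_less_mult_iff mult_less_0_iff)
  have g: "g t < 0" if t: "t < T" for t
  proof (cases "t \<le> T1")
    case False
    have "0 < - g t"
    proof (rule barrier_pos[of T1 t "\<lambda>t. - g t" "\<lambda>t. - h t"])
      show "((\<lambda>t. - g t) has_real_derivative - h x) (at x)" if "T1 \<le> x" "x \<le> t" for x
        using ode_solD[OF s, of x] that t by (auto intro: DERIV_minus)
      fix x assume x: "T1 \<le> x" "x \<le> t" and past: "\<And>v. T1 \<le> v \<Longrightarrow> v < x \<Longrightarrow> 0 < - g v" and gx: "- g x = 0"
      have neq: "T1 < x" using gn(1)[of T1] gx x by (cases "T1 = x") auto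
      have dr: "(r has_real_derivative D v) (at v)" "(D has_real_derivative - (f v + 2 * r v) * D v - (1 - k) * r v * g v) (at v)"
        if "T1 \<le> v" "v < x" for v
        using ode_sol_ratio_deriv[OF s, of v] past[OF that] that x t unfolding r_def D_def by auto
      have rge: "r T1 \<le> r v" if "T1 \<le> v" "v < x" "\<And>w. T1 \<le> w \<Longrightarrow> w < v \<Longrightarrow> D w > 0" "D v \<ge> 0" for v
      proof (rule DERIV_nonneg_imp_nondecreasing[OF that(1)])
        fix w assume "T1 \<le> w" "w \<le> v"
        then have "D w \<ge> 0" using that(3)[of w] that(4) by (cases "w = v") auto
        then show "\<exists>y. (r has_real_derivative y) (at w) \<and> 0 \<le> y" using dr(1)[of w] \<open>T1 \<le> w\<close> \<open>w \<le> v\<close> that by auto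
      qed
      have Dp: "D v > 0" if v: "T1 \<le> v" "v < x" for v
      proof (rule barrier_pos[of T1 v D "\<lambda>v. - (f v + 2 * r v) * D v - (1 - k) * r v * g v"])
        show "(D has_real_derivative - (f w + 2 * r w) * D w - (1 - k) * r w * g w) (at w)" if "T1 \<le> w" "w \<le> v" for w
          using dr(2)[of w] that v by auto
        fix w assume w: "T1 \<le> w" "w \<le> v" "\<And>y. T1 \<le> y \<Longrightarrow> y < w \<Longrightarrow> 0 < D y" "D w = 0"
        have "r T1 \<le> r w" using rge[of w] w v by auto
        then have "r w > 0" using T1(3)[of T1] by simp
        moreover have "g w < 0" using past[of w] w v by auto
        ultimately show "0 < - (f w + 2 * r w) * D w - (1 - k) * r w * g w" using k w(4) by (simp add: mult_pos_neg)
      qed (use gn v in auto)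
      have h: "h v < 0" if "T1 \<le> v" "v < x" for v
      proof -
        have "r v > 0" using rge[of v] Dp that T1(3)[of T1] by (auto intro: less_imp_le order_less_le_trans)
        then show ?thesis using past[OF that] by (simp add: r_def zero_less_divide_iff)
      qed
      have "g T1 > g x"
      proof (rule DERIV_neg_imp_decreasing_open[OF neq])
        show "\<exists>y. (g has_real_derivative y) (at v) \<and> y < 0" if "T1 < v" "v < x" for v
          using h[of v] ode_solD(2)[OF s, of v] that x t by auto
        show "continuous_on {T1..x} g"
          using x t by (intro continuous_at_imp_continuous_on ballI DERIV_isCont[OF ode_solD(2)[OF s]]) auto
      qed
      then show "0 < - h x" using gx gn(1)[of T1] by simp
    qed (use False gn in auto)
    then show ?thesis by simp
  qed (use gn in auto)
  show "g t < 0" using g t .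
  show "f t < - 1"
    by (rule less_limit_at_bot_if_decreasing[of t f g "- 1" t, OF _ _ unstable_tendsto(1)[OF u]])
       (use t g ode_solD(1)[OF s] in auto)
qed

text \<open>\<open>J\<close> increases from \<open>0\<close>, so \<open>J > 0\<close>; at a zero of
  \<open>g\<close> it equals \<open>h\<close>, so \<open>g\<close> cannot vanish. At a first point
  with \<open>h = g\<close> the derivative of \<open>g - h\<close> would be
  \<open>g (f + 1 - k g)\<close>, positive because \<open>g < f + 1\<close> follows by integrating
  \<open>h < g\<close> up to there. The last inequality says that the primitive
  \<open>g + f^2 / 2 - 1 / 2\<close> of \<open>J\<close> is positive. The last and the fourth are
  the comparison inequalities behind the \<open>tanh\<close> and \<open>exp\<close> bounds.\<close>

lemma unstable_positive_branch:
  assumes s: "ode_sol k {..<T} f g h" and u: "unstable d f g h" and k: "- 1 < k" "k < 1" and d: "d > 0" and t: "t < T"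
  shows "g t > 0" "h t + f t * g t > 0" "h t < g t" "g t < f t + 1" "f t > - 1" "g t > (1 - (f t)\<^sup>2) / 2"
proof -
  obtain T1 where T1: "T1 < T" "\<And>t. t \<le> T1 \<Longrightarrow> d * g t > 0" "\<And>t. t \<le> T1 \<Longrightarrow> d * (h t / g t) < d"
    using unstable_ratio[OF s u k(2)] d by (metis less_irrefl)
  note L = unstable_tendsto[OF u]
  have g1: "g t > 0" if "t \<le> T1" for t using T1(2)[OF that] d by (simp add: zero_less_mult_iff)
  have h1: "h t < g t" if "t \<le> T1" for t using T1(3)[OF that] g1[OF that] d by (simp add: field_simps)
  define J where "J = (\<lambda>t. h t + f t * g t)"
  have J': "(J has_real_derivative (1 + k) * (g t)\<^sup>2) (at t)" if "t < T" for t
    unfolding J_def using that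
    by (auto intro!: derivative_eq_intros ode_solD[OF s] simp: power2_eq_square algebra_simps)
  have "(J \<longlongrightarrow> 0 + (- 1) * 0) at_bot" unfolding J_def by (intro tendsto_intros L)
  then have J0: "(J \<longlongrightarrow> 0) at_bot" by simp
  have J: "J t > 0" if t: "t < T" for t
  proof (cases "t \<le> T1")
    case True
    show ?thesis
      by (rule greater_limit_at_bot_if_increasing[of t J _ 0 t, OF J' _ J0])
         (use True t g1 k in \<open>auto simp: zero_less_mult_iff less_imp_neq[symmetric]\<close>)
  next
    case False
    have "0 < J T1"
      by (rule greater_limit_at_bot_if_increasing[of T1 J _ 0 T1, OF J' _ J0])
         (use T1 g1 k in \<open>auto simp: zero_less_mult_iff less_imp_neq[symmetric]\<close>)
    also have "J T1 \<le> J t"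
    proof (rule DERIV_nonneg_imp_nondecreasing[of T1 t J])
      fix x assume "x \<le> t"
      then show "\<exists>y. (J has_real_derivative y) (at x) \<and> 0 \<le> y" using J'[of x] t k by (intro exI conjI) auto
    qed (use False in auto)
    finally show ?thesis .
  qed
  have g: "g t > 0" if t: "t < T" for t
  proof (cases "t \<le> T1")
    case False
    show ?thesis
    proof (rule barrier_pos[of T1 t g h])
      show "0 < h x" if "T1 \<le> x" "x \<le> t" "g x = 0" for x using J[of x] that t by (simp add: J_def)
    qed (use False t g1 ode_solD(2)[OF s] in auto)
  qed (use g1 in auto)
  have f: "f t > - 1" if t: "t < T" for t
    by (rule greater_limit_at_bot_if_increasing[of t f g, OF _ _ L(1)]) (use t g ode_solD(1)[OF s] in auto)
  have "((\<lambda>t. f t + 1 - g t) \<longlongrightarrow> - 1 + 1 - 0) at_bot" by (intro tendsto_intros L)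
  then have s0: "((\<lambda>t. f t + 1 - g t) \<longlongrightarrow> 0) at_bot" by simp
  \<comment> \<open>Stated with \<open>h < g\<close> assumed only before \<open>t\<close>, so that
    it can be used inside the barrier argument that proves \<open>h < g\<close>.\<close>
  have s1: "f t + 1 - g t > 0" if "t < T" "\<And>v. v < t \<Longrightarrow> h v < g v" "h t \<le> g t" for t
  proof -
    define q where "q = (\<lambda>t. f t + 1 - g t)"
    have q': "(q has_real_derivative g v - h v) (at v)" if "v \<le> t" for v
      unfolding q_def using that \<open>t < T\<close> by (auto intro!: derivative_eq_intros ode_solD[OF s])
    have "q (t - 1) > 0"
      by (rule greater_limit_at_bot_if_increasing[of "t - 1" q "\<lambda>t. g t - h t" 0 "t - 1"])
         (use that q' s0 in \<open>auto simp: q_def\<close>)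
    also have "q (t - 1) \<le> q t"
    proof (rule DERIV_nonneg_imp_nondecreasing[of "t - 1" t q])
      fix x assume "t - 1 \<le> x" "x \<le> t"
      then show "\<exists>y. (q has_real_derivative y) (at x) \<and> 0 \<le> y"
        using q'[of x] that(2)[of x] that(3) by (intro exI[of _ "g x - h x"]) (cases "x = t"; auto)
    qed auto
    finally show ?thesis by (simp add: q_def)
  qed
  have h: "h t < g t" if t: "t < T" for t
  proof (cases "t \<le> T1")
    case False
    have "0 < g t - h t"
    proof (rule barrier_pos[of T1 t "\<lambda>t. g t - h t" "\<lambda>t. h t - (k * (g t)\<^sup>2 - f t * h t)"])
      fix x assume x: "T1 \<le> x" "x \<le> t" and past: "\<And>v. T1 \<le> v \<Longrightarrow> v < x \<Longrightarrow> 0 < g v - h v" and eq: "g x - h x = 0"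
      have p: "h v < g v" if "v < x" for v using past[of v] h1[of v] that by (cases "v \<le> T1") auto
      have q: "g x < f x + 1" using s1[of x] p eq x t by auto
      have gx: "g x > 0" using g x t by auto
      have "k * g x < f x + 1"
      proof (cases "k \<le> 0")
        case True
        then have "k * g x \<le> 0" using gx by (simp add: mult_nonpos_nonneg)
        then show ?thesis using f[of x] x t by simp
      next
        case False
        have "k * g x \<le> 1 * g x" using k gx by (intro mult_right_mono) auto
        then show ?thesis using q by simp
      qed
      then have "0 < g x * (f x + 1 - k * g x)" using gx by simp
      then show "0 < h x - (k * (g x)\<^sup>2 - f x * h x)" using eq by (simp add: algebra_simps power2_eq_square)
    qed (use False t h1 ode_solD(2,3)[OF s] in \<open>auto intro!: DERIV_diff\<close>)
    then show ?thesis by simp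
  qed (use h1 in auto)
  have q: "(1 - (f t)\<^sup>2) / 2 < g t"
  proof -
    have "((\<lambda>t. g t + (f t)\<^sup>2 / 2 - 1 / 2) \<longlongrightarrow> 0 + (- 1)\<^sup>2 / 2 - 1 / 2) at_bot" by (intro tendsto_intros L) auto
    then have l: "((\<lambda>t. g t + (f t)\<^sup>2 / 2 - 1 / 2) \<longlongrightarrow> 0) at_bot" by simp
    have "0 < g t + (f t)\<^sup>2 / 2 - 1 / 2"
      by (rule greater_limit_at_bot_if_increasing[of t _ J, OF _ _ l])
         (use t J in \<open>auto intro!: derivative_eq_intros ode_solD[OF s] simp: J_def\<close>)
    then show ?thesis by (simp add: field_simps)
  qed
  show "g t > 0" "h t + f t * g t > 0" "h t < g t" "g t < f t + 1" "f t > - 1" "g t > (1 - (f t)\<^sup>2) / 2"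
    using g[OF t] J[OF t] h f[OF t] q s1[OF t] t unfolding J_def by (auto intro: less_imp_le)
qed

section \<open>The normalized solution\<close>

lemma unstable_shift:
  assumes "unstable d f g h"
  shows "unstable (d * exp c) (\<lambda>t. f (t + c)) (\<lambda>t. g (t + c)) (\<lambda>t. h (t + c))"
proof -
  obtain C T where CT: "\<And>t. t \<le> T \<Longrightarrow> \<bar>f t + 1 - d * exp t\<bar> \<le> C * exp (3 / 2 * t) \<and>
     \<bar>g t - d * exp t\<bar> \<le> C * exp (3 / 2 * t) \<and> \<bar>h t - d * exp t\<bar> \<le> C * exp (3 / 2 * t)"
    using assms unfolding unstable_def by blast
  show ?thesis unfolding unstable_def
  proof (rule exI[of _ "C * exp (3 / 2 * c)"], rule exI[of _ "T - c"], intro allI impI)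
    fix t assume "t \<le> T - c"
    with CT[of "t + c"] show "\<bar>f (t + c) + 1 - d * exp c * exp t\<bar> \<le> C * exp (3 / 2 * c) * exp (3 / 2 * t) \<and>
     \<bar>g (t + c) - d * exp c * exp t\<bar> \<le> C * exp (3 / 2 * c) * exp (3 / 2 * t) \<and>
     \<bar>h (t + c) - d * exp c * exp t\<bar> \<le> C * exp (3 / 2 * c) * exp (3 / 2 * t)"
      by (simp add: exp_add distrib_left mult_ac add_divide_distrib)
  qed
qed

lemma unstable_cong:
  assumes "unstable d f g h" and "\<And>t. t < T \<Longrightarrow> f' t = f t" "\<And>t. t < T \<Longrightarrow> g' t = g t" "\<And>t. t < T \<Longrightarrow> h' t = h t"
  shows "unstable d f' g' h'"
proof -
  obtain C S where CT: "\<And>t. t \<le> S \<Longrightarrow> \<bar>f t + 1 - d * exp t\<bar> \<le> C * exp (3 / 2 * t) \<and>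
     \<bar>g t - d * exp t\<bar> \<le> C * exp (3 / 2 * t) \<and> \<bar>h t - d * exp t\<bar> \<le> C * exp (3 / 2 * t)"
    using assms(1) unfolding unstable_def by blast
  show ?thesis unfolding unstable_def
    by (rule exI[of _ C], rule exI[of _ "min S (T - 1)"]) (use CT assms(2-) in auto)
qed

text \<open>The inequalities of the positive branch are the a priori bounds:
  \<open>g < f + 1\<close> makes \<open>(f + 1) exp (- t)\<close> nonincreasing, which bounds
  \<open>f\<close> on finite intervals, and \<open>0 < g < f + 1\<close> and
  \<open>- f g < h < g\<close> bound the rest. They apply to every continuation because being
  \<open>unstable\<close> depends only on the germ at minus infinity.\<close>

lemma global_lyapunov_solution:
  assumes m: "m > 1 / 2" and k: "k = (m - 1) / m"
  obtains f g h where "ode_sol k UNIV f g h" "unstable 1 f g h"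
    "\<And>t. t < 0 \<Longrightarrow> (\<lambda>n. lyapunov_coeff m 1 (Suc n) * exp t ^ Suc n) sums (f t + 1)"
proof -
  have kb: "- 1 < k" "k < 1" "\<bar>k\<bar> \<le> 1" using m by (auto simp: k field_simps abs_le_iff)
  obtain f0 g0 h0 where s2: "ode_sol k {..<ln 2} f0 g0 h0"
    and sums: "\<And>t. t < ln 2 \<Longrightarrow> (\<lambda>n. lyapunov_coeff m 1 (Suc n) * exp t ^ Suc n) sums (f0 t + 1)"
    and lim: "((\<lambda>t. exp (- t) * (f0 t + 1)) \<longlongrightarrow> 1) at_bot" "((\<lambda>t. exp (- t) * g0 t) \<longlongrightarrow> 1) at_bot"
      "((\<lambda>t. exp (- t) * h0 t) \<longlongrightarrow> 1) at_bot"
    by (rule lyapunov_series_solution[OF k kb(3)]) blast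
  have s: "ode_sol k {..<0} f0 g0 h0" by (rule ode_sol_subset[OF s2]) auto
  obtain d where u: "unstable d f0 g0 h0"
    by (rule unstableI_decay[OF s kb(3)]) (use decay_mult_exp[of _ _ "3 / 4"] lim in auto)
  have "d = 1" using tendsto_unique[OF _ unstable_lims(1)[OF u] lim(1)] by simp
  then have u1: "unstable 1 f0 g0 h0" using u by simp
  have ext: "unstable 1 f g h" if "ode_sol k {..<T'} f g h" "0 \<le> T'" "\<forall>t<0. f t = f0 t" for T' f g h
    by (rule unstable_cong[OF u1, of 0]) (use that ode_sol_unique_extension[OF that(1), of f0 g0 h0 0]
       ode_sol_derivs_eq[OF ode_sol_subset[OF that(1), of "{..<0}"] s] in auto)
  obtain f g h where fgh: "ode_sol k UNIV f g h" "\<And>t. t < 0 \<Longrightarrow> f t = f0 t"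
  proof (rule ode_sol_global[OF kb(3) s])
    fix T
    \<comment> \<open>The value at \<open>-1\<close> is transported to the right end by the
      monotonicity of \<open>(f + 1) exp (- t)\<close>, so \<open>f + 1 <= E\<close> on the range
      considered.\<close>
    define E where "E = (f0 (- 1) + 1) * exp (T + 1)"
    define M where "M = \<bar>E\<bar> + 2"
    have M1: "M \<ge> 1" by (simp add: M_def)
    show "\<exists>M\<ge>1. \<forall>T' f g h. 0 \<le> T' \<and> T' \<le> T \<and> ode_sol k {..<T'} f g h \<and> (\<forall>t<0. f t = f0 t) \<longrightarrow>
        (\<forall>t. 0 - 1 \<le> t \<and> t < T' \<longrightarrow> \<bar>f t\<bar> \<le> M \<and> \<bar>g t\<bar> \<le> M\<^sup>2 \<and> \<bar>h t\<bar> \<le> M ^ 3)"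
    proof (intro exI[of _ M] conjI M1 allI impI; (elim conjE)?)
      fix T' f g h t assume T': "0 \<le> T'" "T' \<le> T" and sol: "ode_sol k {..<T'} f g h"
        and eq: "\<forall>t<0. f t = f0 t" and t: "0 - 1 \<le> t" "t < T'"
      note P = unstable_positive_branch[OF sol ext[OF sol T'(1) eq] kb(1,2)]
      have "(f t + 1) * exp (- t) \<le> (f (- 1) + 1) * exp (- (- 1))"
      proof (rule DERIV_nonpos_imp_nonincreasing[of "- 1" t "\<lambda>t. (f t + 1) * exp (- t)"])
        fix x assume "x \<le> t"
        then have x: "x < T'" using t by simp
        have "((\<lambda>t. (f t + 1) * exp (- t)) has_real_derivative (g x - (f x + 1)) * exp (- x)) (at x)"
          using x by (auto intro!: derivative_eq_intros ode_solD[OF sol] simp: algebra_simps)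
        moreover have "(g x - (f x + 1)) * exp (- x) \<le> 0" using P(4)[of x] x by (intro mult_nonpos_nonneg) auto
        ultimately show "\<exists>y. ((\<lambda>t. (f t + 1) * exp (- t)) has_real_derivative y) (at x) \<and> y \<le> 0" by blast
      qed (use t in auto)
      then have "f t + 1 \<le> (f (- 1) + 1) * exp 1 * exp t" by (simp add: exp_minus field_simps)
      also have "\<dots> = (f (- 1) + 1) * exp (t + 1)" by (simp add: exp_add)
      also have "\<dots> \<le> (f (- 1) + 1) * exp (T + 1)"
        using P(5)[of "- 1"] t T' by (intro mult_left_mono) auto
      finally have fE: "f t + 1 \<le> E" using eq by (simp add: E_def)
      have p: "g t > 0" "h t + f t * g t > 0" "h t < g t" "g t < f t + 1" "f t > - 1" using P[of t] t by auto
      have f: "\<bar>f t\<bar> \<le> M" using fE p by (auto simp: M_def)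
      have g: "\<bar>g t\<bar> \<le> M" using fE p by (auto simp: M_def)
      have "\<bar>f t * g t\<bar> \<le> M * M" unfolding abs_mult using f g by (intro mult_mono) auto
      moreover have MM: "M \<le> M * M" "M * M \<le> M * M * M" using M1 by (auto intro: mult_right_mono simp: mult_le_cancel_left1)
      ultimately have "\<bar>h t\<bar> \<le> M * M" using p g by linarith
      then show "\<bar>f t\<bar> \<le> M" "\<bar>g t\<bar> \<le> M\<^sup>2" "\<bar>h t\<bar> \<le> M ^ 3"
        using f g MM by (auto simp: power2_eq_square power3_eq_cube)
    qed
  qed blast
  show ?thesis
  proof (rule that[OF fgh(1)])
    show "unstable 1 f g h" by (rule ext[of 0]) (use fgh ode_sol_subset[OF fgh(1)] in auto)
    show "(\<lambda>n. lyapunov_coeff m 1 (Suc n) * exp t ^ Suc n) sums (f t + 1)" if "t < 0" for t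
    proof -
      have "t < ln 2" using that by (simp add: less_trans[of t 0])
      then show ?thesis using sums[of t] fgh(2)[OF that] by simp
    qed
  qed
qed

text \<open>The solution with parameter \<open>1\<close> is shifted so that its zero
  \<open>c\<close> moves to the origin; the shift turns the parameter into
  \<open>exp c\<close>.\<close>

lemma normalized_solution:
  assumes m: "m > 1 / 2" and k: "k = (m - 1) / m"
  obtains f g h d where "ode_sol k UNIV f g h" "unstable d f g h" "d > 0" "f 0 = 0"
    "\<And>t. d * exp t < 1 \<Longrightarrow> (\<lambda>n. lyapunov_coeff m 1 (Suc n) * (d * exp t) ^ Suc n) sums (f t + 1)"
proof -
  have kb: "- 1 < k" "k < 1" "\<bar>k\<bar> \<le> 1" using m by (auto simp: k field_simps abs_le_iff)
  obtain f g h where s: "ode_sol k UNIV f g h" and u: "unstable 1 f g h"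
    and sums: "\<And>t. t < 0 \<Longrightarrow> (\<lambda>n. lyapunov_coeff m 1 (Suc n) * exp t ^ Suc n) sums (f t + 1)"
    by (rule global_lyapunov_solution[OF m k]) blast
  have P: "g t > 0" "f t > - 1" "g t > (1 - (f t)\<^sup>2) / 2" for t
    using unstable_positive_branch[OF ode_sol_subset[OF s, of "{..<t + 1}"] u kb(1,2), of t] by auto
  note D = ode_solD[OF s UNIV_I]
  have mono: "f x < f y" if "x < y" for x y
    by (rule DERIV_pos_imp_increasing[OF that]) (use D(1) P in blast)
  have "\<exists>t. f t \<ge> 0"
  proof (rule ccontr)
    assume "\<not> ?thesis"
    then have neg: "f t < 0" for t by (simp add: not_le)
    \<comment> \<open>If \<open>f\<close> stayed negative, monotonicity would keep
      \<open>f^2 <= (f 0)^2\<close> for \<open>t >= 0\<close>, and \<open>g > (1 - f^2) / 2\<close>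
      would bound the slope below by \<open>c\<close>; then
      \<open>f (1 / c) >= f 0 + 1 > 0\<close>.\<close>
    define c where "c = (1 - (f 0)\<^sup>2) / 2"
    have c: "c > 0" using P(2)[of 0] neg[of 0] by (simp add: c_def power2_less_1_iff abs_less_iff)
    have "f t - c * t \<ge> f 0 - c * 0" if "t \<ge> 0" for t
    proof (rule DERIV_nonneg_imp_nondecreasing[of 0 t "\<lambda>t. f t - c * t", OF that])
      fix x :: real assume x: "0 \<le> x"
      have "f 0 \<le> f x" using mono[of 0 x] x by (cases "x = 0") auto
      then have "\<bar>f x\<bar> \<le> \<bar>f 0\<bar>" using neg[of x] neg[of 0] by simp
      then have "(f x)\<^sup>2 \<le> (f 0)\<^sup>2" by (rule abs_le_square_iff[THEN iffD1])
      then have "g x - c \<ge> 0" using P(3)[of x] by (simp add: c_def field_simps)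
      moreover have "((\<lambda>t. f t - c * t) has_real_derivative g x - c) (at x)"
        by (auto intro!: derivative_eq_intros D)
      ultimately show "\<exists>y. ((\<lambda>t. f t - c * t) has_real_derivative y) (at x) \<and> 0 \<le> y" by blast
    qed
    from this[of "1 / c"] neg[of "1 / c"] c P(2)[of 0] show False by simp
  qed
  then obtain b where b: "f b \<ge> 0" by blast
  obtain a where a: "f a < 0"
  proof -
    have "eventually (\<lambda>t. f t < 0) at_bot" using unstable_tendsto(1)[OF u] by (rule order_tendstoD) simp
    then show ?thesis using that eventually_happens by fastforce
  qed
  have "a \<le> b" using mono[of b a] a b by (cases "a \<le> b") auto
  then obtain c where c: "f c = 0"
    using IVT[of f a 0 b] a b DERIV_isCont[OF D(1)] by auto
  show ?thesis
  proof (rule that)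
    show "ode_sol k UNIV (\<lambda>t. f (t + c)) (\<lambda>t. g (t + c)) (\<lambda>t. h (t + c))"
      using ode_sol_shift[OF s, of c] by simp
    show "unstable (exp c) (\<lambda>t. f (t + c)) (\<lambda>t. g (t + c)) (\<lambda>t. h (t + c))"
      using unstable_shift[OF u, of c] by simp
    show "(\<lambda>n. lyapunov_coeff m 1 (Suc n) * (exp c * exp t) ^ Suc n) sums (f (t + c) + 1)"
      if "exp c * exp t < 1" for t
    proof -
      have "exp (t + c) < exp 0" using that by (simp add: exp_add mult.commute)
      then have "t + c < 0" by (subst (asm) exp_less_cancel_iff)
      then show ?thesis using sums[of "t + c"] by (simp add: exp_add mult.commute)
    qed
  qed (use c in auto)
qed

text \<open>The primes denote a second solution, known only on the open half-line with a limit at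
  \<open>0\<close>. For \<open>d' < 0\<close> it stays below \<open>-1\<close>, for
  \<open>d' = 0\<close> it is the constant \<open>-1\<close>, and neither reaches \<open>0\<close>.
  For \<open>d' > 0\<close> it is a shift of \<open>f\<close>, and as \<open>f\<close> is strictly
  increasing with its zero at the origin, the shift is trivial.\<close>

lemma half_line_unique:
  assumes k: "- 1 < k" "k < 1" and s: "ode_sol k UNIV f g h" and u: "unstable d f g h" "d > 0" and f0: "f 0 = 0"
    and s': "ode_sol k {..<0} f' g' h'" and u': "unstable d' f' g' h'" and f'0: "(f' \<longlongrightarrow> 0) (at_left 0)"
    and t: "t < 0"
  shows "f' t = f t"
proof -
  have kb: "\<bar>k\<bar> \<le> 1" using k by simp
  have contra: False if "\<And>t. t < 0 \<Longrightarrow> f' t \<le> - 1"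
  proof -
    have "eventually (\<lambda>t. f' t \<le> - 1) (at_left 0)"
      using that by (auto simp: eventually_at_filter)
    then have "0 \<le> - (1::real)" by (intro tendsto_upperbound[OF f'0]) auto
    then show False by simp
  qed
  have "\<not> d' < 0" using unstable_negative_branch(2)[OF s' u' k(2)] contra by (meson less_imp_le)
  moreover have "d' \<noteq> 0"
  proof
    assume 0: "d' = 0"
    have c: "ode_sol k {..<0} (\<lambda>_. - 1) (\<lambda>_. 0) (\<lambda>_. 0)" by (auto simp: ode_sol_def)
    have uc: "unstable 0 (\<lambda>_. - 1) (\<lambda>_. 0) (\<lambda>_. 0)" unfolding unstable_def by (intro exI[of _ 0]) auto
    have "f' t = - 1" if "t < 0" for t
      using unstable_unique[OF s' c kb _ uc that] u' 0 by simp
    then show False using contra by simp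
  qed
  ultimately have d': "d' > 0" by simp
  define c where "c = ln (d' / d)"
  have "d * exp c = d'" using d' u(2) by (simp add: c_def)
  then have uc: "unstable d' (\<lambda>t. f (t + c)) (\<lambda>t. g (t + c)) (\<lambda>t. h (t + c))"
    using unstable_shift[OF u(1), of c] by simp
  have sc: "ode_sol k {..<0} (\<lambda>t. f (t + c)) (\<lambda>t. g (t + c)) (\<lambda>t. h (t + c))"
    by (rule ode_sol_subset[OF ode_sol_shift[OF s]]) auto
  have eq: "f' t = f (t + c)" if "t < 0" for t
    using unstable_unique[OF s' sc kb u' uc that] .
  have "isCont (\<lambda>t. f (t + c)) 0"
    using DERIV_isCont[OF ode_solD(1)[OF ode_sol_shift[OF s, of c]]] by simp
  then have "((\<lambda>t. f (t + c)) \<longlongrightarrow> f (0 + c)) (at_left 0)"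
    unfolding isCont_def by (rule tendsto_mono[OF at_le, rotated]) auto
  then have lim_c: "(f' \<longlongrightarrow> f c) (at_left 0)"
    using Lim_transform_eventually[of "\<lambda>t. f (t + c)" "f (0 + c)" "at_left 0" f'] eq
    by (simp add: eventually_at_filter)
  have fc: "f c = 0" using tendsto_unique[OF _ lim_c f'0] by simp
  have g: "g t > 0" for t
    using unstable_positive_branch(1)[OF ode_sol_subset[OF s, of "{..<t + 1}"] u(1) k u(2), of t] by auto
  have mono: "f x < f y" if "x < y" for x y
    by (rule DERIV_pos_imp_increasing[OF that]) (use ode_solD(1)[OF s] g in blast)
  have "c = 0" using mono[of c 0] mono[of 0 c] fc f0 by (cases c "0::real" rule: linorder_cases) auto
  then show ?thesis using eq[OF t] by simp
qed

text \<open>The bound by \<open>exp\<close> holds because \<open>(f + 1) exp (- t)\<close> is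
  strictly decreasing with value \<open>1\<close> at \<open>0\<close>. The function
  \<open>tanh (t / 2)\<close> solves \<open>y' = (1 - y^2) / 2\<close>, for which \<open>f\<close>
  is a strict supersolution; so \<open>f - tanh (t / 2)\<close> can change sign only upwards and
  does so at \<open>0\<close>.\<close>

lemma normalized_bounds:
  assumes k: "- 1 < k" "k < 1" and s: "ode_sol k UNIV f g h" and u: "unstable d f g h" "d > 0" and f0: "f 0 = 0"
  shows "t \<le> 0 \<Longrightarrow> exp t - 1 \<le> f t \<and> f t \<le> tanh (t / 2)"
    and "t > 0 \<Longrightarrow> tanh (t / 2) < f t \<and> f t < exp t - 1"
proof -
  note D = ode_solD[OF s UNIV_I]
  have P: "g t > 0" "g t < f t + 1" "f t > - 1" "g t > (1 - (f t)\<^sup>2) / 2" for t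
    using unstable_positive_branch[OF ode_sol_subset[OF s, of "{..<t + 1}"] u(1) k u(2), of t] by auto
  have dec: "(f y + 1) * exp (- y) < (f x + 1) * exp (- x)" if "x < y" for x y
  proof (rule DERIV_neg_imp_decreasing[of x y "\<lambda>t. (f t + 1) * exp (- t)", OF that])
    fix x
    have "((\<lambda>t. (f t + 1) * exp (- t)) has_real_derivative (g x - (f x + 1)) * exp (- x)) (at x)"
      by (auto intro!: derivative_eq_intros D simp: algebra_simps)
    moreover have "(g x - (f x + 1)) * exp (- x) < 0" using P(2)[of x] by (intro mult_neg_pos) auto
    ultimately show "\<exists>y. ((\<lambda>t. (f t + 1) * exp (- t)) has_real_derivative y) (at x) \<and> y < 0" by blast
  qed
  define N where "N = (\<lambda>t. f t - tanh (t / 2))"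
  define N' where "N' = (\<lambda>t. g t - (1 - (tanh (t / 2))\<^sup>2) / 2)"
  have dN: "(N has_real_derivative N' t) (at t)" for t
    unfolding N_def N'_def by (auto intro!: derivative_eq_intros D cosh_real_nonzero)
  have zero: "N' t > 0" if "N t = 0" for t using that P(4)[of t] by (simp add: N_def N'_def)
  have N0: "N 0 = 0" by (simp add: N_def f0)
  have pos: "N y > 0" if "N x > 0" "x \<le> y" for x y
    by (rule barrier_pos[of x y N N']) (use dN zero that in auto)
  show "exp t - 1 \<le> f t \<and> f t \<le> tanh (t / 2)" if t: "t \<le> 0"
  proof
    show "exp t - 1 \<le> f t"
      using dec[of t 0] t f0 by (cases "t = 0") (auto simp: exp_minus field_simps)
    show "f t \<le> tanh (t / 2)" using pos[of t 0] t N0 by (auto simp: N_def not_less[symmetric])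
  qed
  show "tanh (t / 2) < f t \<and> f t < exp t - 1" if t: "t > 0"
  proof
    obtain e where e: "e > 0" "\<And>x. 0 < x \<Longrightarrow> x < e \<Longrightarrow> N 0 < N (0 + x)"
      using DERIV_pos_inc_right[OF dN zero[OF N0]] by auto
    have "N (min (e / 2) t) > 0" using e(2)[of "min (e / 2) t"] e(1) t N0 by auto
    then have "N t > 0" by (rule pos) simp
    then show "tanh (t / 2) < f t" by (simp add: N_def)
    show "f t < exp t - 1" using dec[of 0 t] t f0 by (simp add: exp_minus field_simps)
  qed
qed

section \<open>Growth at plus infinity\<close>

text \<open>In the scale and shift invariant quantities \<open>G = f f'' / f'\<^sup>2\<close> and \<open>p = f' / f\<^sup>2\<close> the equation
  becomes a first order one, in which \<open>G\<close> is attracted to \<open>k\<close> as \<open>p\<close> decreases to \<open>0\<close>; \<open>K\<close> below is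
  \<open>(G - k) / p\<close>, and \<open>X = 1 + G p\<close> is needed only to bound \<open>G\<close> from below.\<close>

lemma ode_sol_growth:
  assumes k: "- 1 < k" "k < 1" and s: "ode_sol k {T<..} f g h" and f_top: "filterlim f at_top at_top"
  obtains H C T1 where "H > 0" "T1 > T" "((\<lambda>t. g t * f t powr (- k)) \<longlongrightarrow> H) at_top"
    "\<And>t. t \<ge> T1 \<Longrightarrow> f t \<ge> 1 \<and> g t > 0 \<and> \<bar>h t\<bar> \<le> C * (g t)\<^sup>2 / f t \<and> \<bar>k * (g t)\<^sup>2 - f t * h t\<bar> \<le> C * (g t) ^ 3 / (f t)\<^sup>2"
proof -
  have not_bounded: False if "\<And>t. t \<ge> a \<Longrightarrow> f t \<le> B" for a B
  proof -
    have "eventually (\<lambda>t. f t > B) at_top" using f_top by (simp add: filterlim_at_top_dense)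
    then have "eventually (\<lambda>t. t \<ge> a \<and> f t > B) at_top" using eventually_ge_at_top[of a] by eventually_elim auto
    then obtain t where "t \<ge> a" "f t > B" using eventually_happens by fastforce
    with that[of t] show False by simp
  qed
  have "eventually (\<lambda>t. t > T \<and> f t \<ge> 1) at_top"
    using f_top eventually_gt_at_top[of T] by (simp add: filterlim_at_top eventually_conj_iff)
  then obtain T0 where T0: "\<And>t. t \<ge> T0 \<Longrightarrow> t > T \<and> f t \<ge> 1" unfolding eventually_at_top_linorder by auto
  have D: "(f has_real_derivative g t) (at t)" "(g has_real_derivative h t) (at t)"
    "(h has_real_derivative k * (g t)\<^sup>2 - f t * h t) (at t)" if "t \<ge> T0" for t
    using ode_solD[OF s, of t] T0[OF that] by auto
  have f1: "f t \<ge> 1" if "t \<ge> T0" for t using T0[OF that] by auto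
  have no_decr: False if a: "a \<ge> T0" "\<And>t. t \<ge> a \<Longrightarrow> g t \<le> 0" for a
  proof (rule not_bounded[of a "f a"])
    fix t assume t: "a \<le> t"
    show "f t \<le> f a"
    proof (rule DERIV_nonpos_imp_nonincreasing[OF t])
      fix x assume "a \<le> x"
      then show "\<exists>y. (f has_real_derivative y) (at x) \<and> y \<le> 0" using D(1)[of x] a(2)[of x] a(1) by auto
    qed
  qed
  define J where "J = (\<lambda>t. h t + f t * g t)"
  have J': "(J has_real_derivative (1 + k) * (g t)\<^sup>2) (at t)" if "t \<ge> T0" for t
    unfolding J_def using that by (auto intro!: derivative_eq_intros D simp: power2_eq_square algebra_simps)
  have Jmono: "J x \<le> J y" if "T0 \<le> x" "x \<le> y" for x y
  proof (rule DERIV_nonneg_imp_nondecreasing[OF that(2)])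
    fix z assume "x \<le> z"
    then show "\<exists>y. (J has_real_derivative y) (at z) \<and> 0 \<le> y" using J'[of z] that k by (intro exI conjI) auto
  qed
  \<comment> \<open>If \<open>J <= 0\<close> throughout, \<open>f\<close> would be bounded: either
    \<open>g > 0\<close> and \<open>(f + g)' <= g (1 - f) <= 0\<close>, or \<open>g <= 0\<close> at
    some point and then always after it, since \<open>g exp A\<close> with \<open>A' = f\<close> has
    the derivative \<open>J exp A\<close>.\<close>
  have "\<exists>t\<ge>T0. J t > 0"
  proof (rule ccontr)
    assume "\<not> ?thesis"
    then have Jle: "J t \<le> 0" if "t \<ge> T0" for t using that by (auto simp: not_less)
    show False
    proof (cases "\<exists>t\<ge>T0. g t \<le> 0")
      case False
      then have gp: "g t > 0" if "t \<ge> T0" for t using that by auto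
      have dec: "f t + g t \<le> f T0 + g T0" if "t \<ge> T0" for t
      proof (rule DERIV_nonpos_imp_nonincreasing[of T0 t "\<lambda>t. f t + g t", OF that])
        fix x assume x: "T0 \<le> x"
        have "g x * (1 - f x) \<le> 0" using gp[OF x] f1[OF x] by (intro mult_nonneg_nonpos) auto
        then have "g x + h x \<le> 0" using Jle[OF x] by (simp add: J_def algebra_simps)
        then show "\<exists>y. ((\<lambda>t. f t + g t) has_real_derivative y) (at x) \<and> y \<le> 0"
          using DERIV_add[OF D(1,2)[OF x]] by blast
      qed
      show False
      proof (rule not_bounded[of T0 "f T0 + g T0"])
        show "f t \<le> f T0 + g T0" if "T0 \<le> t" for t using dec[OF that] gp[OF that] by simp
      qed
    next
      case True
      then obtain t2 where t2: "t2 \<ge> T0" "g t2 \<le> 0" by blast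
      obtain A where A: "\<And>t. t > T \<Longrightarrow> (A has_real_derivative f t) (at t)"
        using antiderivative_exists[of T f] DERIV_isCont[OF ode_solD(1)[OF s]] by auto
      show False
      proof (rule no_decr[of t2])
        fix t assume t: "t2 \<le> t"
        have "g t * exp (A t) \<le> g t2 * exp (A t2)"
        proof (rule DERIV_nonpos_imp_nonincreasing[of t2 t "\<lambda>t. g t * exp (A t)", OF t])
          fix x assume "t2 \<le> x"
          then have x: "x \<ge> T0" using t2 by simp
          have "((\<lambda>t. g t * exp (A t)) has_real_derivative J x * exp (A x)) (at x)"
            unfolding J_def using x T0[OF x] by (auto intro!: derivative_eq_intros D A simp: algebra_simps)
          moreover have "J x * exp (A x) \<le> 0" using Jle[OF x] by (intro mult_nonpos_nonneg) auto
          ultimately show "\<exists>y. ((\<lambda>t. g t * exp (A t)) has_real_derivative y) (at x) \<and> y \<le> 0" by blast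
        qed
        also have "\<dots> \<le> 0" using t2 by (intro mult_nonpos_nonneg) auto
        finally show "g t \<le> 0" by (simp add: mult_le_0_iff)
      qed (rule t2)
    qed
  qed
  then obtain t1 where t1: "t1 \<ge> T0" "J t1 > 0" by blast
  have Jpos: "J t > 0" if "t \<ge> t1" for t using Jmono[of t1 t] t1 that by simp
  obtain t2 where t2: "t2 \<ge> t1" "g t2 > 0" using no_decr[of t1] t1 by (meson not_less)
  have gpos: "g t > 0" if t: "t \<ge> t2" for t
  proof (rule barrier_pos[of t2 t g h])
    show "0 < h x" if "t2 \<le> x" "g x = 0" for x using Jpos[of x] that t2 by (simp add: J_def)
  qed (use t t1 t2 D in auto)
  have ge: "t \<ge> T0" "t \<ge> t1" if "t \<ge> t2" for t using that t1 t2 by auto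
  define G where "G = (\<lambda>t. f t * h t / (g t)\<^sup>2)"
  define p where "p = (\<lambda>t. g t / (f t)\<^sup>2)"
  have fpos: "f t > 0" if "t \<ge> T0" for t using f1[OF that] by simp
  have hG: "h t = G t * (g t)\<^sup>2 / f t" if "t \<ge> t2" for t
    using fpos[of t] gpos[of t] ge[of t] that by (simp add: G_def)
  have dG: "(G has_real_derivative f t * (k - G t) + (g t / f t) * (G t - 2 * (G t)\<^sup>2)) (at t)" if t: "t \<ge> t2" for t
  proof -
    note t0 = ge(1)[OF t]
    have "(G has_real_derivative ((g t * h t + (k * (g t)\<^sup>2 - f t * h t) * f t) * (g t)\<^sup>2 - f t * h t * (2 * g t * h t)) / ((g t)\<^sup>2 * (g t)\<^sup>2)) (at t)"
      unfolding G_def using gpos[OF t]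
      by (auto intro!: derivative_eq_intros D[OF t0] simp: power2_eq_square algebra_simps)
    moreover have "((g t * h t + (k * (g t)\<^sup>2 - f t * h t) * f t) * (g t)\<^sup>2 - f t * h t * (2 * g t * h t)) / ((g t)\<^sup>2 * (g t)\<^sup>2)
       = f t * (k - G t) + (g t / f t) * (G t - 2 * (G t)\<^sup>2)"
      unfolding hG[OF t] using gpos[OF t] fpos[OF t0] by (simp add: divide_simps power2_eq_square) (simp add: algebra_simps)
    ultimately show ?thesis by (rule DERIV_cong)
  qed
  have Gbad: "G t - 2 * (G t)\<^sup>2 \<le> - 1" if "G t \<ge> 1" for t
  proof -
    have "G t - 2 * (G t)\<^sup>2 = - (G t * (2 * G t - 1))" by (simp add: power2_eq_square algebra_simps)
    moreover have "1 * 1 \<le> G t * (2 * G t - 1)" using that by (intro mult_mono) auto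
    ultimately show ?thesis by simp
  qed
  \<comment> \<open>For \<open>G >= 1\<close> the term \<open>(g / f) (G - 2 G^2)\<close> is at most
    \<open>- g / f\<close>, which cancels the derivative of \<open>ln f\<close>; so
    \<open>G + ln f\<close> would not increase and \<open>f\<close> would be bounded.\<close>
  have "\<exists>t\<ge>t2. G t < 1"
  proof (rule ccontr)
    assume "\<not> ?thesis"
    then have G1: "G t \<ge> 1" if "t \<ge> t2" for t using that by (auto simp: not_less)
    have dec: "G t + ln (f t) \<le> G t2 + ln (f t2)" if "t \<ge> t2" for t
    proof (rule DERIV_nonpos_imp_nonincreasing[of t2 t "\<lambda>t. G t + ln (f t)", OF that])
      fix x assume x: "t2 \<le> x"
      have "((\<lambda>t. G t + ln (f t)) has_real_derivative f x * (k - G x) + (g x / f x) * (G x - 2 * (G x)\<^sup>2) + g x / f x) (at x)"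
        using fpos[OF ge(1)[OF x]] by (auto intro!: derivative_eq_intros dG D x ge)
      moreover have "f x * (k - G x) \<le> 0" using G1[OF x] k fpos[OF ge(1)[OF x]] by (intro mult_nonneg_nonpos) auto
      moreover have "(g x / f x) * (G x - 2 * (G x)\<^sup>2) \<le> (g x / f x) * (- 1)"
        using gpos[OF x] fpos[OF ge(1)[OF x]] Gbad[OF G1[OF x]] by (intro mult_left_mono) auto
      ultimately show "\<exists>y. ((\<lambda>t. G t + ln (f t)) has_real_derivative y) (at x) \<and> y \<le> 0" by - (rule exI, rule conjI, assumption, linarith)
    qed
    show False
    proof (rule not_bounded[of t2 "exp (G t2 + ln (f t2))"])
      fix t assume t: "t2 \<le> t"
      have "ln (f t) \<le> G t2 + ln (f t2)" using dec[OF t] G1[OF t] by simp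
      then have "exp (ln (f t)) \<le> exp (G t2 + ln (f t2))" by (subst exp_le_cancel_iff)
      then show "f t \<le> exp (G t2 + ln (f t2))" using fpos[OF ge(1)[OF t]] by simp
    qed
  qed
  then obtain t3 where t3: "t3 \<ge> t2" "G t3 < 1" by blast
  have G1: "G t < 1" if t: "t \<ge> t3" for t
  proof -
    have "0 < 1 - G t"
    proof (rule barrier_pos[of t3 t "\<lambda>t. 1 - G t" "\<lambda>t. - (f t * (k - G t) + (g t / f t) * (G t - 2 * (G t)\<^sup>2))"])
      fix x assume x: "t3 \<le> x" "1 - G x = 0"
      then have x2: "x \<ge> t2" and Gx: "G x = 1" using t3 by auto
      have "f x * (k - 1) < 0" using fpos[OF ge(1)[OF x2]] k by (simp add: mult_pos_neg)
      moreover have "g x / f x > 0" using fpos[OF ge(1)[OF x2]] gpos[OF x2] by simp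
      ultimately show "0 < - (f x * (k - G x) + (g x / f x) * (G x - 2 * (G x)\<^sup>2))" by (simp add: Gx)
    next
      show "((\<lambda>t. 1 - G t) has_real_derivative - (f x * (k - G x) + (g x / f x) * (G x - 2 * (G x)\<^sup>2))) (at x)" if "t3 \<le> x" for x
        using DERIV_diff[OF DERIV_const[of 1] dG[of x]] that t3 by simp
    qed (use t t3 in auto)
    then show ?thesis by simp
  qed
  have ppos: "p t > 0" if "t \<ge> t2" for t using gpos[OF that] fpos[OF ge(1)[OF that]] by (simp add: p_def)
  have dp: "(p has_real_derivative (p t)\<^sup>2 * f t * (G t - 2)) (at t)" if t: "t \<ge> t2" for t
  proof -
    note t0 = ge(1)[OF t]
    have "(p has_real_derivative (h t * (f t)\<^sup>2 - g t * (2 * f t * g t)) / ((f t)\<^sup>2 * (f t)\<^sup>2)) (at t)"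
      unfolding p_def using fpos[OF t0]
      by (auto intro!: derivative_eq_intros D[OF t0] simp: power2_eq_square algebra_simps)
    moreover have "(h t * (f t)\<^sup>2 - g t * (2 * f t * g t)) / ((f t)\<^sup>2 * (f t)\<^sup>2) = (p t)\<^sup>2 * f t * (G t - 2)"
      unfolding hG[OF t] p_def using gpos[OF t] fpos[OF t0] by (simp add: divide_simps power2_eq_square) (simp add: algebra_simps)
    ultimately show ?thesis by (rule DERIV_cong)
  qed
  \<comment> \<open>The derivative of \<open>1 / p\<close> is \<open>f (2 - G)\<close>, at least
    \<open>1\<close> because \<open>f >= 1\<close> and \<open>G < 1\<close>. Hence \<open>p\<close>
    tends to \<open>0\<close>.\<close>
  have pinv: "1 / p t \<ge> 1 / p t3 + (t - t3)" if t: "t \<ge> t3" for t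
  proof -
    have "1 / p t - t \<ge> 1 / p t3 - t3"
    proof (rule DERIV_nonneg_imp_nondecreasing[of t3 t "\<lambda>t. 1 / p t - t", OF t])
      fix x assume x: "t3 \<le> x"
      then have x2: "x \<ge> t2" using t3 by simp
      have "((\<lambda>t. 1 / p t - t) has_real_derivative f x * (2 - G x) - 1) (at x)"
        using ppos[OF x2] by (auto intro!: derivative_eq_intros dp[OF x2] simp: field_simps power2_eq_square)
      moreover have "1 * 1 \<le> f x * (2 - G x)" using f1[OF ge(1)[OF x2]] G1[OF x] by (intro mult_mono) auto
      ultimately show "\<exists>y. ((\<lambda>t. 1 / p t - t) has_real_derivative y) (at x) \<and> 0 \<le> y" by - (rule exI, rule conjI, assumption, linarith)
    qed
    then show ?thesis by simp
  qed
  have p_small: "eventually (\<lambda>t. p t < e) at_top" if e: "e > 0" for e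
    using eventually_gt_at_top[of "t3 + 1 / e"]
  proof eventually_elim
    case (elim t)
    have "1 / e > 0" using e by simp
    then have t: "t \<ge> t3" using elim by linarith
    have "1 / p t3 > 0" using ppos[of t3] t3 by simp
    then have "1 / p t > 1 / e" using pinv[OF t] elim by linarith
    then show ?case using ppos[of t] t t3 e by (simp add: field_simps)
  qed
  obtain t4 where t4: "t4 \<ge> t3" "\<And>t. t \<ge> t4 \<Longrightarrow> p t < 1 / 16"
    using eventually_conj[OF p_small[of "1 / 16"] eventually_ge_at_top[of t3]]
    unfolding eventually_at_top_linorder by (metis divide_pos_pos nle_le order_trans zero_less_numeral zero_less_one)
  \<comment> \<open>\<open>J > 0\<close> gives only \<open>G p > -1\<close>, too weak for a lower
    bound on \<open>G\<close>. For small \<open>p\<close> the quantity \<open>X\<close> nearly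
    follows the logistic equation \<open>X' = f X (1 - X)\<close>, so it passes \<open>7 / 8\<close>
    and stays above it, that is \<open>G p > -1 / 8\<close>.\<close>
  define X where "X = (\<lambda>t. J t / (f t * g t))"
  have Xpos: "X t > 0" if "t \<ge> t2" for t using Jpos[OF ge(2)[OF that]] fpos[OF ge(1)[OF that]] gpos[OF that] by (simp add: X_def)
  have hX: "h t = f t * g t * (X t - 1)" if "t \<ge> t2" for t
    using fpos[OF ge(1)[OF that]] gpos[OF that] by (simp add: X_def J_def field_simps)
  have Xq: "X t - 1 = G t * p t" if "t \<ge> t2" for t
    using fpos[OF ge(1)[OF that]] gpos[OF that] by (simp add: X_def J_def G_def p_def field_simps power2_eq_square)
  have dX: "(X has_real_derivative f t * ((1 + k - X t) * p t + X t * (1 - X t))) (at t)" if t: "t \<ge> t2" for t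
  proof -
    note t0 = ge(1)[OF t]
    have "(X has_real_derivative ((1 + k) * (g t)\<^sup>2 * (f t * g t) - J t * (g t * g t + h t * f t)) / ((f t * g t) * (f t * g t))) (at t)"
      unfolding X_def using fpos[OF t0] gpos[OF t]
      by (auto intro!: derivative_eq_intros D[OF t0] J'[OF t0])
    moreover have "((1 + k) * (g t)\<^sup>2 * (f t * g t) - J t * (g t * g t + h t * f t)) / ((f t * g t) * (f t * g t))
      = f t * ((1 + k - X t) * p t + X t * (1 - X t))"
    proof -
      have Jt: "J t = X t * (f t * g t)" using fpos[OF t0] gpos[OF t] by (simp add: X_def)
      show ?thesis unfolding Jt unfolding hX[OF t] p_def using fpos[OF t0] gpos[OF t]
        by (simp add: divide_simps power2_eq_square) (simp add: algebra_simps)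
    qed
    ultimately show ?thesis by (rule DERIV_cong)
  qed
  have Xgrow: "f t * ((1 + k - X t) * p t + X t * (1 - X t)) \<ge> X t / 16" if t: "t \<ge> t4" and X: "X t \<le> 7 / 8" for t
  proof -
    have t2': "t \<ge> t2" using t t4 t3 by simp
    have "(1 + k - X t) * p t \<ge> (- X t) * p t" using ppos[OF t2'] k by (intro mult_right_mono) auto
    moreover have "X t * p t \<le> X t * (1 / 16)" using Xpos[OF t2'] t4(2)[OF t] by (intro mult_left_mono) auto
    moreover have "X t * (1 - X t) \<ge> X t * (1 / 8)" using Xpos[OF t2'] X by (intro mult_left_mono) auto
    ultimately have 1: "(1 + k - X t) * p t + X t * (1 - X t) \<ge> X t / 16" by simp
    have "1 * (X t / 16) \<le> f t * ((1 + k - X t) * p t + X t * (1 - X t))"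
      using 1 f1[OF ge(1)[OF t2']] Xpos[OF t2'] by (intro mult_mono) auto
    then show ?thesis by simp
  qed
  have "\<exists>t\<ge>t4. X t > 7 / 8"
  proof (rule ccontr)
    assume "\<not> ?thesis"
    then have X1: "X t \<le> 7 / 8" if "t \<ge> t4" for t using that by (auto simp: not_less)
    have inc: "ln (X t) - t / 16 \<ge> ln (X t4) - t4 / 16" if "t \<ge> t4" for t
    proof (rule DERIV_nonneg_imp_nondecreasing[of t4 t "\<lambda>t. ln (X t) - t / 16", OF that])
      fix x assume x: "t4 \<le> x"
      have x2: "x \<ge> t2" using x t4 t3 by simp
      have "((\<lambda>t. ln (X t) - t / 16) has_real_derivative f x * ((1 + k - X x) * p x + X x * (1 - X x)) / X x - 1 / 16) (at x)"
        using Xpos[OF x2] by (auto intro!: derivative_eq_intros dX[OF x2])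
      moreover have "f x * ((1 + k - X x) * p x + X x * (1 - X x)) / X x \<ge> 1 / 16"
        using Xgrow[OF x X1[OF x]] Xpos[OF x2] by (simp add: le_divide_eq)
      ultimately show "\<exists>y. ((\<lambda>t. ln (X t) - t / 16) has_real_derivative y) (at x) \<and> 0 \<le> y" by - (rule exI, rule conjI, assumption, linarith)
    qed
    define t where "t = t4 + 16 * \<bar>ln (X t4)\<bar> + 16"
    have "t \<ge> t4" by (simp add: t_def)
    moreover have "t / 16 = t4 / 16 + \<bar>ln (X t4)\<bar> + 1" by (simp add: t_def add_divide_distrib)
    ultimately have "ln (X t) \<ge> 1" using inc[of t] by linarith
    moreover have "ln (X t) < 0" using X1[of t] Xpos[of t] \<open>t \<ge> t4\<close> t4 t3 by simp
    ultimately show False by simp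
  qed
  then obtain t5 where t5: "t5 \<ge> t4" "X t5 > 7 / 8" by blast
  have X78: "X t > 7 / 8" if t: "t \<ge> t5" for t
  proof -
    have "0 < X t - 7 / 8"
    proof (rule barrier_pos[of t5 t "\<lambda>t. X t - 7 / 8" "\<lambda>t. f t * ((1 + k - X t) * p t + X t * (1 - X t))"])
      show "((\<lambda>t. X t - 7 / 8) has_real_derivative f x * ((1 + k - X x) * p x + X x * (1 - X x))) (at x)" if "t5 \<le> x" for x
        using DERIV_diff[OF dX[of x] DERIV_const[of "7 / 8"]] that t5 t4 t3 by simp
      show "0 < f x * ((1 + k - X x) * p x + X x * (1 - X x))" if "t5 \<le> x" "X x - 7 / 8 = 0" for x
        using Xgrow[of x] that t5 by simp
    qed (use t t5 in auto)
    then show ?thesis by simp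
  qed
  \<comment> \<open>At \<open>G = L\<close> the estimate \<open>G p >= -1 / 8\<close> gives
    \<open>G' / f >= k - 1 / 8 - 3 L / 4\<close>, which is positive for \<open>L <= -5\<close>; so
    \<open>G\<close> cannot fall through a level of this kind that lies below
    \<open>G t5\<close>.\<close>
  define L where "L = min (G t5) (- 4) - 1"
  have L5: "L \<le> - 5" by (simp add: L_def)
  have ge5: "t \<ge> t4" "t \<ge> t3" "t \<ge> t2" "t \<ge> T0" if "t \<ge> t5" for t using that t5 t4 t3 ge(1)[of t] by auto
  have GL: "G t > L" if t: "t \<ge> t5" for t
  proof -
    have "0 < G t - L"
    proof (rule barrier_pos[of t5 t "\<lambda>t. G t - L" "\<lambda>t. f t * (k - G t) + (g t / f t) * (G t - 2 * (G t)\<^sup>2)"])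
      show "((\<lambda>t. G t - L) has_real_derivative f x * (k - G x) + (g x / f x) * (G x - 2 * (G x)\<^sup>2)) (at x)" if "t5 \<le> x" for x
        using DERIV_diff[OF dG[of x] DERIV_const[of L]] ge5[OF that] by simp
      fix x assume x: "t5 \<le> x" "G x - L = 0"
      note x5 = ge5[OF x(1)]
      have q: "G x * p x \<ge> - 1 / 8" using X78[OF x(1)] Xq[OF x5(3)] by simp
      have "(g x / f x) * (G x - 2 * (G x)\<^sup>2) = f x * (G x * p x * (1 - 2 * G x))"
        using fpos[OF x5(4)] by (simp add: p_def field_simps power2_eq_square)
      then have "f x * (k - G x) + (g x / f x) * (G x - 2 * (G x)\<^sup>2) = f x * ((k - G x) + G x * p x * (1 - 2 * G x))"
        by (simp add: algebra_simps)
      moreover define Y where "Y = G x * p x * (1 - 2 * G x)"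
      have "(- 1 / 8) * (1 - 2 * G x) \<le> Y"
        unfolding Y_def using q x L5 by (intro mult_right_mono) auto
      then have "- 1 - 2 * (- G x) \<le> 8 * Y" by (simp add: algebra_simps)
      then have "(k - G x) + Y > 0" using x(2) L5 k by linarith
      then have "(k - G x) + G x * p x * (1 - 2 * G x) > 0" by (simp only: Y_def)
      ultimately show "0 < f x * (k - G x) + (g x / f x) * (G x - 2 * (G x)\<^sup>2)" using fpos[OF x5(4)] by simp
    qed (use t in \<open>auto simp: L_def\<close>)
    then show ?thesis by simp
  qed
  define C0 where "C0 = - L"
  have C0: "C0 \<ge> 5" "\<bar>G t\<bar> \<le> C0" if "t \<ge> t5" for t using GL[OF that] G1[OF ge5(2)[OF that]] L5 by (auto simp: C0_def)
  define C1 where "C1 = C0 + 2 * C0\<^sup>2"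
  have GC1: "\<bar>G t - 2 * (G t)\<^sup>2\<bar> \<le> C1" if "t \<ge> t5" for t
  proof -
    have "(G t)\<^sup>2 \<le> C0\<^sup>2" using C0[OF that] by (simp add: abs_le_square_iff[symmetric])
    then show ?thesis using C0[OF that] zero_le_power2[of "G t"] unfolding C1_def by linarith
  qed
  have C05: "C0 \<ge> 5" using C0 by blast
  obtain t6 where t6: "t6 \<ge> t5" "\<And>t. t \<ge> t6 \<Longrightarrow> p t < 1 / (2 * (2 + C0))"
  proof -
    have "1 / (2 * (2 + C0)) > 0" using C05 by simp
    from eventually_conj[OF p_small[OF this] eventually_ge_at_top[of t5]]
    show ?thesis unfolding eventually_at_top_linorder using that by (metis nle_le order_trans)
  qed
  have ge6: "t \<ge> t5" "t \<ge> t4" "t \<ge> t3" "t \<ge> t2" "t \<ge> T0" if "t \<ge> t6" for t using that t6 ge5[of t] by auto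
  \<comment> \<open>The equation for \<open>K\<close> has the damping factor
    \<open>1 - (2 - G) p\<close>, at least \<open>1 / 2\<close> after \<open>t6\<close> by the
    choice of that time, and a forcing bounded by \<open>C1\<close>. Hence every level above
    \<open>2 C1\<close> is a barrier for the absolute value of \<open>K\<close>.\<close>
  define K where "K = (\<lambda>t. (G t - k) / p t)"
  have dK: "(K has_real_derivative f t * (- K t * (1 - (2 - G t) * p t) + (G t - 2 * (G t)\<^sup>2))) (at t)" if t: "t \<ge> t6" for t
  proof -
    note t0 = ge6[OF t]
    have "(K has_real_derivative ((f t * (k - G t) + (g t / f t) * (G t - 2 * (G t)\<^sup>2)) * p t - (G t - k) * ((p t)\<^sup>2 * f t * (G t - 2))) / (p t * p t)) (at t)"
      unfolding K_def using ppos[OF t0(4)]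
      by (auto intro!: derivative_eq_intros dG[OF t0(4)] dp[OF t0(4)])
    moreover have "((f t * (k - G t) + (g t / f t) * (G t - 2 * (G t)\<^sup>2)) * p t - (G t - k) * ((p t)\<^sup>2 * f t * (G t - 2))) / (p t * p t)
       = f t * (- K t * (1 - (2 - G t) * p t) + (G t - 2 * (G t)\<^sup>2))"
    proof -
      have "g t / f t = p t * f t" using fpos[OF t0(5)] by (simp add: p_def power2_eq_square)
      then show ?thesis unfolding K_def using ppos[OF t0(4)]
        by (simp add: divide_simps power2_eq_square) (simp add: algebra_simps)
    qed
    ultimately show ?thesis by (rule DERIV_cong)
  qed
  define B where "B = max \<bar>K t6\<bar> (2 * C1) + 1"
  have B: "B > \<bar>K t6\<bar>" "B > 2 * C1" "C1 > 0" "B > 0" using C05 by (auto simp: B_def C1_def intro!: add_pos_nonneg)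
  have half: "1 - (2 - G t) * p t \<ge> 1 / 2" if t: "t \<ge> t6" for t
  proof -
    have "(2 - G t) * p t \<le> (2 + C0) * (1 / (2 * (2 + C0)))"
      using C0[OF ge6(1)[OF t]] t6(2)[OF t] ppos[OF ge6(4)[OF t]] C05 by (intro mult_mono) auto
    also have "\<dots> = 1 / 2" using C05 by simp
    finally show ?thesis by simp
  qed
  have KB: "\<bar>K t\<bar> \<le> B" if t: "t \<ge> t6" for t
  proof -
    have "0 < B - K t"
    proof (rule barrier_pos[of t6 t "\<lambda>t. B - K t" "\<lambda>t. - (f t * (- K t * (1 - (2 - G t) * p t) + (G t - 2 * (G t)\<^sup>2)))"])
      show "((\<lambda>t. B - K t) has_real_derivative - (f x * (- K x * (1 - (2 - G x) * p x) + (G x - 2 * (G x)\<^sup>2)))) (at x)" if "t6 \<le> x" for x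
        using DERIV_diff[OF DERIV_const[of B] dK[OF that]] by simp
      fix x assume x: "t6 \<le> x" "B - K x = 0"
      define Y Z where "Y = B * (1 - (2 - G x) * p x)" and "Z = G x - 2 * (G x)\<^sup>2"
      have "Y \<ge> B * (1 / 2)" unfolding Y_def using half[OF x(1)] B by (intro mult_left_mono) auto
      moreover have "\<bar>Z\<bar> \<le> C1" using GC1[OF ge6(1)[OF x(1)]] by (simp add: Z_def)
      ultimately have "- Y + Z < 0" using B by linarith
      then have "- K x * (1 - (2 - G x) * p x) + (G x - 2 * (G x)\<^sup>2) < 0" using x(2) by (simp add: Y_def Z_def)
      then show "0 < - (f x * (- K x * (1 - (2 - G x) * p x) + (G x - 2 * (G x)\<^sup>2)))"
        using fpos[OF ge6(5)[OF x(1)]] by (simp add: mult_pos_neg)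
    qed (use t B in auto)
    moreover have "0 < B + K t"
    proof (rule barrier_pos[of t6 t "\<lambda>t. B + K t" "\<lambda>t. f t * (- K t * (1 - (2 - G t) * p t) + (G t - 2 * (G t)\<^sup>2))"])
      show "((\<lambda>t. B + K t) has_real_derivative f x * (- K x * (1 - (2 - G x) * p x) + (G x - 2 * (G x)\<^sup>2))) (at x)" if "t6 \<le> x" for x
        using DERIV_add[OF DERIV_const[of B] dK[OF that]] by simp
      fix x assume x: "t6 \<le> x" "B + K x = 0"
      have Kx: "- K x = B" using x by simp
      define Y Z where "Y = B * (1 - (2 - G x) * p x)" and "Z = G x - 2 * (G x)\<^sup>2"
      have "Y \<ge> B * (1 / 2)" unfolding Y_def using half[OF x(1)] B by (intro mult_left_mono) auto
      moreover have "\<bar>Z\<bar> \<le> C1" using GC1[OF ge6(1)[OF x(1)]] by (simp add: Z_def)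
      ultimately have "Y + Z > 0" using B by linarith
      then have "- K x * (1 - (2 - G x) * p x) + (G x - 2 * (G x)\<^sup>2) > 0" unfolding Kx by (simp add: Y_def Z_def)
      then show "0 < f x * (- K x * (1 - (2 - G x) * p x) + (G x - 2 * (G x)\<^sup>2))"
        using fpos[OF ge6(5)[OF x(1)]] by simp
    qed (use t B in auto)
    ultimately show ?thesis by (simp add: abs_le_iff)
  qed
  \<comment> \<open>The logarithm of \<open>g f^(- k)\<close> has the derivative
    \<open>(G - k) g / f = K p^2 f\<close>. Since \<open>p' = - p^2 f (2 - G) <= - p^2 f\<close>,
    the bounded function \<open>- B p\<close> dominates it.\<close>
  define u where "u = (\<lambda>t. ln (g t) - k * ln (f t))"
  obtain l where l: "(u \<longlongrightarrow> l) at_top"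
  proof (rule dominated_derivative_convergent_at_top[of t6 u "\<lambda>t. K t * ((p t)\<^sup>2 * f t)" "\<lambda>t. - B * p t" "\<lambda>t. - B * ((p t)\<^sup>2 * f t * (G t - 2))" 0])
    fix t assume t: "t6 \<le> t"
    note t0 = ge6[OF t]
    have "(u has_real_derivative h t / g t - k * (g t / f t)) (at t)"
      unfolding u_def using fpos[OF t0(5)] gpos[OF t0(4)] by (auto intro!: derivative_eq_intros D[OF t0(5)])
    moreover have "h t / g t - k * (g t / f t) = K t * ((p t)\<^sup>2 * f t)"
    proof -
      have "h t / g t - k * (g t / f t) = (G t - k) * (g t / f t)"
        unfolding hG[OF t0(4)] using gpos[OF t0(4)] fpos[OF t0(5)] by (simp add: field_simps power2_eq_square)
      also have "\<dots> = K t * ((p t)\<^sup>2 * f t)"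
        unfolding K_def using gpos[OF t0(4)] fpos[OF t0(5)] by (simp add: p_def field_simps power2_eq_square)
      finally show ?thesis .
    qed
    ultimately show "(u has_real_derivative K t * ((p t)\<^sup>2 * f t)) (at t)" by (rule DERIV_cong)
    show "((\<lambda>t. - B * p t) has_real_derivative - B * ((p t)\<^sup>2 * f t * (G t - 2))) (at t)"
      by (rule DERIV_cmult[OF dp[OF t0(4)]])
    have pf: "(p t)\<^sup>2 * f t \<ge> 0" using fpos[OF t0(5)] by simp
    have "\<bar>K t * ((p t)\<^sup>2 * f t)\<bar> = \<bar>K t\<bar> * ((p t)\<^sup>2 * f t)" using fpos[OF t0(5)] by (simp add: abs_mult)
    also have "\<dots> \<le> B * ((p t)\<^sup>2 * f t)" using KB[OF t] pf by (intro mult_right_mono) auto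
    also have "\<dots> \<le> B * ((p t)\<^sup>2 * f t) * (2 - G t)"
      using mult_left_mono[of 1 "2 - G t" "B * ((p t)\<^sup>2 * f t)"] G1[OF t0(3)] pf B by simp
    also have "\<dots> = - B * ((p t)\<^sup>2 * f t * (G t - 2))" by (simp add: algebra_simps)
    finally show "\<bar>K t * ((p t)\<^sup>2 * f t)\<bar> \<le> - B * ((p t)\<^sup>2 * f t * (G t - 2))" .
    show "- B * p t \<le> 0" using B ppos[OF t0(4)] by simp
  qed
  have "((\<lambda>t. exp (u t)) \<longlongrightarrow> exp l) at_top" by (intro tendsto_intros l)
  then have Hlim: "((\<lambda>t. g t * f t powr (- k)) \<longlongrightarrow> exp l) at_top"
  proof (rule Lim_transform_eventually)
    show "eventually (\<lambda>t. exp (u t) = g t * f t powr (- k)) at_top"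
      using eventually_ge_at_top[of t6]
    proof eventually_elim
      case (elim t)
      have "f t > 0" "g t > 0" using fpos[OF ge6(5)] gpos[OF ge6(4)] elim by auto
      then show ?case by (simp add: u_def exp_diff powr_def exp_minus divide_inverse)
    qed
  qed
  show ?thesis
  proof (rule that[of "exp l" t6 "max B C0"])
    show "T < t6" using T0[OF ge6(5)[of t6]] by simp
    fix t assume t: "t6 \<le> t"
    note t0 = ge6[OF t]
    have fg: "f t > 0" "g t > 0" using fpos[OF t0(5)] gpos[OF t0(4)] by auto
    have "\<bar>h t\<bar> = \<bar>G t\<bar> * (g t)\<^sup>2 / f t" using hG[OF t0(4)] fg by (simp add: abs_mult abs_divide)
    also have "\<dots> \<le> max B C0 * (g t)\<^sup>2 / f t" using C0[OF t0(1)] fg by (intro divide_right_mono mult_right_mono) auto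
    finally have 1: "\<bar>h t\<bar> \<le> max B C0 * (g t)\<^sup>2 / f t" .
    have "k * (g t)\<^sup>2 - f t * h t = - (K t * ((g t) ^ 3 / (f t)\<^sup>2))"
      unfolding K_def p_def hG[OF t0(4)] using fg by (simp add: field_simps power2_eq_square power3_eq_cube)
    then have "\<bar>k * (g t)\<^sup>2 - f t * h t\<bar> = \<bar>K t\<bar> * ((g t) ^ 3 / (f t)\<^sup>2)" using fg by (simp add: abs_mult)
    also have "\<dots> \<le> max B C0 * ((g t) ^ 3 / (f t)\<^sup>2)" using KB[OF t] fg by (intro mult_right_mono) auto
    finally show "f t \<ge> 1 \<and> g t > 0 \<and> \<bar>h t\<bar> \<le> max B C0 * (g t)\<^sup>2 / f t \<and>
        \<bar>k * (g t)\<^sup>2 - f t * h t\<bar> \<le> max B C0 * (g t) ^ 3 / (f t)\<^sup>2" using 1 fg f1[OF t0(5)] by simp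
  qed (use Hlim in auto)
qed

text \<open>As \<open>1 / m - 1 = - k\<close>, the derivative of \<open>f powr (1 / m)\<close> is
  \<open>g * f powr (- k) / m\<close>, with limit \<open>H / m\<close>; so
  \<open>f powr (1 / m)\<close> is asymptotically linear. The growth of \<open>g\<close> follows by
  putting this into the limit \<open>H\<close> and using \<open>m k = m - 1\<close>.\<close>

lemma power_growth:
  assumes m: "m > 1 / 2" and k: "k = (m - 1) / m" and s: "ode_sol k {T<..} f g h"
    and f_top: "filterlim f at_top at_top" and H: "((\<lambda>t. g t * f t powr (- k)) \<longlongrightarrow> H) at_top" "H > 0"
  shows "((\<lambda>t. f t / t powr m) \<longlongrightarrow> (H / m) powr m) at_top"
    and "((\<lambda>t. g t / t powr (m - 1)) \<longlongrightarrow> m * (H / m) powr m) at_top"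
proof -
  have m0: "m > 0" using m by simp
  have fp: "eventually (\<lambda>t. f t > 0) at_top" using f_top by (simp add: filterlim_at_top_dense)
  have "((\<lambda>t. f t powr (1 / m) / t) \<longlongrightarrow> H / m) at_top"
  proof (rule lhospital_at_top_at_top[where f' = "\<lambda>t. (g t * f t powr (- k)) / m" and g' = "\<lambda>_. 1"])
    show "eventually (\<lambda>t. ((\<lambda>t. f t powr (1 / m)) has_real_derivative (g t * f t powr (- k)) / m) (at t)) at_top"
      using fp eventually_gt_at_top[of T]
    proof eventually_elim
      case (elim t)
      have e: "1 / m - 1 = - k" using m0 by (simp add: k field_simps)
      have "((\<lambda>t. f t powr (1 / m)) has_real_derivative (1 / m) * f t powr (1 / m - 1) * g t) (at t)"
        using DERIV_fun_powr[OF ode_solD(1)[OF s], of t "1 / m"] elim by simp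
      then show ?case unfolding e by (simp add: mult_ac)
    qed
    show "((\<lambda>t. (g t * f t powr (- k)) / m / 1) \<longlongrightarrow> H / m) at_top"
      using tendsto_divide[OF H(1) tendsto_const[of m]] m0 by simp
  qed (auto simp: filterlim_ident)
  from tendsto_powr[OF this tendsto_const[of m]]
  have "((\<lambda>t. (f t powr (1 / m) / t) powr m) \<longlongrightarrow> (H / m) powr m) at_top"
    using H(2) m0 by simp
  then show 1: "((\<lambda>t. f t / t powr m) \<longlongrightarrow> (H / m) powr m) at_top"
  proof (rule Lim_transform_eventually)
    show "eventually (\<lambda>t. (f t powr (1 / m) / t) powr m = f t / t powr m) at_top"
      using fp eventually_gt_at_top[of 0]
      by eventually_elim (use m0 in \<open>simp add: powr_divide powr_powr\<close>)
  qed
  have pos: "(H / m) powr m > 0" using H(2) m0 by simp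
  have "((\<lambda>t. (g t * f t powr (- k)) * (f t / t powr m) powr k) \<longlongrightarrow> H * ((H / m) powr m) powr k) at_top"
    using pos by (intro tendsto_intros H 1) auto
  moreover have "H * ((H / m) powr m) powr k = m * (H / m) powr m"
  proof -
    have "((H / m) powr m) powr k = (H / m) powr (m - 1)" using m0 by (simp add: powr_powr k)
    also have "\<dots> = (H / m) powr m / (H / m)" using H(2) m0 by (simp add: powr_diff)
    finally show ?thesis using H(2) m0 by simp
  qed
  ultimately have "((\<lambda>t. (g t * f t powr (- k)) * (f t / t powr m) powr k) \<longlongrightarrow> m * (H / m) powr m) at_top" by simp
  then show "((\<lambda>t. g t / t powr (m - 1)) \<longlongrightarrow> m * (H / m) powr m) at_top"
  proof (rule Lim_transform_eventually)
    show "eventually (\<lambda>t. (g t * f t powr (- k)) * (f t / t powr m) powr k = g t / t powr (m - 1)) at_top"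
      using fp eventually_gt_at_top[of 0]
    proof eventually_elim
      case (elim t)
      have "m * k = m - 1" using m0 by (simp add: k)
      then have "(f t / t powr m) powr k = f t powr k / t powr (m - 1)"
        using elim by (simp add: powr_divide powr_powr)
      then show ?case using elim by (simp add: powr_minus field_simps)
    qed
  qed
qed

section \<open>Comparison of two growing solutions\<close>

lemma power_asymp_compose:
  fixes u \<zeta> :: "real \<Rightarrow> real"
  assumes u: "((\<lambda>x. u x / x powr p) \<longlongrightarrow> c) at_top" and z: "((\<lambda>t. \<zeta> t / t) \<longlongrightarrow> 1) at_top"
  shows "((\<lambda>t. u (\<zeta> t) / t powr p) \<longlongrightarrow> c) at_top"
proof -
  have "filterlim (\<lambda>t. \<zeta> t / t * t) at_top at_top"
    by (rule filterlim_tendsto_pos_mult_at_top[OF z _ filterlim_ident]) simp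
  then have top: "filterlim \<zeta> at_top at_top"
    by (rule filterlim_at_top_mono) (rule eventually_mono[OF eventually_gt_at_top[of 0]], simp)
  have "((\<lambda>t. (\<zeta> t / t) powr p) \<longlongrightarrow> 1 powr p) at_top"
    by (rule tendsto_powr[OF z tendsto_const]) simp
  then have "((\<lambda>t. u (\<zeta> t) / \<zeta> t powr p * (\<zeta> t / t) powr p) \<longlongrightarrow> c * 1) at_top"
    by (intro tendsto_mult filterlim_compose[OF u top]) simp
  then have "((\<lambda>t. u (\<zeta> t) / \<zeta> t powr p * (\<zeta> t / t) powr p) \<longlongrightarrow> c) at_top" by simp
  then show ?thesis
  proof (rule Lim_transform_eventually)
    have "eventually (\<lambda>t. \<zeta> t > 0) at_top" using top by (simp add: filterlim_at_top_dense)
    then show "eventually (\<lambda>t. u (\<zeta> t) / \<zeta> t powr p * (\<zeta> t / t) powr p = u (\<zeta> t) / t powr p) at_top"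
      using eventually_gt_at_top[of 0] by eventually_elim (simp add: powr_divide)
  qed
qed

text \<open>A linear system with a slow and a fast mode: the cone \<open>\<bar>z\<bar> \<le> \<bar>\<omega>\<bar> / t\<^sup>2\<close> is forward
  invariant, and in it \<open>\<omega>\<close> converges to a nonzero limit. So if \<open>\<omega>\<close> tends to \<open>0\<close> without vanishing,
  the solution stays out of the cone and is the fast mode.\<close>

lemma fast_slow_dichotomy:
  fixes \<omega> z A B Y Y' :: "real \<Rightarrow> real"
  assumes d\<omega>: "\<And>t. t \<ge> T \<Longrightarrow> (\<omega> has_real_derivative z t) (at t)"
    and dz: "\<And>t. t \<ge> T \<Longrightarrow> (z has_real_derivative - A t * z t - B t * \<omega> t) (at t)"
    and dY: "\<And>t. t \<ge> T \<Longrightarrow> (Y has_real_derivative Y' t) (at t)"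
    and B: "\<And>t. t \<ge> T \<Longrightarrow> \<bar>B t\<bar> \<le> C / t\<^sup>2"
    and A: "((\<lambda>t. A t / Y t) \<longlongrightarrow> 1) at_top" and Y: "filterlim Y at_top at_top"
    and Y': "((\<lambda>t. Y' t / (Y t)\<^sup>2) \<longlongrightarrow> 0) at_top" and \<omega>0: "(\<omega> \<longlongrightarrow> 0) at_top"
  obtains (zero) a where "\<And>t. t \<ge> a \<Longrightarrow> \<omega> t = 0"
    | (fast) a e where "e = 1 \<or> e = - 1" "\<And>t. t \<ge> a \<Longrightarrow> e * z t > 0" "(z \<longlongrightarrow> 0) at_top"
      "((\<lambda>t. \<omega> t * Y t / z t) \<longlongrightarrow> - 1) at_top"
proof -
  have Atop: "filterlim A at_top at_top"
  proof -
    have AY: "filterlim (\<lambda>t. A t / Y t * Y t) at_top at_top"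
      by (rule filterlim_tendsto_pos_mult_at_top[OF A _ Y]) simp
    have Y0: "eventually (\<lambda>t. Y t > 0) at_top" using Y by (simp add: filterlim_at_top_dense)
    show ?thesis by (rule filterlim_at_top_mono[OF AY eventually_mono[OF Y0]]) simp
  qed
  \<comment> \<open>On the boundary of the cone, with \<open>w\<close> the common value of both
    sides, the terms of \<open>N'\<close> other than \<open>2 A w^2\<close> add up to at most
    \<open>(2 + 4 + 2 \<bar>C\<bar>) w^2\<close> for \<open>t >= 1\<close>; the threshold
    \<open>\<bar>C\<bar> + 4\<close> beats this.\<close>
  have "eventually (\<lambda>t. A t > \<bar>C\<bar> + 4 \<and> Y t > 0 \<and> t \<ge> T \<and> t \<ge> 1) at_top"
    using Atop Y eventually_ge_at_top[of T] eventually_ge_at_top[of 1]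
    by (simp add: filterlim_at_top_dense eventually_conj_iff)
  then obtain T1 where T1: "\<And>t. t \<ge> T1 \<Longrightarrow> A t > \<bar>C\<bar> + 4 \<and> Y t > 0 \<and> t \<ge> T \<and> t \<ge> 1"
    unfolding eventually_at_top_linorder by auto
  have BC: "\<bar>B t\<bar> \<le> \<bar>C\<bar> / t\<^sup>2" if "t \<ge> T1" for t
    using order_trans[OF B[of t] divide_right_mono[of C "\<bar>C\<bar>" "t\<^sup>2"]] T1[OF that] by simp
  define N where "N = (\<lambda>t. (\<omega> t)\<^sup>2 / t ^ 4 - (z t)\<^sup>2)"
  define N' where "N' = (\<lambda>t. 2 * \<omega> t * z t / t ^ 4 - 4 * (\<omega> t)\<^sup>2 / t ^ 5 + 2 * A t * (z t)\<^sup>2 + 2 * B t * \<omega> t * z t)"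
  have dN: "(N has_real_derivative N' t) (at t)" if "t \<ge> T1" for t
  proof -
    have t: "t > 0" "t \<ge> T" using T1[OF that] by auto
    have a: "((\<lambda>t. (\<omega> t)\<^sup>2) has_real_derivative 2 * \<omega> t * z t) (at t)"
      by (auto intro!: derivative_eq_intros d\<omega>[OF t(2)])
    have b: "((\<lambda>t. (z t)\<^sup>2) has_real_derivative 2 * z t * (- A t * z t - B t * \<omega> t)) (at t)"
      by (auto intro!: derivative_eq_intros dz[OF t(2)])
    have c: "((\<lambda>t. t ^ 4) has_real_derivative 4 * t ^ 3) (at t)"
      by (auto intro!: derivative_eq_intros)
    have "(2 * \<omega> t * z t * t ^ 4 - (\<omega> t)\<^sup>2 * (4 * t ^ 3)) / (t ^ 4 * t ^ 4)
       = 2 * \<omega> t * z t / t ^ 4 - 4 * (\<omega> t)\<^sup>2 / t ^ 5"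
      using t by (simp add: diff_divide_distrib eval_nat_numeral)
    then show ?thesis unfolding N_def N'_def using t
      by (intro DERIV_cong[OF DERIV_diff[OF DERIV_divide[OF a c] b]]) (auto simp: algebra_simps power2_eq_square)
  qed
  have cone: "\<bar>z t\<bar> \<le> \<bar>\<omega> t\<bar> / t\<^sup>2" if "N t \<ge> 0" "t \<ge> T1" for t
  proof -
    have "(z t)\<^sup>2 \<le> (\<omega> t / t\<^sup>2)\<^sup>2" using that(1) by (simp add: N_def power_divide)
    then have "\<bar>z t\<bar> \<le> \<bar>\<omega> t / t\<^sup>2\<bar>" by (rule abs_le_square_iff[THEN iffD2])
    then show ?thesis by simp
  qed
  have N'pos: "N' t > 0" if t: "t \<ge> T1" and N: "N t = 0" and \<omega>: "\<omega> t \<noteq> 0" for t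
  proof -
    have t1: "t \<ge> 1" "A t > \<bar>C\<bar> + 4" using T1[OF t] by auto
    define w where "w = \<bar>\<omega> t\<bar> / t\<^sup>2"
    have w: "w > 0" using \<omega> t1 by (simp add: w_def)
    have zz: "(z t)\<^sup>2 = w\<^sup>2" using N t1 by (simp add: N_def w_def power_divide)
    then have az: "\<bar>z t\<bar> = w" using w by (metis abs_of_pos power2_eq_iff abs_minus_cancel)
    have a\<omega>: "\<bar>\<omega> t\<bar> = w * t\<^sup>2" using t1 by (simp add: w_def)
    have oz: "\<bar>\<omega> t * z t\<bar> = w\<^sup>2 * t\<^sup>2" unfolding abs_mult az a\<omega> by (simp add: power2_eq_square)
    have "\<bar>2 * \<omega> t * z t / t ^ 4\<bar> = 2 * \<bar>\<omega> t * z t\<bar> / t ^ 4" by (simp add: abs_mult abs_divide)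
    also have "\<dots> = 2 * w\<^sup>2 / t\<^sup>2" unfolding oz using t1 by (simp add: field_simps eval_nat_numeral)
    also have "\<dots> \<le> 2 * w\<^sup>2 / 1" using t1 by (intro divide_left_mono) auto
    finally have 1: "\<bar>2 * \<omega> t * z t / t ^ 4\<bar> \<le> 2 * w\<^sup>2" by simp
    have "(\<omega> t)\<^sup>2 = w\<^sup>2 * t ^ 4"
      using a\<omega> by (metis abs_le_square_iff power2_abs power_mult_distrib power_mult numeral_Bit0 mult_2)
    then have "4 * (\<omega> t)\<^sup>2 / t ^ 5 = 4 * w\<^sup>2 / t" using t1 by (simp add: field_simps eval_nat_numeral)
    also have "\<dots> \<le> 4 * w\<^sup>2 / 1" using t1 by (intro divide_left_mono) auto
    finally have 2: "4 * (\<omega> t)\<^sup>2 / t ^ 5 \<le> 4 * w\<^sup>2" by simp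
    have "\<bar>2 * B t * \<omega> t * z t\<bar> = 2 * (\<bar>B t\<bar> * \<bar>\<omega> t * z t\<bar>)" by (simp add: abs_mult)
    also have "\<dots> \<le> 2 * (\<bar>C\<bar> / t\<^sup>2 * (w\<^sup>2 * t\<^sup>2))"
      unfolding oz using BC[OF t] by (intro mult_left_mono mult_right_mono) auto
    also have "\<dots> = 2 * (\<bar>C\<bar> * w\<^sup>2)" using t1 by simp
    finally have 3: "\<bar>2 * B t * \<omega> t * z t\<bar> \<le> 2 * (\<bar>C\<bar> * w\<^sup>2)" .
    have "(\<bar>C\<bar> + 4) * w\<^sup>2 < A t * w\<^sup>2" using t1 w by (intro mult_strict_right_mono) auto
    then have 4: "2 * A t * (z t)\<^sup>2 > 2 * (\<bar>C\<bar> * w\<^sup>2) + 8 * w\<^sup>2" unfolding zz by (simp add: algebra_simps)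
    have "w\<^sup>2 > 0" using w by simp
    then show ?thesis unfolding N'_def using 1 2 3 4 by linarith
  qed
  \<comment> \<open>In the cone the derivative of \<open>\<omega>^2\<close> is at least
    \<open>- 2 \<omega>^2 / t^2\<close>, which the factor \<open>exp (- 2 / t)\<close> compensates.
    This factor stays between positive constants, so \<open>\<omega>\<close> is bounded away from
    \<open>0\<close> unless it vanishes at the start.\<close>
  have mono: "(\<omega> a)\<^sup>2 * exp (- 2 / a) \<le> (\<omega> x)\<^sup>2 * exp (- 2 / x)"
    if a: "a \<ge> T1" "a \<le> x" and N: "\<And>u. a \<le> u \<Longrightarrow> u \<le> x \<Longrightarrow> N u \<ge> 0" for a x
  proof (rule DERIV_nonneg_imp_nondecreasing[of a x "\<lambda>t. (\<omega> t)\<^sup>2 * exp (- 2 / t)", OF a(2)])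
    fix t assume t: "a \<le> t" "t \<le> x"
    have tT: "t > 0" "t \<ge> T" "t \<ge> T1" using T1[of t] t a by auto
    have "((\<lambda>t. (\<omega> t)\<^sup>2 * exp (- 2 / t)) has_real_derivative (2 * \<omega> t * z t + 2 * (\<omega> t)\<^sup>2 / t\<^sup>2) * exp (- 2 / t)) (at t)"
    proof -
      have a: "((\<lambda>t. (\<omega> t)\<^sup>2) has_real_derivative 2 * \<omega> t * z t) (at t)"
        by (auto intro!: derivative_eq_intros d\<omega>[OF tT(2)])
      have "((\<lambda>t. - 2 / t) has_real_derivative 2 / t\<^sup>2) (at t)"
        using tT by (auto intro!: derivative_eq_intros simp: power2_eq_square)
      from DERIV_mult[OF a DERIV_fun_exp[OF this]] show ?thesis
        by (rule DERIV_cong) (simp add: algebra_simps)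
    qed
    moreover have "2 * \<omega> t * z t + 2 * (\<omega> t)\<^sup>2 / t\<^sup>2 \<ge> 0"
    proof -
      have "\<bar>\<omega> t * z t\<bar> \<le> \<bar>\<omega> t\<bar> * (\<bar>\<omega> t\<bar> / t\<^sup>2)"
        unfolding abs_mult using cone[OF N[OF t] tT(3)] by (intro mult_left_mono) auto
      also have "\<dots> = (\<omega> t)\<^sup>2 / t\<^sup>2" by (simp add: power2_eq_square)
      finally show ?thesis by (simp add: abs_le_iff)
    qed
    ultimately show "\<exists>y. ((\<lambda>t. (\<omega> t)\<^sup>2 * exp (- 2 / t)) has_real_derivative y) (at t) \<and> 0 \<le> y"
      by - (rule exI, rule conjI, assumption, rule mult_nonneg_nonneg, assumption, simp)
  qed
  show ?thesis
  proof (cases "\<exists>t\<ge>T1. N t \<ge> 0")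
    case True
    then obtain t0 where t0: "t0 \<ge> T1" "N t0 \<ge> 0" by blast
    show ?thesis
    proof (cases "\<omega> t0 = 0")
      case True
      then have z0: "z t0 = 0" using cone[OF t0(2,1)] by simp
      have "\<omega> t = 0" if t: "t \<ge> t0" for t
      proof -
        have "(\<omega> t)\<^sup>2 + (z t)\<^sup>2 = 0"
        proof (rule gronwall_zero[of t0 t "\<lambda>t. (\<omega> t)\<^sup>2 + (z t)\<^sup>2" "\<lambda>t. 2 * \<omega> t * z t + 2 * z t * (- A t * z t - B t * \<omega> t)" "1 + \<bar>C\<bar>"])
          fix x assume x: "t0 \<le> x"
          have xT: "x \<ge> T1" "x \<ge> T" "x \<ge> 1" "A x > 0" using T1[of x] x t0 by auto
          show "((\<lambda>t. (\<omega> t)\<^sup>2 + (z t)\<^sup>2) has_real_derivative 2 * \<omega> x * z x + 2 * z x * (- A x * z x - B x * \<omega> x)) (at x)"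
            by (auto intro!: derivative_eq_intros d\<omega>[OF xT(2)] dz[OF xT(2)])
          have sq: "2 * \<bar>\<omega> x * z x\<bar> \<le> (\<omega> x)\<^sup>2 + (z x)\<^sup>2"
            using sum_squares_bound[of "\<bar>\<omega> x\<bar>" "\<bar>z x\<bar>"] by (simp add: abs_mult)
          have "\<bar>C\<bar> / x\<^sup>2 \<le> \<bar>C\<bar> / 1" using xT by (intro divide_left_mono) auto
          then have "\<bar>B x\<bar> \<le> \<bar>C\<bar>" using BC[OF xT(1)] by simp
          then have "\<bar>B x\<bar> * (2 * \<bar>\<omega> x * z x\<bar>) \<le> \<bar>C\<bar> * ((\<omega> x)\<^sup>2 + (z x)\<^sup>2)" using sq by (intro mult_mono) auto
          have "- (B x * (2 * (\<omega> x * z x))) \<le> \<bar>B x\<bar> * (2 * \<bar>\<omega> x * z x\<bar>)"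
            using abs_ge_minus_self[of "B x * (2 * (\<omega> x * z x))"] by (simp add: abs_mult)
          have "A x * (z x)\<^sup>2 \<ge> 0" using xT by simp
          show "2 * \<omega> x * z x + 2 * z x * (- A x * z x - B x * \<omega> x) \<le> (1 + \<bar>C\<bar>) * ((\<omega> x)\<^sup>2 + (z x)\<^sup>2)"
          proof -
            have "2 * \<omega> x * z x + 2 * z x * (- A x * z x - B x * \<omega> x)
                = 2 * (\<omega> x * z x) - 2 * (A x * (z x)\<^sup>2) - B x * (2 * (\<omega> x * z x))"
              by (simp add: algebra_simps power2_eq_square)
            moreover have "\<omega> x * z x \<le> \<bar>\<omega> x * z x\<bar>" by simp
            moreover have "(1 + \<bar>C\<bar>) * ((\<omega> x)\<^sup>2 + (z x)\<^sup>2) = ((\<omega> x)\<^sup>2 + (z x)\<^sup>2) + \<bar>C\<bar> * ((\<omega> x)\<^sup>2 + (z x)\<^sup>2)"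
              by (simp add: distrib_right)
            ultimately show ?thesis using \<open>\<bar>B x\<bar> * (2 * \<bar>\<omega> x * z x\<bar>) \<le> _\<close> \<open>- (B x * _) \<le> _\<close> \<open>A x * (z x)\<^sup>2 \<ge> 0\<close> sq
              by linarith
          qed
        qed (use t True z0 in auto)
        then show ?thesis by (simp add: add_nonneg_eq_0_iff)
      qed
      then show ?thesis by (rule zero)
    next
      case False
      have Nn: "N t \<ge> 0" if t: "t \<ge> t0" for t
      proof (rule barrier_nonneg[of t0 t N N'])
        fix x assume x: "t0 \<le> x" "x \<le> t" and past: "\<And>u. t0 \<le> u \<Longrightarrow> u \<le> x \<Longrightarrow> N u \<ge> 0" and Nx: "N x = 0"
        have "0 < (\<omega> t0)\<^sup>2 * exp (- 2 / t0)" using False by simp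
        also have "\<dots> \<le> (\<omega> x)\<^sup>2 * exp (- 2 / x)" by (rule mono) (use t0 x past in auto)
        finally have "\<omega> x \<noteq> 0" by auto
        then show "N' x > 0" using N'pos[of x] x t0 Nx by simp
      qed (use t t0 dN in auto)
      define c where "c = (\<omega> t0)\<^sup>2 * exp (- 2 / t0)"
      have c: "c > 0" using False by (simp add: c_def)
      have "c \<le> (\<omega> t)\<^sup>2" if t: "t \<ge> t0" for t
      proof -
        have "c \<le> (\<omega> t)\<^sup>2 * exp (- 2 / t)" unfolding c_def by (rule mono) (use t0 t Nn in auto)
        also have "\<dots> \<le> (\<omega> t)\<^sup>2 * 1" using T1[of t] t t0 by (intro mult_left_mono) auto
        finally show ?thesis by simp
      qed
      then have "c \<le> 0\<^sup>2"
        by (intro tendsto_lowerbound[OF tendsto_power[OF \<omega>0, of 2]] eventually_mono[OF eventually_ge_at_top[of t0]]) auto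
      then show ?thesis using c by simp
    qed
  next
    case False
    have Nneg: "N t < 0" if "t \<ge> T1" for t using False that by (meson not_le)
    have out: "z t \<noteq> 0" "\<bar>\<omega> t\<bar> \<le> t\<^sup>2 * \<bar>z t\<bar>" if t: "t \<ge> T1" for t
    proof -
      have t1: "t \<ge> 1" using T1[OF t] by simp
      have "(\<omega> t / t\<^sup>2)\<^sup>2 < (z t)\<^sup>2" using Nneg[OF t] by (simp add: N_def power_divide)
      then have "\<bar>\<omega> t / t\<^sup>2\<bar> < \<bar>z t\<bar>" by (metis abs_le_square_iff not_le)
      then show "z t \<noteq> 0" "\<bar>\<omega> t\<bar> \<le> t\<^sup>2 * \<bar>z t\<bar>" using t1 by (auto simp: field_simps)
    qed
    define e where "e = sgn (z T1)"
    have e: "e = 1 \<or> e = - 1" using out(1)[of T1] by (auto simp: e_def sgn_if)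
    have ee: "e * e = 1" using e by auto
    define y where "y = (\<lambda>t. e * z t)"
    define v where "v = (\<lambda>t. e * \<omega> t)"
    have ypos: "y t > 0" if t: "t \<ge> T1" for t
    proof (rule barrier_pos[of T1 t y "\<lambda>t. e * (- A t * z t - B t * \<omega> t)"])
      show "(y has_real_derivative e * (- A x * z x - B x * \<omega> x)) (at x)" if "T1 \<le> x" for x
        unfolding y_def using T1[of x] that by (intro DERIV_cmult dz) auto
      show "0 < y T1" using out(1)[of T1] by (auto simp: y_def e_def sgn_if)
      show "0 < e * (- A x * z x - B x * \<omega> x)" if "T1 \<le> x" "y x = 0" for x
        using out(1)[of x] that e by (auto simp: y_def)
    qed (use t in auto)
    \<comment> \<open>Outside the cone the slow variable acts on the fast one only through this
      bounded factor: \<open>z' = z (- A - \<rho>)\<close>, so \<open>z\<close> keeps its sign and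
      decays at least like \<open>exp (- t)\<close>.\<close>
    define \<rho> where "\<rho> = (\<lambda>t. B t * (\<omega> t / z t))"
    have \<rho>: "\<bar>\<rho> t\<bar> \<le> \<bar>C\<bar>" if t: "t \<ge> T1" for t
    proof -
      have t1: "t \<ge> 1" using T1[OF t] by simp
      have "\<bar>\<rho> t\<bar> = \<bar>B t\<bar> * (\<bar>\<omega> t\<bar> / \<bar>z t\<bar>)" by (simp add: \<rho>_def abs_mult)
      also have "\<dots> \<le> \<bar>C\<bar> / t\<^sup>2 * t\<^sup>2"
        using BC[OF t] out[OF t] by (intro mult_mono) (auto simp: field_simps)
      also have "\<dots> = \<bar>C\<bar>" using t1 by simp
      finally show ?thesis .
    qed
    have dy: "(y has_real_derivative y t * (- A t - \<rho> t)) (at t)" if t: "t \<ge> T1" for t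
    proof -
      have eq: "e * (- A t * z t - B t * \<omega> t) = y t * (- A t - \<rho> t)"
        using out(1)[OF t] by (simp add: y_def \<rho>_def field_simps)
      have "(y has_real_derivative e * (- A t * z t - B t * \<omega> t)) (at t)"
        unfolding y_def using T1[OF t] by (intro DERIV_cmult dz) auto
      then show ?thesis by (rule DERIV_cong[OF _ eq])
    qed
    have dv: "(v has_real_derivative y t) (at t)" if t: "t \<ge> T1" for t
      unfolding v_def y_def using T1[OF t] by (intro DERIV_cmult d\<omega>) auto
    have yexp: "y t * exp t \<le> y T1 * exp T1" if t: "t \<ge> T1" for t
    proof (rule DERIV_nonpos_imp_nonincreasing[of T1 t "\<lambda>t. y t * exp t", OF t])
      fix x assume x: "T1 \<le> x"
      have "((\<lambda>t. y t * exp t) has_real_derivative y x * exp x * (1 - A x - \<rho> x)) (at x)"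
        by (rule DERIV_cong[OF DERIV_mult[OF dy[OF x] DERIV_exp]]) (simp add: algebra_simps)
      moreover have "y x * exp x * (1 - A x - \<rho> x) \<le> 0"
        using ypos[OF x] \<rho>[OF x] T1[OF x] by (intro mult_nonneg_nonpos) auto
      ultimately show "\<exists>u. ((\<lambda>t. y t * exp t) has_real_derivative u) (at x) \<and> u \<le> 0" by blast
    qed
    have y0: "(y \<longlongrightarrow> 0) at_top"
    proof (rule tendsto_sandwich[of "\<lambda>_. 0" y at_top "\<lambda>t. y T1 * exp T1 * exp (- t)"])
      show "eventually (\<lambda>t. 0 \<le> y t) at_top"
        using eventually_ge_at_top[of T1] by eventually_elim (use ypos in \<open>auto intro: less_imp_le\<close>)
      show "eventually (\<lambda>t. y t \<le> y T1 * exp T1 * exp (- t)) at_top"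
        using eventually_ge_at_top[of T1] by eventually_elim (use yexp in \<open>auto simp: exp_minus field_simps\<close>)
      have "((\<lambda>t. y T1 * exp T1 * exp (- t)) \<longlongrightarrow> y T1 * exp T1 * 0) at_top"
        by (intro tendsto_mult tendsto_const) real_asymp
      then show "((\<lambda>t. y T1 * exp T1 * exp (- t)) \<longlongrightarrow> 0) at_top" by simp
    qed simp
    have Yinv: "((\<lambda>t. inverse (Y t)) \<longlongrightarrow> 0) at_top" by (rule tendsto_inverse_0_at_top[OF Y])
    \<comment> \<open>The derivative of \<open>y / Y\<close> is \<open>y \<mu>\<close>, while that
      of \<open>v\<close> is \<open>y\<close>; as \<open>\<mu>\<close> tends to \<open>-1\<close>,
      the rule for \<open>0 / 0\<close> compares \<open>v\<close> with \<open>y / Y\<close>.\<close>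
    define \<mu> where "\<mu> = (\<lambda>t. - (A t / Y t) - \<rho> t * inverse (Y t) - Y' t / (Y t)\<^sup>2)"
    have "((\<lambda>t. \<rho> t * inverse (Y t)) \<longlongrightarrow> 0) at_top"
    proof (rule tendsto_0_le[OF Yinv, of _ "\<bar>C\<bar>"])
      show "eventually (\<lambda>t. norm (\<rho> t * inverse (Y t)) \<le> norm (inverse (Y t)) * \<bar>C\<bar>) at_top"
        using eventually_ge_at_top[of T1]
      proof eventually_elim
        case (elim t)
        then show ?case using mult_right_mono[OF \<rho>[OF elim], of "\<bar>inverse (Y t)\<bar>"] by (simp only: real_norm_def abs_mult abs_ge_zero mult.commute[of "\<bar>inverse (Y t)\<bar>"])
      qed
    qed
    then have "(\<mu> \<longlongrightarrow> - 1 - 0 - 0) at_top" unfolding \<mu>_def by (intro tendsto_intros A Y')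
    then have \<mu>: "(\<mu> \<longlongrightarrow> - 1) at_top" by simp
    have "((\<lambda>t. v t / (y t * inverse (Y t))) \<longlongrightarrow> - 1) at_top"
    proof (rule lhopital_zero_at_top[where f' = y and g' = "\<lambda>t. y t * \<mu> t"])
      show "eventually (\<lambda>t. (v has_real_derivative y t) (at t)) at_top"
        using eventually_ge_at_top[of T1] by eventually_elim (rule dv)
      show "eventually (\<lambda>t. ((\<lambda>t. y t * inverse (Y t)) has_real_derivative y t * \<mu> t) (at t)) at_top"
        using eventually_ge_at_top[of T1]
      proof eventually_elim
        case (elim t)
        have Yt: "Y t > 0" "t \<ge> T" using T1[OF elim] by auto
        have "((\<lambda>t. inverse (Y t)) has_real_derivative - (Y' t / (Y t)\<^sup>2)) (at t)"
          using DERIV_inverse_fun[OF dY[OF Yt(2)]] Yt(1) by (simp add: field_simps power2_eq_square)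
        from DERIV_mult[OF dy[OF elim] this] show ?case
          by (rule DERIV_cong) (use Yt in \<open>simp add: \<mu>_def field_simps power2_eq_square\<close>)
      qed
      have "eventually (\<lambda>t. \<mu> t < 0) at_top" using \<mu> by (rule order_tendstoD) simp
      then show "eventually (\<lambda>t. y t * \<mu> t < 0) at_top"
        using eventually_ge_at_top[of T1] by eventually_elim (use ypos in \<open>auto intro: mult_pos_neg\<close>)
      show "(v \<longlongrightarrow> 0) at_top" unfolding v_def using tendsto_mult[OF tendsto_const[of e] \<omega>0] by simp
      show "((\<lambda>t. y t * inverse (Y t)) \<longlongrightarrow> 0) at_top" using tendsto_mult[OF y0 Yinv] by simp
      have "((\<lambda>t. inverse (\<mu> t)) \<longlongrightarrow> inverse (- 1)) at_top" by (intro tendsto_inverse \<mu>) simp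
      then have i: "((\<lambda>t. inverse (\<mu> t)) \<longlongrightarrow> - 1) at_top" by simp
      show "((\<lambda>t. y t / (y t * \<mu> t)) \<longlongrightarrow> - 1) at_top"
        by (rule Lim_transform_eventually[OF i])
           (auto intro!: eventually_mono[OF eventually_ge_at_top[of T1]] simp: divide_inverse dest: ypos)
    qed
    moreover have "(\<lambda>t. v t / (y t * inverse (Y t))) = (\<lambda>t. \<omega> t * Y t / z t)"
      using e by (auto simp: v_def y_def divide_inverse)
    moreover have "(z \<longlongrightarrow> 0) at_top"
      using tendsto_mult[OF tendsto_const[of e] y0] ee by (simp add: y_def mult.assoc[symmetric])
    ultimately show ?thesis using fast[of e T1] e ypos by (simp add: y_def)
  qed
qed

lemma increasing_inverse:
  fixes f g :: "real \<Rightarrow> real"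
  assumes d: "\<And>t. t \<ge> a \<Longrightarrow> (f has_real_derivative g t) (at t)" and g: "\<And>t. t \<ge> a \<Longrightarrow> g t > 0"
    and top: "filterlim f at_top at_top"
  obtains i where "\<And>y. y > f a \<Longrightarrow> i y > a \<and> f (i y) = y \<and> (i has_real_derivative 1 / g (i y)) (at y)"
    "filterlim i at_top at_top"
proof -
  have mono: "f x < f y" if "a \<le> x" "x < y" for x y
  proof (rule DERIV_pos_imp_increasing[OF that(2)])
    fix u assume "x \<le> u"
    then show "\<exists>z. (f has_real_derivative z) (at u) \<and> z > 0" using d[of u] g[of u] that by auto
  qed
  have ex: "\<exists>x>a. f x = y" if y: "y > f a" for y
  proof -
    have "eventually (\<lambda>t. f t > y \<and> t > a) at_top"
      using top eventually_gt_at_top[of a] by (simp add: filterlim_at_top_dense eventually_conj_iff)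
    then obtain t where t: "f t > y" "t > a" using eventually_happens by fastforce
    have "\<exists>x\<ge>a. x \<le> t \<and> f x = y"
      by (rule IVT) (use t y d in \<open>auto intro: DERIV_isCont\<close>)
    then obtain x where "x \<ge> a" "f x = y" by blast
    then show ?thesis using y by (intro exI[of _ x]) (cases "x = a"; auto)
  qed
  define i where "i = (\<lambda>y. SOME x. x > a \<and> f x = y)"
  have i: "i y > a" "f (i y) = y" if "y > f a" for y
    using someI_ex[of "\<lambda>x. x > a \<and> f x = y"] ex[OF that] unfolding i_def by blast+
  have inj: "x = y" if "f x = f y" "x > a" "y > a" for x y
    using mono[of x y] mono[of y x] that by (cases x y rule: linorder_cases) auto
  have if_eq: "i (f x) = x" if x: "x > a" for x
  proof -
    have "f x > f a" using mono[of a x] x by simp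
    from i[OF this] show ?thesis using inj x by blast
  qed
  have di: "(i has_real_derivative 1 / g (i y)) (at y)" if y: "y > f a" for y
  proof -
    define x where "x = i y"
    have x: "x > a" "f x = y" using i[OF y] by (auto simp: x_def)
    have "isCont i (f x)"
    proof (rule isCont_inverse_function2[where f = f and x = x and a = "(a + x) / 2" and b = "x + 1"])
      fix z assume "(a + x) / 2 \<le> z"
      then have "z > a" using x(1) by simp
      then show "i (f z) = z" "isCont f z" using if_eq d[of z] by (auto intro: DERIV_isCont)
    qed (use x in auto)
    moreover have "(f has_real_derivative g (i y)) (at (i y))" "g (i y) \<noteq> 0"
      using d[of x] g[of x] x by (auto simp: x_def)
    ultimately have "(i has_real_derivative inverse (g (i y))) (at y)"
      using x y i by (intro DERIV_inverse_function[of f _ _ _ "f a" "y + 1"]) auto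
    then show ?thesis by (simp add: divide_inverse)
  qed
  have "filterlim i at_top at_top"
    unfolding filterlim_at_top
  proof
    fix Z
    show "eventually (\<lambda>y. Z \<le> i y) at_top"
      using eventually_gt_at_top[of "max (f a) (f (max Z a))"]
    proof eventually_elim
      case (elim y)
      show ?case
      proof (rule ccontr)
        assume "\<not> Z \<le> i y"
        then have "f (i y) < f (max Z a)" using mono[of "i y" "max Z a"] i[of y] elim by auto
        then show False using i[of y] elim by auto
      qed
    qed
  qed
  then show ?thesis using that i di by blast
qed

text \<open>The prescribed limit \<open>b\<close> forces \<open>(H / m) powr m = b\<close> for the
  limit \<open>H\<close> supplied by \<open>ode_sol_growth\<close>, which turns the general growth
  statement into one with known constants.\<close>

lemma growth_data:
  assumes m: "m > 1 / 2" and k: "k = (m - 1) / m" and s: "ode_sol k {T<..} f g h"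
    and lim: "((\<lambda>t. f t / t powr m) \<longlongrightarrow> b) at_top" and b: "b > 0"
  obtains C T1 where "T1 > T" "((\<lambda>t. g t / t powr (m - 1)) \<longlongrightarrow> m * b) at_top" "filterlim f at_top at_top"
    "\<And>t. t \<ge> T1 \<Longrightarrow> f t \<ge> 1 \<and> g t > 0 \<and> \<bar>h t\<bar> \<le> C * (g t)\<^sup>2 / f t \<and> \<bar>k * (g t)\<^sup>2 - f t * h t\<bar> \<le> C * (g t) ^ 3 / (f t)\<^sup>2"
proof -
  have kb: "- 1 < k" "k < 1" using m by (auto simp: k field_simps)
  have "filterlim (\<lambda>t. t powr m) at_top at_top" using m by real_asymp
  then have "filterlim (\<lambda>t. f t / t powr m * t powr m) at_top at_top"
    by (rule filterlim_tendsto_pos_mult_at_top[OF lim b])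
  then have top: "filterlim f at_top at_top"
    by (rule filterlim_at_top_mono) (rule eventually_mono[OF eventually_gt_at_top[of 0]], simp)
  obtain H C T1 where H: "H > 0" "T1 > T" "((\<lambda>t. g t * f t powr (- k)) \<longlongrightarrow> H) at_top"
    and bd: "\<And>t. t \<ge> T1 \<Longrightarrow> f t \<ge> 1 \<and> g t > 0 \<and> \<bar>h t\<bar> \<le> C * (g t)\<^sup>2 / f t \<and> \<bar>k * (g t)\<^sup>2 - f t * h t\<bar> \<le> C * (g t) ^ 3 / (f t)\<^sup>2"
    by (rule ode_sol_growth[OF kb s top]) blast
  note pg = power_growth[OF m k s top H(3,1)]
  have "(H / m) powr m = b" using tendsto_unique[OF _ pg(1) lim] by simp
  then show ?thesis using that[of T1 C] H pg(2) top bd by simp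
qed

lemma mean_value_between:
  fixes f :: "real \<Rightarrow> real"
  assumes d: "\<And>t. t \<ge> S \<Longrightarrow> (f has_real_derivative f' t) (at t)" and "x \<ge> S" "y \<ge> S"
  shows "\<exists>\<zeta>. \<bar>\<zeta> - y\<bar> \<le> \<bar>x - y\<bar> \<and> f x - f y = f' \<zeta> * (x - y)"
proof (cases x y rule: linorder_cases)
  case less
  then obtain \<zeta> where "x < \<zeta>" "\<zeta> < y" "f y - f x = (y - x) * f' \<zeta>"
    using MVT2[of x y f f'] d assms(2) by auto
  then show ?thesis by (intro exI[of _ \<zeta>]) (auto simp: algebra_simps)
next
  case greater
  then obtain \<zeta> where "y < \<zeta>" "\<zeta> < x" "f x - f y = (x - y) * f' \<zeta>"
    using MVT2[of y x f f'] d assms(3) by auto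
  then show ?thesis by (intro exI[of _ \<zeta>]) (auto simp: algebra_simps)
qed auto

text \<open>Writing \<open>f\<^sub>1 = f\<^sub>2 \<circ> s\<close> removes the shift from the three-dimensional family of differences;
  \<open>\<omega> = s' - 1\<close> then solves a linear equation of second order whose slow mode is a change of
  scale, which is excluded by the common limit \<open>b\<close>. What remains is the exponentially small mode.\<close>

lemma compare_growing_solutions:
  assumes m: "m > 1 / 2" and k: "k = (m - 1) / m" and b: "b > 0"
    and s1: "ode_sol k {T1<..} f1 g1 h1" and l1: "((\<lambda>t. f1 t / t powr m) \<longlongrightarrow> b) at_top"
    and s2: "ode_sol k {T2<..} f2 g2 h2" and l2: "((\<lambda>t. f2 t / t powr m) \<longlongrightarrow> b) at_top"
    and F2: "\<And>t. t > T2 \<Longrightarrow> (F2 has_real_derivative f2 t) (at t)"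
  obtains (equal) c where "eventually (\<lambda>t. f1 t = f2 (t + c)) at_top"
    | (fast) c D where "D \<noteq> 0"
      "((\<lambda>t. (f1 t - f2 (t + c)) * exp (F2 (t + c)) * (t + c) powr (4 * m - 2)) \<longlongrightarrow> D) at_top"
proof -
  have m0: "m > 0" using m by simp
  have mb: "m * b > 0" using m0 b by simp
  obtain C1 S1 where S1: "S1 > T1" and g1: "((\<lambda>t. g1 t / t powr (m - 1)) \<longlongrightarrow> m * b) at_top" and top1: "filterlim f1 at_top at_top"
    and bd1: "\<And>t. t \<ge> S1 \<Longrightarrow> f1 t \<ge> 1 \<and> g1 t > 0 \<and> \<bar>h1 t\<bar> \<le> C1 * (g1 t)\<^sup>2 / f1 t \<and> \<bar>k * (g1 t)\<^sup>2 - f1 t * h1 t\<bar> \<le> C1 * (g1 t) ^ 3 / (f1 t)\<^sup>2"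
    by (rule growth_data[OF m k s1 l1 b]) blast
  obtain C S2 where S2: "S2 > T2" and g2: "((\<lambda>t. g2 t / t powr (m - 1)) \<longlongrightarrow> m * b) at_top" and top2: "filterlim f2 at_top at_top"
    and bd2: "\<And>t. t \<ge> S2 \<Longrightarrow> f2 t \<ge> 1 \<and> g2 t > 0 \<and> \<bar>h2 t\<bar> \<le> C * (g2 t)\<^sup>2 / f2 t \<and> \<bar>k * (g2 t)\<^sup>2 - f2 t * h2 t\<bar> \<le> C * (g2 t) ^ 3 / (f2 t)\<^sup>2"
    by (rule growth_data[OF m k s2 l2 b]) blast
  have D2: "(f2 has_real_derivative g2 t) (at t)" "(g2 has_real_derivative h2 t) (at t)"
    "(h2 has_real_derivative k * (g2 t)\<^sup>2 - f2 t * h2 t) (at t)" if "t \<ge> S2" for t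
    using ode_solD[OF s2, of t] S2 that by auto
  obtain i where i: "\<And>y. y > f2 S2 \<Longrightarrow> i y > S2 \<and> f2 (i y) = y \<and> (i has_real_derivative 1 / g2 (i y)) (at y)"
    and itop: "filterlim i at_top at_top"
    by (rule increasing_inverse[of S2 f2 g2]) (use D2 bd2 top2 in auto)
  have "eventually (\<lambda>t. f1 t > f2 S2 \<and> t \<ge> S1 \<and> t \<ge> 1) at_top"
    using top1 eventually_ge_at_top[of S1] eventually_ge_at_top[of 1]
    by (simp add: filterlim_at_top_dense eventually_conj_iff)
  then obtain T where T: "\<And>t. t \<ge> T \<Longrightarrow> f1 t > f2 S2 \<and> t \<ge> S1 \<and> t \<ge> 1"
    unfolding eventually_at_top_linorder by auto
  have D1: "(f1 has_real_derivative g1 t) (at t)" "(g1 has_real_derivative h1 t) (at t)"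
    "(h1 has_real_derivative k * (g1 t)\<^sup>2 - f1 t * h1 t) (at t)" if "t \<ge> T" for t
    using ode_solD[OF s1, of t] T[OF that] S1 by auto
  \<comment> \<open>The reparametrization with \<open>f1 = f2 \<circ> s\<close>; \<open>q\<close>
    and \<open>z\<close> below are its first two derivatives, expressed through the solutions. A
    pure shift corresponds to \<open>q = 1\<close>.\<close>
  define s where "s = (\<lambda>t. i (f1 t))"
  have s: "s t > S2" "f2 (s t) = f1 t" if "t \<ge> T" for t using i T[OF that] by (auto simp: s_def)
  have stop: "filterlim s at_top at_top" unfolding s_def by (rule filterlim_compose[OF itop top1])
  define q where "q = (\<lambda>t. g1 t / g2 (s t))"
  define z where "z = (\<lambda>t. (h1 t - (q t)\<^sup>2 * h2 (s t)) / g2 (s t))"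
  define r where "r = (\<lambda>t. h2 (s t) / g2 (s t))"
  define B0 where "B0 = (\<lambda>t. (k * (g2 (s t))\<^sup>2 - f2 (s t) * h2 (s t)) / g2 (s t))"
  have gs: "g2 (s t) > 0" if "t \<ge> T" for t using bd2 s(1)[OF that] by auto
  have g1p: "g1 t > 0" "f1 t \<ge> 1" "f1 t > 0" "t \<ge> 1" if "t \<ge> T" for t using bd1[of t] T[OF that] by auto
  have ds: "(s has_real_derivative q t) (at t)" if t: "t \<ge> T" for t
  proof -
    have "(i has_real_derivative 1 / g2 (s t)) (at (f1 t))" using i T[OF t] by (auto simp: s_def)
    from DERIV_chain2[OF this D1(1)[OF t]] show ?thesis by (simp add: s_def q_def)
  qed
  have dgs: "((\<lambda>t. g2 (s t)) has_real_derivative h2 (s t) * q t) (at t)"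
    and dhs: "((\<lambda>t. h2 (s t)) has_real_derivative (k * (g2 (s t))\<^sup>2 - f2 (s t) * h2 (s t)) * q t) (at t)" if t: "t \<ge> T" for t
    using DERIV_chain2[OF D2(2) ds[OF t]] DERIV_chain2[OF D2(3) ds[OF t]] s(1)[OF t] by auto
  have qg: "g1 t = q t * g2 (s t)" and zh: "h1 t = z t * g2 (s t) + (q t)\<^sup>2 * h2 (s t)" if "t \<ge> T" for t
    using gs[OF that] by (auto simp: q_def z_def)
  have dq: "(q has_real_derivative z t) (at t)" if t: "t \<ge> T" for t
  proof -
    have "(q has_real_derivative (h1 t * g2 (s t) - g1 t * (h2 (s t) * q t)) / (g2 (s t) * g2 (s t))) (at t)"
      unfolding q_def[of] using gs[OF t] by (intro DERIV_divide D1(2)[OF t] dgs[OF t, unfolded q_def]) auto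
    moreover have "(h1 t * g2 (s t) - g1 t * (h2 (s t) * q t)) / (g2 (s t) * g2 (s t)) = z t"
      unfolding qg[OF t] z_def using gs[OF t] by (simp add: field_simps power2_eq_square)
    ultimately show ?thesis by (rule DERIV_cong)
  qed
  \<comment> \<open>Substituting \<open>f1 = f2 \<circ> s\<close> in the equation and eliminating by
    the equation of \<open>f2\<close> leaves
    \<open>f2''' q^2 (q - 1) + f2' z' + (3 f2'' q + f2 f2') z = 0\<close>, with \<open>f2\<close>
    taken at \<open>s\<close>. Division by \<open>f2'\<close> gives \<open>A\<close> and
    \<open>B\<close>; \<open>B0\<close> is \<open>f2''' / f2'\<close>.\<close>
  define \<omega> where "\<omega> = (\<lambda>t. q t - 1)"
  define A where "A = (\<lambda>t. f1 t + 3 * r t * q t)"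
  define B where "B = (\<lambda>t. B0 t * (q t)\<^sup>2)"
  have d\<omega>: "(\<omega> has_real_derivative z t) (at t)" if "t \<ge> T" for t
    unfolding \<omega>_def using DERIV_diff[OF dq[OF that] DERIV_const[of 1]] by simp
  have dz: "(z has_real_derivative - A t * z t - B t * \<omega> t) (at t)" if t: "t \<ge> T" for t
  proof -
    have sq: "((\<lambda>t. (q t)\<^sup>2) has_real_derivative 2 * q t * z t) (at t)"
      by (auto intro!: derivative_eq_intros dq[OF t])
    let ?h3 = "k * (g2 (s t))\<^sup>2 - f2 (s t) * h2 (s t)"
    have num: "((\<lambda>t. h1 t - (q t)\<^sup>2 * h2 (s t)) has_real_derivative
       (k * (g1 t)\<^sup>2 - f1 t * h1 t) - (2 * q t * z t * h2 (s t) + ?h3 * q t * (q t)\<^sup>2)) (at t)"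
      by (intro DERIV_diff D1(3)[OF t] DERIV_mult sq dhs[OF t])
    have "(z has_real_derivative
       (((k * (g1 t)\<^sup>2 - f1 t * h1 t) - (2 * q t * z t * h2 (s t) + ?h3 * q t * (q t)\<^sup>2)) * g2 (s t)
         - (h1 t - (q t)\<^sup>2 * h2 (s t)) * (h2 (s t) * q t)) / (g2 (s t) * g2 (s t))) (at t)"
      unfolding z_def[of] using gs[OF t] by (intro DERIV_divide num[unfolded z_def] dgs[OF t]) auto
    moreover have "(((k * (g1 t)\<^sup>2 - f1 t * h1 t) - (2 * q t * z t * h2 (s t) + ?h3 * q t * (q t)\<^sup>2)) * g2 (s t)
         - (h1 t - (q t)\<^sup>2 * h2 (s t)) * (h2 (s t) * q t)) / (g2 (s t) * g2 (s t)) = - A t * z t - B t * \<omega> t"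
      unfolding A_def B_def \<omega>_def r_def B0_def qg[OF t] zh[OF t] s(2)[OF t]
      using gs[OF t] by (simp add: divide_simps) (simp add: algebra_simps power2_eq_square)
    ultimately show ?thesis by (rule DERIV_cong)
  qed
  \<comment> \<open>The common limit \<open>b\<close> enters here: it forces \<open>s\<close> to be
    asymptotic to \<open>t\<close>, hence \<open>q\<close> to tend to \<open>1\<close> and
    \<open>\<omega>\<close> to \<open>0\<close>.\<close>
  have st: "((\<lambda>t. s t / t) \<longlongrightarrow> 1) at_top"
  proof -
    have "((\<lambda>t. (f1 t / t powr m) / (f2 (s t) / s t powr m)) \<longlongrightarrow> b / b) at_top"
      using b by (intro tendsto_divide l1 filterlim_compose[OF l2 stop]) auto
    then have "((\<lambda>t. ((f1 t / t powr m) / (f2 (s t) / s t powr m)) powr (1 / m)) \<longlongrightarrow> (b / b) powr (1 / m)) at_top"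
      using b by (intro tendsto_powr tendsto_const) auto
    then have "((\<lambda>t. ((f1 t / t powr m) / (f2 (s t) / s t powr m)) powr (1 / m)) \<longlongrightarrow> 1) at_top" using b by simp
    then show ?thesis
    proof (rule Lim_transform_eventually)
      have "eventually (\<lambda>t. s t > 0) at_top" using stop by (simp add: filterlim_at_top_dense)
      then show "eventually (\<lambda>t. ((f1 t / t powr m) / (f2 (s t) / s t powr m)) powr (1 / m) = s t / t) at_top"
        using eventually_ge_at_top[of T]
      proof eventually_elim
        case (elim t)
        have "(f1 t / t powr m) / (f2 (s t) / s t powr m) = (s t / t) powr m"
          using elim g1p[OF elim(2)] s(2)[OF elim(2)] by (simp add: powr_divide field_simps)
        then show ?case using elim m0 g1p(4)[OF elim(2)] by (simp add: powr_powr)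
      qed
    qed
  qed
  have g2s: "((\<lambda>t. g2 (s t) / t powr (m - 1)) \<longlongrightarrow> m * b) at_top" by (rule power_asymp_compose[OF g2 st])
  have tpos: "eventually (\<lambda>t. t \<ge> T \<and> t > 0) at_top"
    using eventually_ge_at_top[of T] eventually_gt_at_top[of 0] by eventually_elim auto
  have q1: "(q \<longlongrightarrow> 1) at_top"
  proof -
    have "((\<lambda>t. (g1 t / t powr (m - 1)) / (g2 (s t) / t powr (m - 1))) \<longlongrightarrow> (m * b) / (m * b)) at_top"
      using mb by (intro tendsto_divide g1 g2s) auto
    moreover have "(m * b) / (m * b) = 1" by (rule divide_self) (use mb in linarith)
    ultimately have "((\<lambda>t. (g1 t / t powr (m - 1)) / (g2 (s t) / t powr (m - 1))) \<longlongrightarrow> 1) at_top" by (simp only:)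
    then show ?thesis
      by (rule Lim_transform_eventually) (rule eventually_mono[OF tpos], simp add: q_def)
  qed
  have \<omega>0: "(\<omega> \<longlongrightarrow> 0) at_top" unfolding \<omega>_def using tendsto_diff[OF q1 tendsto_const[of 1]] by simp
  have gf: "((\<lambda>t. t * (g2 (s t) / f1 t)) \<longlongrightarrow> m) at_top"
  proof -
    have "((\<lambda>t. (g2 (s t) / t powr (m - 1)) / (f1 t / t powr m)) \<longlongrightarrow> (m * b) / b) at_top"
      using b by (intro tendsto_divide g2s l1) auto
    then have "((\<lambda>t. (g2 (s t) / t powr (m - 1)) / (f1 t / t powr m)) \<longlongrightarrow> m) at_top" using b by simp
    then show ?thesis
      by (rule Lim_transform_eventually) (rule eventually_mono[OF tpos], simp add: powr_diff field_simps)
  qed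
  have inv0: "((\<lambda>t::real. 1 / t) \<longlongrightarrow> 0) at_top" by real_asymp
  have gf0: "((\<lambda>t. g2 (s t) / f1 t) \<longlongrightarrow> 0) at_top"
  proof -
    have "((\<lambda>t. t * (g2 (s t) / f1 t) * (1 / t)) \<longlongrightarrow> m * 0) at_top" by (intro tendsto_mult gf inv0)
    then have "((\<lambda>t. t * (g2 (s t) / f1 t) * (1 / t)) \<longlongrightarrow> 0) at_top" by simp
    then show ?thesis by (rule Lim_transform_eventually) (rule eventually_mono[OF tpos], simp)
  qed
  have f1inv: "((\<lambda>t. inverse (f1 t)) \<longlongrightarrow> 0) at_top" by (rule tendsto_inverse_0_at_top[OF top1])
  have rb: "\<bar>r t\<bar> \<le> \<bar>C\<bar> * (g2 (s t) / f1 t)" if t: "t \<ge> T" for t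
  proof -
    have "\<bar>h2 (s t)\<bar> \<le> C * (g2 (s t))\<^sup>2 / f1 t" using bd2[of "s t"] s[OF t] by auto
    then have "\<bar>r t\<bar> \<le> (C * (g2 (s t))\<^sup>2 / f1 t) / g2 (s t)"
      unfolding r_def abs_divide abs_of_pos[OF gs[OF t]] using gs[OF t] by (intro divide_right_mono) auto
    also have "\<dots> = C * (g2 (s t) / f1 t)" using gs[OF t] by (simp add: power2_eq_square)
    also have "\<dots> \<le> \<bar>C\<bar> * (g2 (s t) / f1 t)" using gs[OF t] g1p[OF t] by (intro mult_right_mono) auto
    finally show ?thesis .
  qed
  have r0: "(r \<longlongrightarrow> 0) at_top"
    by (rule tendsto_0_le[OF gf0, of _ "\<bar>C\<bar>"])
       (rule eventually_mono[OF eventually_ge_at_top[of T]],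
        use rb gs g1p in \<open>simp add: mult.commute abs_of_pos less_imp_le\<close>)
  \<comment> \<open>The bound on the third derivative from \<open>ode_sol_growth\<close> makes
    \<open>B0\<close> of order \<open>(g2 / f2)^2\<close>, that is \<open>1 / t^2\<close>; the
    separate bounds on \<open>g\<close> and \<open>h\<close> would not show this cancellation in
    \<open>k g^2 - f h\<close>.\<close>
  have Bb: "\<bar>B0 t\<bar> \<le> \<bar>C\<bar> * (g2 (s t) / f1 t)\<^sup>2" if t: "t \<ge> T" for t
  proof -
    have "\<bar>k * (g2 (s t))\<^sup>2 - f2 (s t) * h2 (s t)\<bar> \<le> C * (g2 (s t)) ^ 3 / (f1 t)\<^sup>2" using bd2[of "s t"] s[OF t] by auto
    then have "\<bar>B0 t\<bar> \<le> (C * (g2 (s t)) ^ 3 / (f1 t)\<^sup>2) / g2 (s t)"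
      unfolding B0_def abs_divide abs_of_pos[OF gs[OF t]] using gs[OF t] by (intro divide_right_mono) auto
    also have "\<dots> = C * (g2 (s t) / f1 t)\<^sup>2" using gs[OF t] by (simp add: power2_eq_square power3_eq_cube)
    also have "\<dots> \<le> \<bar>C\<bar> * (g2 (s t) / f1 t)\<^sup>2" by (intro mult_right_mono) auto
    finally show ?thesis .
  qed
  define C' where "C' = \<bar>C\<bar> * (m\<^sup>2 * 1\<^sup>2) + 1"
  have "((\<lambda>t. \<bar>C\<bar> * ((t * (g2 (s t) / f1 t))\<^sup>2 * (q t)\<^sup>2)) \<longlongrightarrow> \<bar>C\<bar> * (m\<^sup>2 * 1\<^sup>2)) at_top"
    by (intro tendsto_intros gf q1)
  then have "eventually (\<lambda>t. \<bar>C\<bar> * ((t * (g2 (s t) / f1 t))\<^sup>2 * (q t)\<^sup>2) < C') at_top"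
    by (rule order_tendstoD) (simp add: C'_def)
  then have "eventually (\<lambda>t. \<bar>B t\<bar> \<le> C' / t\<^sup>2) at_top" using tpos
  proof eventually_elim
    case (elim t)
    have "t\<^sup>2 * \<bar>B t\<bar> = t\<^sup>2 * (\<bar>B0 t\<bar> * (q t)\<^sup>2)" by (simp add: B_def abs_mult)
    also have "\<dots> \<le> t\<^sup>2 * (\<bar>C\<bar> * (g2 (s t) / f1 t)\<^sup>2 * (q t)\<^sup>2)" using Bb[of t] elim by (intro mult_left_mono mult_right_mono) auto
    also have "\<dots> = \<bar>C\<bar> * ((t * (g2 (s t) / f1 t))\<^sup>2 * (q t)\<^sup>2)" by (simp add: power_mult_distrib power_divide)
    finally have "t\<^sup>2 * \<bar>B t\<bar> \<le> C'" using elim by simp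
    then show ?case using elim by (simp add: field_simps)
  qed
  then obtain T3 where T3: "\<And>t. t \<ge> T3 \<Longrightarrow> \<bar>B t\<bar> \<le> C' / t\<^sup>2 \<and> t \<ge> T"
    using eventually_conj[OF _ eventually_ge_at_top[of T]] unfolding eventually_at_top_linorder by (metis le_trans nle_le order_trans)
  have AY: "((\<lambda>t. A t / f1 t) \<longlongrightarrow> 1) at_top"
  proof -
    have "((\<lambda>t. 1 + 3 * r t * q t * inverse (f1 t)) \<longlongrightarrow> 1 + 3 * 0 * 1 * 0) at_top"
      by (intro tendsto_intros r0 q1 f1inv)
    then have "((\<lambda>t. 1 + 3 * r t * q t * inverse (f1 t)) \<longlongrightarrow> 1) at_top" by simp
    then show ?thesis
      by (rule Lim_transform_eventually)
         (rule eventually_mono[OF eventually_ge_at_top[of T]], use g1p in \<open>force simp: A_def divide_inverse distrib_right\<close>)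
  qed
  have g1f: "((\<lambda>t. g1 t / (f1 t)\<^sup>2) \<longlongrightarrow> 0) at_top"
  proof -
    have "((\<lambda>t. q t * (g2 (s t) / f1 t) * inverse (f1 t)) \<longlongrightarrow> 1 * 0 * 0) at_top"
      by (intro tendsto_mult q1 gf0 f1inv)
    then have "((\<lambda>t. q t * (g2 (s t) / f1 t) * inverse (f1 t)) \<longlongrightarrow> 0) at_top" by simp
    then show ?thesis
      by (rule Lim_transform_eventually)
         (rule eventually_mono[OF eventually_ge_at_top[of T]], use qg in \<open>simp add: power2_eq_square divide_inverse\<close>)
  qed
  have C'1: "C' \<ge> 1" by (simp add: C'_def)
  show ?thesis
  proof (rule fast_slow_dichotomy[of T3 \<omega> z A B f1 g1 C', OF _ _ _ _ AY top1 g1f \<omega>0])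
    fix a assume a: "\<And>t. t \<ge> a \<Longrightarrow> \<omega> t = 0"
    define a' where "a' = max a T"
    have st: "s t = t + (s a' - a')" if t: "t \<ge> a'" for t
    proof (cases "t = a'")
      case False
      then have "a' < t" using t by simp
      moreover have "((\<lambda>t. s t - t) has_real_derivative \<omega> x) (at x)" if "a' \<le> x" for x
        using DERIV_diff[OF ds DERIV_ident] that by (simp add: \<omega>_def a'_def)
      ultimately obtain x where "a' < x" "(s t - t) - (s a' - a') = (t - a') * \<omega> x"
        using MVT2[of a' t "\<lambda>t. s t - t" \<omega>] by auto
      then show ?thesis using a[of x] by (simp add: a'_def)
    qed simp
    show thesis
    proof (rule equal[of "s a' - a'"], rule eventually_mono[OF eventually_ge_at_top[of a']])
      fix t assume t: "a' \<le> t"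
      then have "f1 t = f2 (s t)" using s(2)[of t] by (simp add: a'_def)
      then show "f1 t = f2 (t + (s a' - a'))" by (simp only: st[OF t])
    qed
  next
    fix a e assume e: "e = 1 \<or> e = - 1" and ez: "\<And>t. t \<ge> a \<Longrightarrow> e * z t > 0" and z0: "(z \<longlongrightarrow> 0) at_top"
      and W: "((\<lambda>t. \<omega> t * f1 t / z t) \<longlongrightarrow> - 1) at_top"
    have ee: "e * e = 1" using e by auto
    have "((\<lambda>t. \<bar>\<omega> t * f1 t / z t\<bar>) \<longlongrightarrow> \<bar>- 1\<bar>) at_top" by (intro tendsto_rabs W)
    then have "eventually (\<lambda>t. \<bar>\<omega> t * f1 t / z t\<bar> < 2) at_top" by (rule order_tendstoD) simp
    moreover have "((\<lambda>t. \<bar>\<omega> t\<bar>) \<longlongrightarrow> \<bar>0\<bar>) at_top" by (intro tendsto_rabs \<omega>0)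
    then have "eventually (\<lambda>t. \<bar>\<omega> t\<bar> < 1) at_top" by (rule order_tendstoD) simp
    ultimately have "eventually (\<lambda>t. \<bar>\<omega> t * f1 t / z t\<bar> < 2 \<and> \<bar>\<omega> t\<bar> < 1 \<and> t \<ge> a \<and> t \<ge> T3) at_top"
      using eventually_ge_at_top[of a] eventually_ge_at_top[of T3] by eventually_elim auto
    then obtain a1 where a1: "\<And>t. t \<ge> a1 \<Longrightarrow> \<bar>\<omega> t * f1 t / z t\<bar> < 2 \<and> \<bar>\<omega> t\<bar> < 1 \<and> t \<ge> a \<and> t \<ge> T3"
      unfolding eventually_at_top_linorder by auto
    have tT: "t \<ge> T" "t \<ge> a" "t \<ge> T3" if "t \<ge> a1" for t using a1[OF that] T3[of t] by auto
    have zn: "z t \<noteq> 0" "\<bar>z t\<bar> = e * z t" if "t \<ge> a1" for t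
      using ez[OF tT(2)[OF that]] e by auto
    have \<omega>z: "\<bar>\<omega> t\<bar> * f1 t \<le> 2 * (e * z t)" if t: "t \<ge> a1" for t
    proof -
      have "\<bar>\<omega> t\<bar> * f1 t / \<bar>z t\<bar> \<le> 2" using a1[OF t] g1p(3)[OF tT(1)[OF t]] by (simp add: abs_mult)
      then show ?thesis using zn[OF t] ez[OF tT(2)[OF t]] by (simp add: divide_le_eq)
    qed
    have \<omega>z': "\<bar>\<omega> t\<bar> \<le> 2 * (e * z t)" if t: "t \<ge> a1" for t
    proof -
      have "\<bar>\<omega> t\<bar> * 1 \<le> \<bar>\<omega> t\<bar> * f1 t" using g1p(2)[OF tT(1)[OF t]] by (intro mult_left_mono) auto
      then show ?thesis using \<omega>z[OF t] by simp
    qed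
    have d2: "((\<lambda>t. 2 * (e * \<omega> t)) has_real_derivative 2 * (e * z t)) (at t)" if "t \<ge> a1" for t
      by (intro DERIV_cmult d\<omega> tT that)
    have b2: "2 * (e * \<omega> t) \<le> 2" if "t \<ge> a1" for t using a1[OF that] e by auto
    have sub1: "((\<lambda>t. s t - t) has_real_derivative \<omega> t) (at t)" if "t \<ge> a1" for t
      using DERIV_diff[OF ds[OF tT(1)[OF that]] DERIV_ident] by (simp add: \<omega>_def)
    \<comment> \<open>Since \<open>z\<close> dominates \<open>\<omega>\<close>, the derivative of
      \<open>s - t\<close> is dominated by that of the bounded function \<open>2 e \<omega>\<close>.
      The limit \<open>c\<close> is the shift between the two solutions.\<close>
    obtain c where c: "((\<lambda>t. s t - t) \<longlongrightarrow> c) at_top"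
      by (rule dominated_derivative_convergent_at_top[OF sub1 d2 \<omega>z' b2])
    define \<sigma> where "\<sigma> = (\<lambda>t. t + c)"
    define E where "E = (\<lambda>t. s t - \<sigma> t)"
    have E0: "(E \<longlongrightarrow> 0) at_top"
      using tendsto_diff[OF c tendsto_const[of c]] by (simp add: E_def \<sigma>_def algebra_simps)
    have dE: "(E has_real_derivative \<omega> t) (at t)" if "t \<ge> a1" for t
      using DERIV_diff[OF sub1[OF that] DERIV_const[of c]] by (simp add: E_def \<sigma>_def algebra_simps)
    have "((\<lambda>t. C' / t\<^sup>2) \<longlongrightarrow> 0) at_top" by real_asymp
    then have B0l: "(B \<longlongrightarrow> 0) at_top"
      by (rule tendsto_0_le[of _ _ _ 1]) (rule eventually_mono[OF eventually_ge_at_top[of T3]], use T3 C'1 in simp)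
    define \<mu> where "\<mu> = (\<lambda>t. - (A t / f1 t) - B t * (\<omega> t * f1 t / z t) * inverse (f1 t) * inverse (f1 t) - 2 * (g1 t / (f1 t)\<^sup>2))"
    have "(\<mu> \<longlongrightarrow> - 1 - 0 * - 1 * 0 * 0 - 2 * 0) at_top"
      unfolding \<mu>_def by (intro tendsto_intros AY B0l W f1inv g1f)
    then have \<mu>: "(\<mu> \<longlongrightarrow> - 1) at_top" by simp
    \<comment> \<open>\<open>E' = \<omega>\<close> is asymptotic to \<open>- z / f1\<close>, and so
      is the derivative of \<open>z / f1^2\<close>; hence \<open>E\<close> is asymptotic to
      \<open>z / f1^2\<close>. The factor \<open>e\<close> makes all signs definite.\<close>
    have L1: "((\<lambda>t. (e * E t) / (e * z t * inverse ((f1 t)\<^sup>2))) \<longlongrightarrow> 1) at_top"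
    proof (rule lhopital_zero_at_top[where f' = "\<lambda>t. e * \<omega> t" and g' = "\<lambda>t. e * z t * inverse (f1 t) * \<mu> t"])
      show "eventually (\<lambda>t. ((\<lambda>t. e * E t) has_real_derivative e * \<omega> t) (at t)) at_top"
        by (rule eventually_mono[OF eventually_ge_at_top[of a1]]) (intro DERIV_cmult dE)
      show "eventually (\<lambda>t. ((\<lambda>t. e * z t * inverse ((f1 t)\<^sup>2)) has_real_derivative e * z t * inverse (f1 t) * \<mu> t) (at t)) at_top"
        using eventually_ge_at_top[of a1]
      proof eventually_elim
        case (elim t)
        note t = tT(1)[OF elim]
        have "((\<lambda>t. (f1 t)\<^sup>2) has_real_derivative 2 * f1 t * g1 t) (at t)"
          by (auto intro!: derivative_eq_intros D1(1)[OF t])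
        then have i: "((\<lambda>t. inverse ((f1 t)\<^sup>2)) has_real_derivative - (2 * f1 t * g1 t / ((f1 t)\<^sup>2)\<^sup>2)) (at t)"
          by (rule DERIV_cong[OF DERIV_inverse_fun]) (use g1p(3)[OF t] in \<open>auto simp: field_simps\<close>)
        show ?case
          by (rule DERIV_cong[OF DERIV_mult[OF DERIV_cmult[OF dz[OF t], of e] i]])
             (use g1p(3)[OF t] zn(1)[OF elim] in \<open>simp add: \<mu>_def divide_simps, simp add: algebra_simps eval_nat_numeral\<close>)
      qed
      have "eventually (\<lambda>t. \<mu> t < 0) at_top" using \<mu> by (rule order_tendstoD) simp
      then show "eventually (\<lambda>t. e * z t * inverse (f1 t) * \<mu> t < 0) at_top"
        using eventually_ge_at_top[of a1]
      proof eventually_elim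
        case (elim t)
        then show ?case using ez[OF tT(2)[OF elim(2)]] g1p(3)[OF tT(1)[OF elim(2)]] by (intro mult_pos_neg mult_pos_pos[of "e * z t"]) auto
      qed
      show "((\<lambda>t. e * E t) \<longlongrightarrow> 0) at_top" using tendsto_mult[OF tendsto_const[of e] E0] by simp
      have "((\<lambda>t. e * z t * (inverse (f1 t))\<^sup>2) \<longlongrightarrow> e * 0 * 0\<^sup>2) at_top" by (intro tendsto_intros z0 f1inv)
      then show "((\<lambda>t. e * z t * inverse ((f1 t)\<^sup>2)) \<longlongrightarrow> 0) at_top" by (simp add: power_inverse)
      have "((\<lambda>t. (\<omega> t * f1 t / z t) / \<mu> t) \<longlongrightarrow> - 1 / - 1) at_top" by (intro tendsto_divide W \<mu>) simp
      then have q: "((\<lambda>t. (\<omega> t * f1 t / z t) / \<mu> t) \<longlongrightarrow> 1) at_top" by simp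
      show "((\<lambda>t. e * \<omega> t / (e * z t * inverse (f1 t) * \<mu> t)) \<longlongrightarrow> 1) at_top"
        by (rule Lim_transform_eventually[OF q], rule eventually_mono[OF eventually_ge_at_top[of a1]])
           (use e in \<open>auto simp: divide_inverse\<close>)
    qed
    have Ez: "((\<lambda>t. E t * (f1 t)\<^sup>2 / z t) \<longlongrightarrow> 1) at_top"
      by (rule Lim_transform_eventually[OF L1], rule always_eventually) (use e in \<open>auto simp: divide_inverse\<close>)
    \<comment> \<open>An explicit integrating factor for \<open>z\<close>. In
      \<open>z' / z = - f1 - 3 r q - B \<omega> / z\<close>, the term \<open>3 r q\<close> is the
      derivative of \<open>3 ln (g2 \<circ> s)\<close>, and \<open>f1\<close> is that of
      \<open>F2 \<circ> s\<close> up to \<open>f1 \<omega>\<close>. What remains is dominated by a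
      function with bounded primitive.\<close>
    define u where "u = (\<lambda>t. ln (e * z t) + F2 (s t) + 3 * ln (g2 (s t)))"
    have du: "(u has_real_derivative f1 t * \<omega> t - B t * (\<omega> t / z t)) (at t)" if t: "t \<ge> a1" for t
    proof -
      note tt = tT(1)[OF t]
      have 1: "((\<lambda>t. ln (e * z t)) has_real_derivative e * (- A t * z t - B t * \<omega> t) / (e * z t)) (at t)"
        using DERIV_chain2[OF DERIV_ln_divide DERIV_cmult[OF dz[OF tt], of e]] ez[OF tT(2)[OF t]] by simp
      have 2: "((\<lambda>t. F2 (s t)) has_real_derivative f2 (s t) * q t) (at t)"
        using s(1)[OF tt] S2 by (intro DERIV_chain2[OF F2 ds[OF tt]]) auto
      have 3: "((\<lambda>t. ln (g2 (s t))) has_real_derivative h2 (s t) * q t / g2 (s t)) (at t)"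
        using DERIV_chain2[OF DERIV_ln_divide dgs[OF tt]] gs[OF tt] by simp
      show ?thesis unfolding u_def
        by (rule DERIV_cong[OF DERIV_add[OF DERIV_add[OF 1 2] DERIV_cmult[OF 3, of 3]]])
           (use zn(1)[OF t] e gs[OF tt] s(2)[OF tt] in \<open>auto simp: A_def \<omega>_def r_def field_simps\<close>)
    qed
    have bu: "\<bar>f1 t * \<omega> t - B t * (\<omega> t / z t)\<bar> \<le> 2 * C' / t\<^sup>2 + 2 * (e * z t)" if t: "t \<ge> a1" for t
    proof -
      note tt = tT(1)[OF t]
      have "\<bar>f1 t * \<omega> t\<bar> \<le> 2 * (e * z t)" using \<omega>z[OF t] g1p(3)[OF tt] by (simp add: abs_mult mult.commute)
      moreover have "\<bar>B t * (\<omega> t / z t)\<bar> \<le> 2 * C' / t\<^sup>2"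
      proof -
        have "\<bar>\<omega> t / z t\<bar> \<le> 2"
          using \<omega>z'[OF t] zn[OF t] ez[OF tT(2)[OF t]] by (simp add: abs_divide divide_le_eq)
        then have "\<bar>B t * (\<omega> t / z t)\<bar> \<le> C' / t\<^sup>2 * 2"
          unfolding abs_mult using T3[OF tT(3)[OF t]] by (intro mult_mono) auto
        then show ?thesis by (simp add: mult.commute)
      qed
      ultimately have "\<bar>f1 t * \<omega> t\<bar> + \<bar>B t * (\<omega> t / z t)\<bar> \<le> 2 * (e * z t) + 2 * C' / t\<^sup>2" by (rule add_mono)
      then show ?thesis unfolding add.commute[of "2 * (e * z t)"] by (rule order_trans[OF abs_triangle_ineq4])
    qed
    obtain \<Lambda> where lam: "(u \<longlongrightarrow> \<Lambda>) at_top"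
    proof (rule dominated_derivative_convergent_at_top[OF du _ bu])
      show "((\<lambda>t. - 2 * C' / t + 2 * (e * \<omega> t)) has_real_derivative 2 * C' / t\<^sup>2 + 2 * (e * z t)) (at t)" if t: "a1 \<le> t" for t
      proof (rule DERIV_add[OF _ d2[OF t]])
        show "((\<lambda>t. - 2 * C' / t) has_real_derivative 2 * C' / t\<^sup>2) (at t)"
          using g1p(4)[OF tT(1)[OF t]] by (auto intro!: derivative_eq_intros simp: power2_eq_square)
      qed
      show "- 2 * C' / t + 2 * (e * \<omega> t) \<le> 2" if t: "a1 \<le> t" for t
      proof -
        have "- 2 * C' / t \<le> 0" using g1p(4)[OF tT(1)[OF t]] C'1 by (simp add: divide_nonpos_pos)
        then show ?thesis using b2[OF t] by linarith
      qed
    qed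
    have "((\<lambda>t. exp (u t)) \<longlongrightarrow> exp \<Lambda>) at_top" by (intro tendsto_intros lam)
    then have Z: "((\<lambda>t. e * z t * exp (F2 (s t)) * (g2 (s t)) ^ 3) \<longlongrightarrow> exp \<Lambda>) at_top"
    proof (rule Lim_transform_eventually)
      show "eventually (\<lambda>t. exp (u t) = e * z t * exp (F2 (s t)) * (g2 (s t)) ^ 3) at_top"
        using eventually_ge_at_top[of a1]
      proof eventually_elim
        case (elim t)
        have "exp (3 * ln (g2 (s t))) = (g2 (s t)) ^ 3"
          using gs[OF tT(1)[OF elim]] exp_of_nat_mult[of 3 "ln (g2 (s t))"] by simp
        then show ?case using ez[OF tT(2)[OF elim]] by (simp add: u_def exp_add)
      qed
    qed
    define a2 where "a2 = max a1 (S2 - c)"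
    have a2: "t \<ge> a1" "\<sigma> t \<ge> S2" "s t \<ge> S2" if "t \<ge> a2" for t
      using that s(1)[OF tT(1)[of t]] by (auto simp: a2_def \<sigma>_def)
    have F2': "(F2 has_real_derivative f2 t) (at t)" if "t \<ge> S2" for t using F2[of t] that S2 by simp
    have "\<forall>t. \<exists>\<zeta>. t \<ge> a2 \<longrightarrow> \<bar>\<zeta> - \<sigma> t\<bar> \<le> \<bar>E t\<bar> \<and> f2 (s t) - f2 (\<sigma> t) = g2 \<zeta> * E t"
      using mean_value_between[of S2 f2 g2, OF D2(1) a2(3,2)] unfolding E_def by blast
    then obtain \<zeta> where \<zeta>: "\<And>t. t \<ge> a2 \<Longrightarrow> \<bar>\<zeta> t - \<sigma> t\<bar> \<le> \<bar>E t\<bar> \<and> f2 (s t) - f2 (\<sigma> t) = g2 (\<zeta> t) * E t"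
      by metis
    have "\<forall>t. \<exists>\<zeta>. t \<ge> a2 \<longrightarrow> \<bar>\<zeta> - \<sigma> t\<bar> \<le> \<bar>E t\<bar> \<and> F2 (s t) - F2 (\<sigma> t) = f2 \<zeta> * E t"
      using mean_value_between[of S2 F2 f2, OF F2' a2(3,2)] unfolding E_def by blast
    then obtain \<eta> where \<eta>: "\<And>t. t \<ge> a2 \<Longrightarrow> \<bar>\<eta> t - \<sigma> t\<bar> \<le> \<bar>E t\<bar> \<and> F2 (s t) - F2 (\<sigma> t) = f2 (\<eta> t) * E t"
      by metis
    have near: "((\<lambda>t. x t / t) \<longlongrightarrow> 1) at_top" if "\<And>t. t \<ge> a2 \<Longrightarrow> \<bar>x t - \<sigma> t\<bar> \<le> \<bar>E t\<bar>" for x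
    proof -
      have "((\<lambda>t. x t - \<sigma> t) \<longlongrightarrow> 0) at_top"
        by (rule tendsto_0_le[OF E0, of _ 1]) (rule eventually_mono[OF eventually_ge_at_top[of a2]], use that in simp)
      then have "((\<lambda>t. (x t - \<sigma> t) * (1 / t) + 1 + c * (1 / t)) \<longlongrightarrow> 0 * 0 + 1 + c * 0) at_top"
        by (intro tendsto_intros inv0)
      then have "((\<lambda>t. (x t - \<sigma> t) * (1 / t) + 1 + c * (1 / t)) \<longlongrightarrow> 1) at_top" by simp
      then show ?thesis
        by (rule Lim_transform_eventually) (rule eventually_mono[OF tpos], simp add: \<sigma>_def field_simps)
    qed
    have g\<zeta>: "((\<lambda>t. g2 (\<zeta> t) / t powr (m - 1)) \<longlongrightarrow> m * b) at_top"
      by (rule power_asymp_compose[OF g2 near]) (use \<zeta> in blast)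
    have f\<eta>: "((\<lambda>t. f2 (\<eta> t) / t powr m) \<longlongrightarrow> b) at_top"
      by (rule power_asymp_compose[OF l2 near]) (use \<eta> in blast)
    have \<sigma>1: "((\<lambda>t. \<sigma> t / t) \<longlongrightarrow> 1) at_top" by (rule near) simp
    \<comment> \<open>Replaces the argument \<open>s t\<close> by the true shift
      \<open>t + c\<close> in the exponent: the difference is \<open>f2 E\<close>, which vanishes
      because \<open>E\<close> is of order \<open>z / f1^2\<close>.\<close>
    have Fdiff: "((\<lambda>t. F2 (\<sigma> t) - F2 (s t)) \<longlongrightarrow> 0) at_top"
    proof -
      have "((\<lambda>t. - ((f2 (\<eta> t) / t powr m) * (E t * (f1 t)\<^sup>2 / z t) * z t * inverse (f1 t) / (f1 t / t powr m)))
          \<longlongrightarrow> - (b * 1 * 0 * 0 / b)) at_top"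
        by (intro tendsto_intros f\<eta> Ez z0 f1inv l1) (use b in simp)
      then have "((\<lambda>t. - ((f2 (\<eta> t) / t powr m) * (E t * (f1 t)\<^sup>2 / z t) * z t * inverse (f1 t) / (f1 t / t powr m))) \<longlongrightarrow> 0) at_top"
        by simp
      then show ?thesis
      proof (rule Lim_transform_eventually)
        show "eventually (\<lambda>t. - ((f2 (\<eta> t) / t powr m) * (E t * (f1 t)\<^sup>2 / z t) * z t * inverse (f1 t) / (f1 t / t powr m))
            = F2 (\<sigma> t) - F2 (s t)) at_top"
          using eventually_ge_at_top[of a2] tpos
        proof eventually_elim
          case (elim t)
          have "F2 (\<sigma> t) - F2 (s t) = - (f2 (\<eta> t) * E t)" using \<eta>[OF elim(1)] by simp
          then show ?case using zn(1)[OF a2(1)[OF elim(1)]] g1p(3)[of t] elim by (simp add: power2_eq_square)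
        qed
      qed
    qed
    \<comment> \<open>Asymptotically \<open>f1 - f2 (t + c)\<close> is \<open>g2 E\<close>,
      \<open>E\<close> is \<open>z / f1^2\<close>, and \<open>z\<close> is a constant times
      \<open>exp (- F2) / g2^3\<close>. With \<open>f\<close> of order \<open>t^m\<close> and
      \<open>g\<close> of order \<open>t^(m - 1)\<close> the power is
      \<open>(m - 1) - 2 m - 3 (m - 1) = 2 - 4 m\<close>; \<open>D\<close> collects the
      constants.\<close>
    define D where "D = (m * b) * 1 * (e * exp \<Lambda>) * exp 0 * 1 powr (4 * m - 2) / (b\<^sup>2 * (m * b) ^ 3)"
    have "D \<noteq> 0" using m0 b e by (auto simp: D_def)
    moreover have "((\<lambda>t. (f1 t - f2 (t + c)) * exp (F2 (t + c)) * (t + c) powr (4 * m - 2)) \<longlongrightarrow> D) at_top"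
    proof (rule Lim_transform_eventually)
      show "((\<lambda>t. (g2 (\<zeta> t) / t powr (m - 1)) * (E t * (f1 t)\<^sup>2 / z t) * (e * (e * z t * exp (F2 (s t)) * (g2 (s t)) ^ 3))
          * exp (F2 (\<sigma> t) - F2 (s t)) * (\<sigma> t / t) powr (4 * m - 2)
          / ((f1 t / t powr m)\<^sup>2 * (g2 (s t) / t powr (m - 1)) ^ 3)) \<longlongrightarrow> D) at_top"
        unfolding D_def using m0 b
        by (intro tendsto_divide tendsto_mult tendsto_power tendsto_exp tendsto_powr g\<zeta> Ez Z Fdiff \<sigma>1 l1 g2s tendsto_const) auto
      show "eventually (\<lambda>t. (g2 (\<zeta> t) / t powr (m - 1)) * (E t * (f1 t)\<^sup>2 / z t) * (e * (e * z t * exp (F2 (s t)) * (g2 (s t)) ^ 3))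
          * exp (F2 (\<sigma> t) - F2 (s t)) * (\<sigma> t / t) powr (4 * m - 2)
          / ((f1 t / t powr m)\<^sup>2 * (g2 (s t) / t powr (m - 1)) ^ 3)
          = (f1 t - f2 (t + c)) * exp (F2 (t + c)) * (t + c) powr (4 * m - 2)) at_top"
        using eventually_ge_at_top[of a2] tpos eventually_gt_at_top[of "- c"]
      proof eventually_elim
        case (elim t)
        have t: "t > 0" "t \<ge> T" "\<sigma> t > 0" using elim by (auto simp: \<sigma>_def)
        note n = zn(1)[OF a2(1)[OF elim(1)]] g1p(3)[OF t(2)] gs[OF t(2)]
        have "(t powr m)\<^sup>2 * (t powr (m - 1)) ^ 3 = t powr (m - 1) * t powr (4 * m - 2)"
          using t by (simp add: powr_realpow[symmetric] powr_powr powr_add[symmetric] power2_eq_square power3_eq_cube algebra_simps)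
        then have p: "(t powr m)\<^sup>2 * (t powr (m - 1)) ^ 3 / (t powr (m - 1) * t powr (4 * m - 2)) = 1" using t by simp
        have "(g2 (\<zeta> t) / t powr (m - 1)) * (E t * (f1 t)\<^sup>2 / z t) * (e * (e * z t * exp (F2 (s t)) * (g2 (s t)) ^ 3))
          * exp (F2 (\<sigma> t) - F2 (s t)) * (\<sigma> t / t) powr (4 * m - 2)
          / ((f1 t / t powr m)\<^sup>2 * (g2 (s t) / t powr (m - 1)) ^ 3)
          = (e * e) * (g2 (\<zeta> t) * E t) * (exp (F2 (s t)) * exp (F2 (\<sigma> t) - F2 (s t))) * \<sigma> t powr (4 * m - 2)
            * ((t powr m)\<^sup>2 * (t powr (m - 1)) ^ 3 / (t powr (m - 1) * t powr (4 * m - 2)))"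
          using n t by (simp add: powr_divide power_divide field_simps)
        also have "\<dots> = (f1 t - f2 (\<sigma> t)) * exp (F2 (\<sigma> t)) * \<sigma> t powr (4 * m - 2)"
          unfolding p ee exp_add[symmetric] using \<zeta>[OF elim(1)] s(2)[OF t(2)] by simp
        finally show ?case by (simp add: \<sigma>_def)
      qed
    qed
    ultimately show thesis by (rule fast)
  qed (use d\<omega> dz D1(1) T3 in auto)
qed

section \<open>Translation to the one-sided derivatives of the problem\<close>

lemma at_within_atMost_nontrivial: "t \<le> 0 \<Longrightarrow> at t within {..0} \<noteq> (bot :: real filter)"
proof -
  assume "t \<le> (0::real)"
  then have "at_left t \<le> at t within {..0}" by (intro at_le) auto
  then show ?thesis using trivial_limit_at_left_real[of t] by (metis bot.extremum_uniqueI)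
qed

lemma deriv_on_eqI:
  assumes "(f has_real_derivative d) (at t within S)" "at t within S \<noteq> bot"
  shows "deriv_on S f t = d"
  unfolding deriv_on_def
  using assms by (intro vector_derivative_within) (simp_all add: has_real_derivative_iff_has_vector_derivative)

lemma deriv_on_has_derivative:
  assumes "f differentiable_on S" "t \<in> S"
  shows "(f has_real_derivative deriv_on S f t) (at t within S)"
  using assms unfolding deriv_on_def differentiable_on_def
  by (simp add: has_real_derivative_iff_has_vector_derivative vector_derivative_works)

text \<open>Expanding the derivative of \<open>f f'\<close> moves one \<open>f'^2\<close> to the
  right-hand side, which turns the coefficient \<open>(2 m - 1) / m\<close> into
  \<open>(m - 1) / m\<close>. The condition on the filter makes one-sided derivatives
  unique.\<close>

lemma solves_odeD:
  assumes m: "m > 0" and s: "solves_ode m S f" and t: "t \<in> S" and nb: "at t within S \<noteq> bot"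
  shows "(f has_real_derivative deriv_on S f t) (at t within S)"
    "(deriv_on S f has_real_derivative deriv_on S (deriv_on S f) t) (at t within S)"
    "(deriv_on S (deriv_on S f) has_real_derivative (m - 1) / m * (deriv_on S f t)\<^sup>2 - f t * deriv_on S (deriv_on S f) t) (at t within S)"
proof -
  define g where "g = deriv_on S f"
  define h where "h = deriv_on S g"
  define h' where "h' = deriv_on S h t"
  have d: "(f has_real_derivative g t) (at t within S)" "(g has_real_derivative h t) (at t within S)"
    "(h has_real_derivative h') (at t within S)"
    using s deriv_on_has_derivative[OF _ t] unfolding solves_ode_def g_def h_def h'_def by auto
  have "((\<lambda>t. h t + f t * g t) has_real_derivative h' + (g t * g t + h t * f t)) (at t within S)"
    by (intro DERIV_add DERIV_mult d)
  from deriv_on_eqI[OF this nb] have "h' + (g t * g t + h t * f t) = (2 * m - 1) / m * (g t)\<^sup>2"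
    using s t unfolding solves_ode_def g_def h_def by metis
  moreover have "(2 * m - 1) / m = 1 + (m - 1) / m" using m by (simp add: field_simps)
  ultimately have "h' + h t * f t = (m - 1) / m * (g t)\<^sup>2" by (simp add: distrib_right power2_eq_square)
  then have "h' = (m - 1) / m * (g t)\<^sup>2 - f t * h t" by (simp only: eq_diff_eq mult.commute[of "f t"])
  then show "(f has_real_derivative deriv_on S f t) (at t within S)"
    "(deriv_on S f has_real_derivative deriv_on S (deriv_on S f) t) (at t within S)"
    "(deriv_on S (deriv_on S f) has_real_derivative (m - 1) / m * (deriv_on S f t)\<^sup>2 - f t * deriv_on S (deriv_on S f) t) (at t within S)"
    using d unfolding g_def h_def by auto
qed

lemma deriv_on_transform:
  assumes "(f has_real_derivative d) (at t within S)" "t \<in> S" "\<And>x. x \<in> S \<Longrightarrow> f' x = f x"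
  shows "(f' has_real_derivative d) (at t within S)"
  using assms has_vector_derivative_transform[of t S f' f d]
  by (simp add: has_real_derivative_iff_has_vector_derivative)

lemma solves_odeI:
  assumes m: "m > 0" and s: "ode_sol ((m - 1) / m) UNIV f g h" and nb: "\<And>t. t \<in> S \<Longrightarrow> at t within S \<noteq> bot"
  shows "solves_ode m S f" "t \<in> S \<Longrightarrow> deriv_on S f t = g t" "t \<in> S \<Longrightarrow> deriv_on S (deriv_on S f) t = h t"
proof -
  note D = ode_solD[OF s UNIV_I, THEN has_field_derivative_at_within]
  have g: "deriv_on S f t = g t" if "t \<in> S" for t using deriv_on_eqI[OF D(1) nb[OF that]] .
  have dg: "(deriv_on S f has_real_derivative h t) (at t within S)" if "t \<in> S" for t
    by (rule deriv_on_transform[OF D(2) that g])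
  have h: "deriv_on S (deriv_on S f) t = h t" if "t \<in> S" for t using deriv_on_eqI[OF dg[OF that] nb[OF that]] .
  have dh: "(deriv_on S (deriv_on S f) has_real_derivative (m - 1) / m * (g t)\<^sup>2 - f t * h t) (at t within S)" if "t \<in> S" for t
    by (rule deriv_on_transform[OF D(3) that h])
  show "t \<in> S \<Longrightarrow> deriv_on S f t = g t" "t \<in> S \<Longrightarrow> deriv_on S (deriv_on S f) t = h t" using g h by blast+
  have c: "(2 * m - 1) / m = 1 + (m - 1) / m" using m by (simp add: field_simps)
  have "deriv_on S (\<lambda>t. deriv_on S (deriv_on S f) t + f t * deriv_on S f t) t = (2 * m - 1) / m * (deriv_on S f t)\<^sup>2"
    if t: "t \<in> S" for t
  proof (rule deriv_on_eqI[OF _ nb[OF t]])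
    show "((\<lambda>t. deriv_on S (deriv_on S f) t + f t * deriv_on S f t) has_real_derivative (2 * m - 1) / m * (deriv_on S f t)\<^sup>2) (at t within S)"
      by (rule DERIV_cong[OF DERIV_add[OF dh[OF t] DERIV_mult[OF D(1) dg[OF t]]]])
         (simp only: g[OF t] c, simp add: algebra_simps power2_eq_square)
  qed
  moreover have "f differentiable_on S" "deriv_on S f differentiable_on S" "deriv_on S (deriv_on S f) differentiable_on S"
    unfolding differentiable_on_def real_differentiable_def using D(1) dg dh by blast+
  ultimately show "solves_ode m S f" unfolding solves_ode_def by blast
qed

lemma limits_at_minus_infinityI:
  assumes a: "a > 0" and u: "unstable d f g h"
    and eq: "\<And>t. t \<le> 0 \<Longrightarrow> \<Phi> t = a * f (a * t)" "\<And>t. t \<le> 0 \<Longrightarrow> deriv_on S \<Phi> t = a\<^sup>2 * g (a * t)"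
      "\<And>t. t \<le> 0 \<Longrightarrow> deriv_on S (deriv_on S \<Phi>) t = a ^ 3 * h (a * t)"
  shows "limits_at_minus_infinity a S \<Phi>"
  unfolding limits_at_minus_infinity_def
proof (intro allI impI)
  fix \<epsilon> assume \<epsilon>: "0 < \<epsilon> \<and> \<epsilon> < a"
  have at: "filterlim (\<lambda>t. a * t) at_bot at_bot" using a by real_asymp
  have *: "((\<lambda>t. exp (- \<epsilon> * t) * v t) \<longlongrightarrow> 0) at_bot"
    if "((\<lambda>t. exp (- t) * u t) \<longlongrightarrow> d) at_bot" "\<And>t. t \<le> 0 \<Longrightarrow> v t = c * u (a * t)" for u v c
  proof -
    have "((\<lambda>t. exp (- (\<epsilon> / a) * t) * u t) \<longlongrightarrow> 0) at_bot" using a \<epsilon> by (intro decay_mult_exp[OF that(1)]) simp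
    from tendsto_mult[OF tendsto_const[of c] filterlim_compose[OF this at]]
    have "((\<lambda>t. c * (exp (- (\<epsilon> / a) * (a * t)) * u (a * t))) \<longlongrightarrow> 0) at_bot" by simp
    then show ?thesis
      by (rule Lim_transform_eventually, intro eventually_mono[OF eventually_le_at_bot[of 0]])
         (use a that(2) in simp)
  qed
  note L = unstable_lims[OF u]
  show "((\<lambda>\<tau>. exp (- \<epsilon> * \<tau>) * (\<Phi> \<tau> + a)) \<longlongrightarrow> 0) at_bot \<and>
        ((\<lambda>\<tau>. exp (- \<epsilon> * \<tau>) * deriv_on S \<Phi> \<tau>) \<longlongrightarrow> 0) at_bot \<and>
        ((\<lambda>\<tau>. exp (- \<epsilon> * \<tau>) * deriv_on S (deriv_on S \<Phi>) \<tau>) \<longlongrightarrow> 0) at_bot"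
    using *[OF L(1), of "\<lambda>t. \<Phi> t + a" a] *[OF L(2), of "deriv_on S \<Phi>" "a\<^sup>2"] *[OF L(3), of "deriv_on S (deriv_on S \<Phi>)" "a ^ 3"] eq
    by (simp add: algebra_simps)
qed

text \<open>Rescales to \<open>a = 1\<close> and uses the decay only for the single rate
  \<open>3 / 4 a\<close>. On the open half-line one-sided and two-sided derivatives agree, so both
  boundary value problems are covered.\<close>

lemma unstableI_limits:
  assumes m: "m > 1 / 2" and a: "a > 0" and s: "solves_ode m S \<Phi>" and l: "limits_at_minus_infinity a S \<Phi>"
    and S: "S = UNIV \<or> S = {..0}"
  obtains d where "ode_sol ((m - 1) / m) {..<0} (\<lambda>t. \<Phi> (t / a) / a) (\<lambda>t. deriv_on S \<Phi> (t / a) / a\<^sup>2) (\<lambda>t. deriv_on S (deriv_on S \<Phi>) (t / a) / a ^ 3)"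
    "unstable d (\<lambda>t. \<Phi> (t / a) / a) (\<lambda>t. deriv_on S \<Phi> (t / a) / a\<^sup>2) (\<lambda>t. deriv_on S (deriv_on S \<Phi>) (t / a) / a ^ 3)"
proof -
  have k: "\<bar>(m - 1) / m\<bar> \<le> 1" using m by (auto simp: abs_le_iff field_simps)
  have at: "at t within S = at t" "t \<in> S" if "t < 0" for t
    using S that at_within_open_subset[of t "{..<0}" S] by (auto simp: subset_eq)
  have "ode_sol ((m - 1) / m) {..<0} \<Phi> (deriv_on S \<Phi>) (deriv_on S (deriv_on S \<Phi>))"
    using solves_odeD[OF _ s at(2)] at(1) m unfolding ode_sol_def by auto
  moreover have set: "{t. 1 / a * t \<in> {..<0}} = {..<0}" using a by (auto simp: divide_less_0_iff)
  ultimately have sol: "ode_sol ((m - 1) / m) {..<0} (\<lambda>t. \<Phi> (t / a) / a) (\<lambda>t. deriv_on S \<Phi> (t / a) / a\<^sup>2) (\<lambda>t. deriv_on S (deriv_on S \<Phi>) (t / a) / a ^ 3)"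
    using ode_sol_scale[of "(m - 1) / m" "{..<0}" \<Phi> _ _ "1 / a"] by (simp only: set) (simp add: power_divide)
  have lim: "filterlim (\<lambda>t. t / a) at_bot at_bot" using a by real_asymp
  have *: "((\<lambda>t. exp (- (3 / 4) * t) * v t) \<longlongrightarrow> 0) at_bot"
    if "((\<lambda>t. exp (- (3 / 4 * a) * t) * u t) \<longlongrightarrow> 0) at_bot" "\<And>t. v t = u (t / a) / c" for u v c
    using tendsto_divide_zero[OF filterlim_compose[OF that(1) lim], of c] a that(2) by simp
  have "0 < 3 / 4 * a \<and> 3 / 4 * a < a" using a by simp
  then have l3: "((\<lambda>t. exp (- (3 / 4 * a) * t) * (\<Phi> t + a)) \<longlongrightarrow> 0) at_bot"
    "((\<lambda>t. exp (- (3 / 4 * a) * t) * deriv_on S \<Phi> t) \<longlongrightarrow> 0) at_bot"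
    "((\<lambda>t. exp (- (3 / 4 * a) * t) * deriv_on S (deriv_on S \<Phi>) t) \<longlongrightarrow> 0) at_bot"
    using l unfolding limits_at_minus_infinity_def by blast+
  obtain d where "unstable d (\<lambda>t. \<Phi> (t / a) / a) (\<lambda>t. deriv_on S \<Phi> (t / a) / a\<^sup>2) (\<lambda>t. deriv_on S (deriv_on S \<Phi>) (t / a) / a ^ 3)"
  proof (rule unstableI_decay[OF sol k])
    show "((\<lambda>t. exp (- (3 / 4) * t) * (\<Phi> (t / a) / a + 1)) \<longlongrightarrow> 0) at_bot"
      by (rule *[OF l3(1), where c = a]) (use a in \<open>simp add: field_simps\<close>)
    show "((\<lambda>t. exp (- (3 / 4) * t) * (deriv_on S \<Phi> (t / a) / a\<^sup>2)) \<longlongrightarrow> 0) at_bot"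
      by (rule *[OF l3(2), where c = "a\<^sup>2"]) simp
    show "((\<lambda>t. exp (- (3 / 4) * t) * (deriv_on S (deriv_on S \<Phi>) (t / a) / a ^ 3)) \<longlongrightarrow> 0) at_bot"
      by (rule *[OF l3(3), where c = "a ^ 3"]) simp
  qed blast
  then show ?thesis using sol that by blast
qed

lemma lyapunov_familyI:
  assumes m: "m > 0" and a: "a > 0" and d: "d > 0" and s: "solves_ode m UNIV \<Phi>" and eq: "\<And>t. \<Phi> t = a * f (a * t)"
    and sums: "\<And>t. d * exp t < 1 \<Longrightarrow> (\<lambda>n. lyapunov_coeff m 1 (Suc n) * (d * exp t) ^ Suc n) sums (f t + 1)"
  shows "lyapunov_family m a (a * d) UNIV \<Phi>"
  unfolding lyapunov_family_def
\<comment> \<open>The threshold is \<open>a\<close>: smallness \<open>a d exp (a \<tau>) < a\<close>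
  is the condition under which the normalized series is known to converge.\<close>
proof (intro conjI s exI[of _ a] a ballI impI)
  fix \<tau> assume "\<bar>a * d * exp (a * \<tau>)\<bar> < a"
  then have "a * (d * exp (a * \<tau>)) < a * 1" using a d by (simp add: abs_mult)
  then have "d * exp (a * \<tau>) < 1" using a by (simp only: mult_less_cancel_left_pos)
  from sums_mult[OF sums[OF this], of a]
  have 1: "(\<lambda>n. a * (lyapunov_coeff m 1 (Suc n) * (d * exp (a * \<tau>)) ^ Suc n)) sums (\<Phi> \<tau> + a)"
    by (simp add: eq algebra_simps)
  have 2: "a * (lyapunov_coeff m 1 (Suc n) * (d * exp (a * \<tau>)) ^ Suc n)
      = lyapunov_coeff m a (Suc n) * (a * d) ^ Suc n * exp (real (Suc n) * a * \<tau>)" for n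
  proof -
    have "exp (real (Suc n) * a * \<tau>) = exp (a * \<tau>) ^ Suc n" by (simp only: exp_of_nat_mult[symmetric] mult.assoc)
    moreover have "lyapunov_coeff m 1 (Suc n) = lyapunov_coeff m a (Suc n) * a ^ n"
      using lyapunov_coeff_scale[OF a, of "Suc n" m] by simp
    ultimately show ?thesis by (simp only: power_mult_distrib power_Suc[of a] mult_ac)
  qed
  show "(\<lambda>n. lyapunov_coeff m a (Suc n) * (a * d) ^ Suc n * exp (real (Suc n) * a * \<tau>)) sums (\<Phi> \<tau> + a)"
    using 1 unfolding 2 .
qed

section \<open>The asymptotic expansion\<close>

text \<open>Chain rule with \<open>\<xi>' = x powr m\<close>. The formulas \<open>g\<close> and
  \<open>h\<close> are the resulting derivatives, and the third one contains \<open>v'''\<close>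
  with the factor \<open>x powr (4 * m)\<close>, through which the equation for \<open>v\<close>
  becomes the one for the product.\<close>

lemma v_par_solution:
  assumes m: "m > 1 / 2" and v: "is_v_par m b v"
  obtains X g h where "X \<ge> 1" "ode_sol ((m - 1) / m) {X<..} (\<lambda>x. x powr m * (b + v (x powr (m + 1) / (m + 1)))) g h"
proof -
  have m0: "m > 0" using m by simp
  obtain \<xi>0 where \<xi>0: "\<And>\<xi>. \<xi> > \<xi>0 \<Longrightarrow> v differentiable at \<xi> \<and> deriv v differentiable at \<xi> \<and>
        deriv (deriv v) differentiable at \<xi> \<and> v_equation_at m b v \<xi>"
    using v unfolding is_v_par_def by blast
  define \<xi> where "\<xi> = (\<lambda>x::real. x powr (m + 1) / (m + 1))"
  have "filterlim \<xi> at_top at_top" unfolding \<xi>_def using m0 by real_asymp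
  then have "eventually (\<lambda>x. \<xi> x > \<xi>0) at_top" by (simp add: filterlim_at_top_dense)
  then obtain X0 where X0: "\<And>x. x \<ge> X0 \<Longrightarrow> \<xi> x > \<xi>0" unfolding eventually_at_top_linorder by blast
  define X where "X = max 1 X0"
  define V1 V2 V3 where "V1 = (\<lambda>x. deriv v (\<xi> x))" and "V2 = (\<lambda>x. deriv (deriv v) (\<xi> x))" and "V3 = (\<lambda>x. deriv (deriv (deriv v)) (\<xi> x))"
  define w where "w = (\<lambda>x. b + v (\<xi> x))"
  define f where "f = (\<lambda>x. x powr m * w x)"
  define g where "g = (\<lambda>x. m * x powr (m - 1) * w x + x powr (2 * m) * V1 x)"
  define h where "h = (\<lambda>x. m * (m - 1) * x powr (m - 2) * w x + 3 * m * x powr (2 * m - 1) * V1 x + x powr (3 * m) * V2 x)"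
  have "ode_sol ((m - 1) / m) {X<..} f g h"
    unfolding ode_sol_def
  proof
    fix x assume "x \<in> {X<..}"
    then have x: "x > 0" "\<xi> x > \<xi>0" using X0[of x] by (auto simp: X_def)
    define y where "y = x powr m"
    have y: "y > 0" using x by (simp add: y_def)
    \<comment> \<open>All powers are expressed by \<open>y = x powr m\<close> and \<open>x\<close>,
      so that the remaining identities are rational in \<open>x\<close> and
      \<open>y\<close>.\<close>
    have R: "x powr m = y" "x powr (m - 1) = y / x" "x powr (m - 2) = y / x\<^sup>2" "x powr (m - 3) = y / x ^ 3"
      "x powr (2 * m) = y\<^sup>2" "x powr (2 * m - 1) = y\<^sup>2 / x" "x powr (2 * m - 2) = y\<^sup>2 / x\<^sup>2"
      "x powr (3 * m) = y ^ 3" "x powr (3 * m - 1) = y ^ 3 / x" "x powr (m + 1) = y * x"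
      using x powr_power[of x m 2] powr_power[of x m 3] by (simp_all add: y_def powr_diff powr_add powr_numeral mult.commute)
    have d\<xi>: "(\<xi> has_real_derivative y) (at x)"
      unfolding \<xi>_def y_def using x m0
      by (intro DERIV_cong[OF DERIV_cdivide[OF has_real_derivative_powr[OF x(1)]]]) simp
    note v' = \<xi>0[OF x(2)]
    have dw: "(w has_real_derivative V1 x * y) (at x)"
      unfolding w_def V1_def using v' DERIV_chain2[OF _ d\<xi>, of v] DERIV_deriv_iff_real_differentiable[of v "\<xi> x"]
      by (auto intro!: derivative_eq_intros)
    have d1: "(V1 has_real_derivative V2 x * y) (at x)" and d2: "(V2 has_real_derivative V3 x * y) (at x)"
      unfolding V1_def V2_def V3_def using v' DERIV_chain2[OF _ d\<xi>] DERIV_deriv_iff_real_differentiable by blast+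
    have P: "((\<lambda>x. x powr p) has_real_derivative p * x powr (p - 1)) (at x)" for p
      by (rule has_real_derivative_powr[OF x(1)])
    have f: "(f has_real_derivative g x) (at x)"
      unfolding f_def by (rule DERIV_cong[OF DERIV_mult[OF P dw]])
        (use x y in \<open>simp add: g_def R; simp add: field_simps power2_eq_square\<close>)
    have g: "(g has_real_derivative h x) (at x)"
      unfolding g_def by (rule DERIV_cong[OF DERIV_add[OF DERIV_mult[OF DERIV_cmult[OF P] dw] DERIV_mult[OF P d1]]])
        (use x y in \<open>simp add: h_def R; simp add: field_simps eval_nat_numeral\<close>)
    have "(m + 1) * \<xi> x = y * x" using m0 by (simp add: \<xi>_def R)
    \<comment> \<open>The coefficients of the equation for \<open>v\<close> contain
      \<open>\<xi>\<close> only through powers of \<open>(m + 1) \<xi>\<close>, which is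
      \<open>y x\<close>.\<close>
    then have M: "(m + 1) * \<xi> x = y * x" "(m + 1)\<^sup>2 * (\<xi> x)\<^sup>2 = (y * x)\<^sup>2" "(m + 1) ^ 3 * (\<xi> x) ^ 3 = (y * x) ^ 3"
      by (simp_all only: power_mult_distrib[symmetric])
    have "V3 x + (6 * m / (y * x) + b) * V2 x + ((7 * m - 4) * m / (y * x)\<^sup>2 + (m + 2) * b / (y * x)) * V1 x
       + m * (m - 1) * (m - 2) / (y * x) ^ 3 * v (\<xi> x) + m * (m - 1) * (m - 2) * b / (y * x) ^ 3
       = - v (\<xi> x) * V2 x - (m + 2) / (y * x) * v (\<xi> x) * V1 x + (m - 1) / m * (V1 x)\<^sup>2"
      using v' unfolding v_equation_at_def M V1_def V2_def V3_def by blast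
    then have V3: "V3 x = - v (\<xi> x) * V2 x - (m + 2) / (y * x) * v (\<xi> x) * V1 x + (m - 1) / m * (V1 x)\<^sup>2
       - ((6 * m / (y * x) + b) * V2 x + ((7 * m - 4) * m / (y * x)\<^sup>2 + (m + 2) * b / (y * x)) * V1 x
       + m * (m - 1) * (m - 2) / (y * x) ^ 3 * v (\<xi> x) + m * (m - 1) * (m - 2) * b / (y * x) ^ 3)" by simp
    have "(h has_real_derivative m * (m - 1) * (m - 2) * (y / x ^ 3) * w x + (7 * m - 4) * m * (y\<^sup>2 / x\<^sup>2) * V1 x
       + 6 * m * (y ^ 3 / x) * V2 x + y ^ 4 * V3 x) (at x)"
      unfolding h_def
      by (rule DERIV_cong[OF DERIV_add[OF DERIV_add[OF DERIV_mult[OF DERIV_cmult[OF P] dw] DERIV_mult[OF DERIV_cmult[OF P] d1]] DERIV_mult[OF P d2]]])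
        (use x y in \<open>simp add: R; simp add: field_simps eval_nat_numeral\<close>)
    moreover have "m * (m - 1) * (m - 2) * (y / x ^ 3) * w x + (7 * m - 4) * m * (y\<^sup>2 / x\<^sup>2) * V1 x
       + 6 * m * (y ^ 3 / x) * V2 x + y ^ 4 * V3 x = (m - 1) / m * (g x)\<^sup>2 - f x * h x"
      unfolding V3 g_def f_def h_def w_def R using x y m0
      by (simp add: divide_simps) (simp add: algebra_simps eval_nat_numeral)
    ultimately have h: "(h has_real_derivative (m - 1) / m * (g x)\<^sup>2 - f x * h x) (at x)" by (rule DERIV_cong)
    show "(f has_real_derivative g x) (at x) \<and> (g has_real_derivative h x) (at x) \<and>
      (h has_real_derivative (m - 1) / m * (g x)\<^sup>2 - f x * h x) (at x)" using f g h by blast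
  qed
  moreover have "f = (\<lambda>x. x powr m * (b + v (x powr (m + 1) / (m + 1))))" by (simp add: f_def w_def \<xi>_def)
  moreover have "X \<ge> 1" by (simp add: X_def)
  ultimately show ?thesis using that by blast
qed

text \<open>One term of the series is enough for the exponent: multiplied by
  \<open>x powr m\<close>, the term in \<open>1 / \<xi>\<close> is of order \<open>1 / x\<close> and
  integrates to a logarithm, while the remainder is of order \<open>x powr (- m - 2)\<close> and has
  a convergent primitive.\<close>

lemma v_par_first_order:
  assumes "is_v_par m b v"
  obtains c where "eventually (\<lambda>\<xi>. \<bar>v \<xi> - (- (m - 1) * (m - 2) / (m + 1)\<^sup>2) / \<xi>\<bar> \<le> c * (1 / \<xi>\<^sup>2)) at_top"
proof -
  obtain V where V: "formal_v_series m b V"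
    "\<And>n. (\<lambda>\<xi>. v \<xi> - (\<Sum>k=1..n. fps_nth V k / \<xi> ^ k)) \<in> O[at_top](\<lambda>\<xi>. 1 / \<xi> ^ Suc n)"
    using assms unfolding is_v_par_def by blast
  have "fps_nth V 1 = - (m - 1) * (m - 2) / (m + 1)\<^sup>2" using V(1) unfolding formal_v_series_def by blast
  then have "(\<lambda>\<xi>. v \<xi> - (- (m - 1) * (m - 2) / (m + 1)\<^sup>2) / \<xi>) \<in> O[at_top](\<lambda>\<xi>. 1 / \<xi>\<^sup>2)"
    using V(2)[of 1] by (simp add: power2_eq_square)
  then obtain c where "eventually (\<lambda>\<xi>. norm (v \<xi> - (- (m - 1) * (m - 2) / (m + 1)\<^sup>2) / \<xi>) \<le> c * norm (1 / \<xi>\<^sup>2)) at_top"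
    by (rule landau_o.bigE)
  then show ?thesis using that[of c] by simp
qed

text \<open>The solution is compared with the one built from \<open>v\<close>, which has the same
  growth. The comparison supplies the shift and the small mode; it remains to rewrite
  \<open>exp (- F)\<close> for a primitive \<open>F\<close> of the second solution.\<close>

lemma growing_solution_expansion:
  fixes m b :: real and v :: "real \<Rightarrow> real"
  assumes m: "m > 1 / 2" and b: "b > 0" and s: "ode_sol ((m - 1) / m) {T<..} \<Phi> \<Phi>' \<Phi>''"
    and lim: "((\<lambda>t. \<Phi> t / t powr m) \<longlongrightarrow> b) at_top" and v: "is_v_par m b v"
  shows "\<exists>D \<tau>\<^sub>s r. (r \<longlongrightarrow> 0) at_top \<and>
     eventually (\<lambda>\<tau>. \<Phi> \<tau> = (\<tau> + \<tau>\<^sub>s) powr m *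
       (b + v ((\<tau> + \<tau>\<^sub>s) powr (m + 1) / (m + 1))
          + D * (\<tau> + \<tau>\<^sub>s) powr ((- 4 * m\<^sup>2 - 6 * m + 4) / (m + 1))
              * exp (- (b * (\<tau> + \<tau>\<^sub>s) powr (m + 1) / (m + 1)))
              * (1 + r \<tau>))) at_top"
proof -
  define k where "k = (m - 1) / m"
  have m0: "m > 0" using m by simp
  define \<psi> where "\<psi> = (\<lambda>x. x powr m * (b + v (x powr (m + 1) / (m + 1))))"
  obtain X \<psi>1 \<psi>2 where X: "X \<ge> 1" and \<psi>: "ode_sol k {X<..} \<psi> \<psi>1 \<psi>2"
    using v_par_solution[OF m v] unfolding \<psi>_def k_def by blast
  define \<xi> where "\<xi> = (\<lambda>x::real. x powr (m + 1) / (m + 1))"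
  have \<xi>top: "filterlim \<xi> at_top at_top" unfolding \<xi>_def using m0 by real_asymp
  have "(v \<longlongrightarrow> 0) at_top" using v unfolding is_v_par_def by blast
  from tendsto_add[OF tendsto_const[of b] filterlim_compose[OF this \<xi>top]]
  have "((\<lambda>x. b + v (\<xi> x)) \<longlongrightarrow> b) at_top" by simp
  then have l2: "((\<lambda>x. \<psi> x / x powr m) \<longlongrightarrow> b) at_top"
    by (rule Lim_transform_eventually)
       (rule eventually_mono[OF eventually_gt_at_top[of 0]], simp add: \<psi>_def \<xi>_def)
  obtain F where F: "\<And>t. t > X \<Longrightarrow> (F has_real_derivative \<psi> t) (at t)"
    using antiderivative_exists[of X \<psi>] DERIV_isCont[OF ode_solD(1)[OF \<psi>]] by auto
  \<comment> \<open>\<open>p / x\<close> is the contribution of the first coefficient of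
    \<open>v\<close>: \<open>x powr m\<close> times that coefficient over
    \<open>\<xi>\<close>.\<close>
  define p where "p = - (m - 1) * (m - 2) / (m + 1)"
  \<comment> \<open>Convergence of \<open>\<rho>\<close> says that \<open>exp (- F)\<close> is
    asymptotically a constant times \<open>exp (- b \<xi>) x powr (- p)\<close>.\<close>
  define \<rho> where "\<rho> = (\<lambda>x. F x - b * \<xi> x - p * ln x)"
  obtain c where "eventually (\<lambda>\<xi>. \<bar>v \<xi> - (- (m - 1) * (m - 2) / (m + 1)\<^sup>2) / \<xi>\<bar> \<le> c * (1 / \<xi>\<^sup>2)) at_top"
    by (rule v_par_first_order[OF v])
  then have "eventually (\<lambda>x. \<bar>v (\<xi> x) - (- (m - 1) * (m - 2) / (m + 1)\<^sup>2) / \<xi> x\<bar> \<le> c * (1 / (\<xi> x)\<^sup>2)) at_top"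
    by (rule eventually_compose_filterlim[OF _ \<xi>top])
  from eventually_conj[OF this eventually_gt_at_top[of X]]
  obtain X1 where X1: "\<And>x. x \<ge> X1 \<Longrightarrow> \<bar>v (\<xi> x) - (- (m - 1) * (m - 2) / (m + 1)\<^sup>2) / \<xi> x\<bar> \<le> c * (1 / (\<xi> x)\<^sup>2) \<and> x > X"
    unfolding eventually_at_top_linorder by blast
  define C where "C = \<bar>c\<bar> * (m + 1)\<^sup>2"
  obtain \<rho>0 where \<rho>0: "(\<rho> \<longlongrightarrow> \<rho>0) at_top"
  proof (rule dominated_derivative_convergent_at_top[of X1 \<rho> "\<lambda>x. \<psi> x - b * x powr m - p * (1 / x)"
        "\<lambda>x. - (C / (m + 1)) * x powr (- m - 1)" "\<lambda>x. C * x powr (- m - 2)" 0])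
    fix x assume x1: "X1 \<le> x"
    then have x: "x > X" "x > 0" using X1[of x] X by auto
    have d\<xi>: "(\<xi> has_real_derivative x powr m) (at x)"
      unfolding \<xi>_def using m0
      by (intro DERIV_cong[OF DERIV_cdivide[OF has_real_derivative_powr[OF x(2)]]]) simp
    show "(\<rho> has_real_derivative \<psi> x - b * x powr m - p * (1 / x)) (at x)"
      unfolding \<rho>_def using x by (intro DERIV_diff F DERIV_cmult d\<xi> DERIV_ln_divide)
    show "((\<lambda>x. - (C / (m + 1)) * x powr (- m - 1)) has_real_derivative C * x powr (- m - 2)) (at x)"
      by (rule DERIV_cong[OF DERIV_cmult[OF has_real_derivative_powr[OF x(2)]]]) (use m0 in \<open>simp add: field_simps\<close>)
    have \<xi>x: "\<xi> x = x powr m * x / (m + 1)" using x by (simp add: \<xi>_def powr_add)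
    have "\<psi> x - b * x powr m - p * (1 / x) = x powr m * (v (\<xi> x) - (- (m - 1) * (m - 2) / (m + 1)\<^sup>2) / \<xi> x)"
    proof -
      have "x powr m * ((- (m - 1) * (m - 2) / (m + 1)\<^sup>2) / \<xi> x) = p * (1 / x)"
        unfolding \<xi>x p_def using x m0 by (simp add: divide_simps) (simp add: power2_eq_square algebra_simps)
      moreover have "\<psi> x = x powr m * b + x powr m * v (\<xi> x)" by (simp add: \<psi>_def \<xi>_def distrib_left)
      ultimately show ?thesis by (simp only: right_diff_distrib) simp
    qed
    then have "\<bar>\<psi> x - b * x powr m - p * (1 / x)\<bar> = x powr m * \<bar>v (\<xi> x) - (- (m - 1) * (m - 2) / (m + 1)\<^sup>2) / \<xi> x\<bar>"
      by (simp add: abs_mult)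
    also have "\<dots> \<le> x powr m * (\<bar>c\<bar> * (1 / (\<xi> x)\<^sup>2))"
    proof (rule mult_left_mono)
      have "c * (1 / (\<xi> x)\<^sup>2) \<le> \<bar>c\<bar> * (1 / (\<xi> x)\<^sup>2)" by (intro mult_right_mono) auto
      then show "\<bar>v (\<xi> x) - (- (m - 1) * (m - 2) / (m + 1)\<^sup>2) / \<xi> x\<bar> \<le> \<bar>c\<bar> * (1 / (\<xi> x)\<^sup>2)"
        using X1[OF x1] by linarith
    qed simp
    also have "\<dots> = C * x powr (- m - 2)"
    proof -
      have e: "x powr (- m - 2) = 1 / (x powr m * x\<^sup>2)" using x by (simp add: powr_diff powr_minus powr_numeral divide_inverse)
      show ?thesis unfolding \<xi>x C_def e using x m0 by (simp add: power_divide power_mult_distrib power2_eq_square)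
    qed
    finally show "\<bar>\<psi> x - b * x powr m - p * (1 / x)\<bar> \<le> C * x powr (- m - 2)" .
    show "- (C / (m + 1)) * x powr (- m - 1) \<le> 0" using m0 by (simp add: C_def)
  qed blast
  show ?thesis
  proof (rule compare_growing_solutions[OF m k_def b s[folded k_def] lim \<psi> l2 F])
    \<comment> \<open>Without a small mode the expansion holds with \<open>D = 0\<close> and
      remainder \<open>0\<close>. In the other case \<open>D\<close> is nonzero, so the remainder
      \<open>r\<close> can be defined by division.\<close>
    fix c assume eq: "eventually (\<lambda>t. \<Phi> t = \<psi> (t + c)) at_top"
    show ?thesis
      by (rule exI[of _ 0], rule exI[of _ c], rule exI[of _ "\<lambda>_. 0"], intro conjI tendsto_const)
         (use eq in \<open>simp add: \<psi>_def\<close>)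
  next
    fix c D assume D: "D \<noteq> 0"
      "((\<lambda>t. (\<Phi> t - \<psi> (t + c)) * exp (F (t + c)) * (t + c) powr (4 * m - 2)) \<longlongrightarrow> D) at_top"
    define \<gamma> where "\<gamma> = (- 4 * m\<^sup>2 - 6 * m + 4) / (m + 1)"
    define D0 where "D0 = D * exp (- \<rho>0)"
    have D0: "D0 \<noteq> 0" using D by (simp add: D0_def)
    define Q where "Q = (\<lambda>t. (t + c) powr m * (t + c) powr \<gamma> * exp (- (b * (t + c) powr (m + 1) / (m + 1))))"
    define r where "r = (\<lambda>t. (\<Phi> t - \<psi> (t + c)) / (D0 * Q t) - 1)"
    have ctop: "filterlim (\<lambda>t. t + c) at_top at_top" by real_asymp
    \<comment> \<open>The exponent of the statement: the prefactor contributes \<open>m\<close>, so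
      \<open>\<gamma>\<close> has to make up the rest of the logarithmic part \<open>- p\<close> and
      the algebraic part \<open>- (4 * m - 2)\<close>.\<close>
    have \<gamma>: "m + \<gamma> = - p - (4 * m - 2)"
      unfolding \<gamma>_def p_def using m0 by (simp add: field_simps power2_eq_square)
    have "((\<lambda>t. (\<Phi> t - \<psi> (t + c)) * exp (F (t + c)) * (t + c) powr (4 * m - 2) * exp (- \<rho> (t + c))) \<longlongrightarrow> D0) at_top"
      unfolding D0_def by (intro tendsto_mult D tendsto_exp tendsto_minus filterlim_compose[OF \<rho>0 ctop])
    then have "((\<lambda>t. (\<Phi> t - \<psi> (t + c)) / Q t) \<longlongrightarrow> D0) at_top"
    proof (rule Lim_transform_eventually)
      show "eventually (\<lambda>t. (\<Phi> t - \<psi> (t + c)) * exp (F (t + c)) * (t + c) powr (4 * m - 2) * exp (- \<rho> (t + c)) = (\<Phi> t - \<psi> (t + c)) / Q t) at_top"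
        using eventually_gt_at_top[of "- c"]
      proof eventually_elim
        case (elim t)
        then have t: "t + c > 0" by simp
        have e: "exp (F (t + c)) * exp (- \<rho> (t + c)) = exp (b * \<xi> (t + c)) * (t + c) powr p"
          using t by (simp add: \<rho>_def exp_add[symmetric] powr_def)
        have "Q t = (t + c) powr (m + \<gamma>) * exp (- (b * \<xi> (t + c)))"
          using t by (simp add: Q_def \<xi>_def powr_add)
        also have "\<dots> = 1 / ((t + c) powr p * (t + c) powr (4 * m - 2) * exp (b * \<xi> (t + c)))"
          unfolding \<gamma> using t by (simp add: powr_diff powr_minus powr_add exp_minus field_simps)
        finally have Q: "1 / Q t = exp (b * \<xi> (t + c)) * (t + c) powr p * (t + c) powr (4 * m - 2)" by simp
        have "(\<Phi> t - \<psi> (t + c)) * exp (F (t + c)) * (t + c) powr (4 * m - 2) * exp (- \<rho> (t + c))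
          = (\<Phi> t - \<psi> (t + c)) * ((exp (F (t + c)) * exp (- \<rho> (t + c))) * (t + c) powr (4 * m - 2))" by (simp only: mult_ac)
        also have "\<dots> = (\<Phi> t - \<psi> (t + c)) * (1 / Q t)" unfolding e Q ..
        finally show ?case by simp
      qed
    qed
    from tendsto_diff[OF tendsto_divide[OF this tendsto_const[of D0] D0] tendsto_const[of 1]]
    have "(r \<longlongrightarrow> 0) at_top" using D0 by (simp add: r_def mult.commute)
    moreover have "eventually (\<lambda>\<tau>. \<Phi> \<tau> = (\<tau> + c) powr m *
       (b + v ((\<tau> + c) powr (m + 1) / (m + 1)) + D0 * (\<tau> + c) powr \<gamma> * exp (- (b * (\<tau> + c) powr (m + 1) / (m + 1))) * (1 + r \<tau>))) at_top"
      using eventually_gt_at_top[of "- c"]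
    proof eventually_elim
      case (elim t)
      then have "Q t > 0" by (simp add: Q_def)
      then have "\<Phi> t = \<psi> (t + c) + D0 * Q t * (1 + r t)" using D0 by (simp add: r_def)
      then show ?case by (simp add: \<psi>_def Q_def algebra_simps)
    qed
    ultimately show ?thesis unfolding \<gamma>_def by blast
  qed auto
qed

section \<open>The boundary value problems\<close>

text \<open>On the right half-line \<open>J >= J 0 > 0\<close>, so its primitive
  \<open>g + f^2 / 2\<close> grows at least linearly; with \<open>g < f + 1\<close> this becomes a
  linear lower bound on \<open>f + 1 + f^2 / 2\<close>.\<close>

lemma unstable_global_growth:
  assumes k: "- 1 < k" "k < 1" and s: "ode_sol k UNIV f g h" and u: "unstable d f g h" "d > 0" and f0: "f 0 = 0"
  shows "filterlim f at_top at_top"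
proof -
  note D = ode_solD[OF s UNIV_I]
  have P: "g t > 0" "h t + f t * g t > 0" "g t < f t + 1" for t
    using unstable_positive_branch[OF ode_sol_subset[OF s, of "{..<t + 1}"] u(1) k u(2), of t] by auto
  define J where "J = (\<lambda>t. h t + f t * g t)"
  have J0: "J 0 > 0" using P by (simp add: J_def)
  have J: "J t \<ge> J 0" if "t \<ge> 0" for t
  proof (rule DERIV_nonneg_imp_nondecreasing[OF that])
    fix x
    have "(J has_real_derivative (1 + k) * (g x)\<^sup>2) (at x)"
      unfolding J_def by (auto intro!: derivative_eq_intros D simp: power2_eq_square algebra_simps)
    then show "\<exists>y. (J has_real_derivative y) (at x) \<and> 0 \<le> y" using k by (intro exI conjI) auto
  qed
  have fnn: "f t \<ge> 0" if "t \<ge> 0" for t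
  proof -
    have "f 0 \<le> f t"
    proof (rule DERIV_nonneg_imp_nondecreasing[OF that])
      fix x show "\<exists>y. (f has_real_derivative y) (at x) \<and> 0 \<le> y" using D(1)[of x] P(1)[of x] by (auto intro: less_imp_le)
    qed
    then show ?thesis by (simp add: f0)
  qed
  have low: "g t + (f t)\<^sup>2 / 2 - J 0 * t \<ge> g 0 + (f 0)\<^sup>2 / 2 - J 0 * 0" if "t \<ge> 0" for t
  proof (rule DERIV_nonneg_imp_nondecreasing[of 0 t "\<lambda>t. g t + (f t)\<^sup>2 / 2 - J 0 * t", OF that])
    fix x :: real assume x: "0 \<le> x"
    have "((\<lambda>t. g t + (f t)\<^sup>2 / 2 - J 0 * t) has_real_derivative J x - J 0) (at x)"
      unfolding J_def by (auto intro!: derivative_eq_intros D)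
    then show "\<exists>y. ((\<lambda>t. g t + (f t)\<^sup>2 / 2 - J 0 * t) has_real_derivative y) (at x) \<and> 0 \<le> y"
      using J[OF x] by (intro exI[of _ "J x - J 0"]) simp
  qed
  show ?thesis
    unfolding filterlim_at_top
  proof
    fix Z :: real
    define Y where "Y = \<bar>Z\<bar>"
    show "eventually (\<lambda>t. Z \<le> f t) at_top"
      using eventually_gt_at_top[of "(Y + 1 + Y\<^sup>2 / 2) / J 0"] eventually_ge_at_top[of 0]
    proof eventually_elim
      case (elim t)
      have "Y + 1 + Y\<^sup>2 / 2 < J 0 * t" using elim(1) J0 by (simp add: divide_less_eq mult.commute)
      moreover have "J 0 * t < f t + 1 + (f t)\<^sup>2 / 2" using low[OF elim(2)] P(1)[of 0] P(3)[of t] by (simp add: f0)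
      moreover have "(f t)\<^sup>2 \<le> Y\<^sup>2" if "f t \<le> Y" using that fnn[OF elim(2)] by (intro power_mono) auto
      ultimately have "\<not> f t \<le> Y" by fastforce
      then show ?case by (simp add: Y_def)
    qed
  qed
qed

lemma scaled_power_limit:
  fixes f :: "real \<Rightarrow> real"
  assumes a: "a > 0" and l: "((\<lambda>t. f t / t powr m) \<longlongrightarrow> b) at_top"
  shows "((\<lambda>t. a * f (a * t) / t powr m) \<longlongrightarrow> a powr (m + 1) * b) at_top"
proof -
  have "filterlim (\<lambda>t. a * t) at_top at_top" using a by real_asymp
  from tendsto_mult[OF tendsto_const[of "a powr (m + 1)"] filterlim_compose[OF l this]]
  show ?thesis
  proof (rule Lim_transform_eventually)
    show "eventually (\<lambda>t. a powr (m + 1) * (f (a * t) / (a * t) powr m) = a * f (a * t) / t powr m) at_top"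
      using eventually_gt_at_top[of 0]
      by eventually_elim (use a in \<open>simp add: powr_mult powr_add field_simps\<close>)
  qed
qed

text \<open>With \<open>A' = f\<close> the derivative of \<open>h exp A\<close> is
  \<open>k g^2 exp A\<close>, nonnegative for \<open>k >= 0\<close>, that is for
  \<open>m >= 1\<close>. To the left of \<open>0\<close> convexity comes from \<open>J > 0\<close>
  and \<open>f <= 0\<close> instead, for every \<open>m > 1 / 2\<close>.\<close>

lemma convex_right_branch:
  assumes k: "0 \<le> k" and s: "ode_sol k UNIV f g h" and h0: "h 0 > 0" and t: "t \<ge> 0"
  shows "h t > 0"
proof -
  note D = ode_solD[OF s UNIV_I]
  obtain A where A: "\<And>t. t > - 1 \<Longrightarrow> (A has_real_derivative f t) (at t)"
    using antiderivative_exists[of "- 1" f] DERIV_isCont[OF D(1)] by auto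
  have "0 < h 0 * exp (A 0)" using h0 by simp
  also have "\<dots> \<le> h t * exp (A t)"
  proof (rule DERIV_nonneg_imp_nondecreasing[of 0 t "\<lambda>t. h t * exp (A t)", OF t])
    fix x :: real assume "0 \<le> x"
    then have "((\<lambda>t. h t * exp (A t)) has_real_derivative k * (g x)\<^sup>2 * exp (A x)) (at x)"
      by (auto intro!: derivative_eq_intros D A simp: algebra_simps)
    then show "\<exists>y. ((\<lambda>t. h t * exp (A t)) has_real_derivative y) (at x) \<and> 0 \<le> y"
      using k by (intro exI[of _ "k * (g x)\<^sup>2 * exp (A x)"]) simp
  qed
  finally show ?thesis by (simp add: zero_less_mult_iff)
qed

text \<open>The whole-line solution is the rescaled normalized one, with \<open>a\<close> fixed by
  \<open>a powr (m + 1) * b1 = b\<close>. Convexity is split at \<open>m = 1\<close> because of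
  \<open>not_convex_if_sublinear\<close>. The expansion is claimed for each admissible
  \<open>v_par\<close>, with constants that may depend on the choice.\<close>

theorem theorem4p1:
  fixes m :: real
  assumes "m > 1 / 2"
  shows
    "\<exists>\<Phi>\<^sub>1 d\<^sub>1 b\<^sub>1.
       \<comment> \<open>(iii), the normalized problem\<close>
       half_line_problem m 1 \<Phi>\<^sub>1 \<and>
       (\<forall>\<Psi>. half_line_problem m 1 \<Psi> \<longrightarrow> (\<forall>\<tau>\<le>0. \<Psi> \<tau> = \<Phi>\<^sub>1 \<tau>)) \<and>
       solves_ode m UNIV \<Phi>\<^sub>1 \<and>
       lyapunov_family m 1 d\<^sub>1 UNIV \<Phi>\<^sub>1 \<and>
       ((\<lambda>\<tau>. \<Phi>\<^sub>1 \<tau> / \<tau> powr m) \<longlongrightarrow> b\<^sub>1) at_top \<and> b\<^sub>1 > 0 \<and>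
       (\<forall>b>0. \<exists>a \<Phi>.
          whole_line_problem m b a \<Phi> \<and>
          (\<forall>a' \<Phi>'. whole_line_problem m b a' \<Phi>' \<longrightarrow> a' = a \<and> \<Phi>' = \<Phi>) \<and>
          (\<exists>d>0.
             \<comment> \<open>(i)\<close>
             convex_on {..0} \<Phi> \<and> (m \<ge> 1 \<longrightarrow> convex_on UNIV \<Phi>) \<and>
             strict_mono \<Phi> \<and>
             lyapunov_family m a d UNIV \<Phi> \<and>
             (\<forall>\<tau>\<le>0. a * (exp (a * \<tau>) - 1) \<le> \<Phi> \<tau> \<and> \<Phi> \<tau> \<le> a * tanh (a * \<tau> / 2)) \<and>
             (\<forall>\<tau>>0. a * tanh (a * \<tau> / 2) < \<Phi> \<tau> \<and> \<Phi> \<tau> < a * (exp (a * \<tau>) - 1)) \<and>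
             \<comment> \<open>(ii)\<close>
             (\<forall>v_par. is_v_par m b v_par \<longrightarrow>
                (\<exists>D \<tau>\<^sub>s r. (r \<longlongrightarrow> 0) at_top \<and>
                   eventually (\<lambda>\<tau>. \<Phi> \<tau> = (\<tau> + \<tau>\<^sub>s) powr m *
                     (b + v_par ((\<tau> + \<tau>\<^sub>s) powr (m + 1) / (m + 1))
                        + D * (\<tau> + \<tau>\<^sub>s) powr ((- 4 * m\<^sup>2 - 6 * m + 4) / (m + 1))
                            * exp (- (b * (\<tau> + \<tau>\<^sub>s) powr (m + 1) / (m + 1)))
                            * (1 + r \<tau>))) at_top)) \<and>
             \<comment> \<open>(iii), the scaling\<close>
             a = (b / b\<^sub>1) powr (1 / (m + 1)) \<and>
             (\<forall>\<tau>. \<Phi> \<tau> = a * \<Phi>\<^sub>1 (a * \<tau>)) \<and>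
             d = a * d\<^sub>1))"
proof -
  note m = assms
  have m0: "m > 0" using m by simp
  define k where "k = (m - 1) / m"
  have k: "- 1 < k" "k < 1" using m by (auto simp: k_def field_simps)
  obtain f g h d1 where s: "ode_sol k UNIV f g h" and u: "unstable d1 f g h" and d1: "d1 > 0" and f0: "f 0 = 0"
    and sums: "\<And>t. d1 * exp t < 1 \<Longrightarrow> (\<lambda>n. lyapunov_coeff m 1 (Suc n) * (d1 * exp t) ^ Suc n) sums (f t + 1)"
    by (rule normalized_solution[OF m k_def]) blast
  note P = unstable_positive_branch[OF ode_sol_subset[OF s subset_UNIV] u k d1]
  have gp: "g t > 0" and Jp: "h t + f t * g t > 0" for t using P(1)[of t "t + 1"] P(2)[of t "t + 1"] by auto
  have ftop: "filterlim f at_top at_top" by (rule unstable_global_growth[OF k s u d1 f0])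
  have s0: "ode_sol k {T<..} f g h" for T by (rule ode_sol_subset[OF s]) auto
  obtain H where H: "H > 0" "((\<lambda>t. g t * f t powr (- k)) \<longlongrightarrow> H) at_top"
    by (rule ode_sol_growth[OF k s0[of 0] ftop]) blast
  define b1 where "b1 = (H / m) powr m"
  have b1: "b1 > 0" using H m0 by (simp add: b1_def)
  have lim1: "((\<lambda>t. f t / t powr m) \<longlongrightarrow> b1) at_top"
    unfolding b1_def by (rule power_growth(1)[OF m k_def s0[of 0] ftop H(2,1)])
  have half_nb: "at t within {..0} \<noteq> bot" if "t \<in> {..(0::real)}" for t using at_within_atMost_nontrivial that by simp
  have UNIV_nb: "at t within UNIV \<noteq> bot" for t :: real by simp
  note half = solves_odeI[OF m0 s[unfolded k_def] half_nb]
  have half_prob: "half_line_problem m 1 f"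
    unfolding half_line_problem_def
    using half f0 by (auto intro!: limits_at_minus_infinityI[OF _ u])
  \<comment> \<open>Serves both problems: \<open>S = {..0}\<close> with \<open>a = 1\<close> for the
    half-line, and \<open>S = UNIV\<close> with arbitrary \<open>a\<close> for the whole line.
    One-sided continuity at \<open>0\<close> supplies the limit that \<open>half_line_unique\<close>
    needs.\<close>
  have uniq: "\<Phi> t = a * f (a * t)" if a: "a > 0" and so: "solves_ode m S \<Phi>" and li: "limits_at_minus_infinity a S \<Phi>"
    and \<Phi>0: "\<Phi> 0 = 0" and S: "S = UNIV \<or> S = {..0}" and t: "t < 0" for a S \<Phi> t
  proof -
    obtain d where d: "ode_sol k {..<0} (\<lambda>t. \<Phi> (t / a) / a) (\<lambda>t. deriv_on S \<Phi> (t / a) / a\<^sup>2) (\<lambda>t. deriv_on S (deriv_on S \<Phi>) (t / a) / a ^ 3)"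
      "unstable d (\<lambda>t. \<Phi> (t / a) / a) (\<lambda>t. deriv_on S \<Phi> (t / a) / a\<^sup>2) (\<lambda>t. deriv_on S (deriv_on S \<Phi>) (t / a) / a ^ 3)"
      using unstableI_limits[OF m a so li S] unfolding k_def by blast
    have "(\<Phi> has_real_derivative deriv_on S \<Phi> 0) (at 0 within S)"
      using so S unfolding solves_ode_def by (intro deriv_on_has_derivative) auto
    then have "(\<Phi> \<longlongrightarrow> \<Phi> 0) (at 0 within S)" using DERIV_continuous[of \<Phi> _ 0 S] by (simp add: continuous_within)
    then have "(\<Phi> \<longlongrightarrow> 0) (at_left 0)" unfolding \<Phi>0 by (rule tendsto_mono[OF at_le, rotated]) (use S in auto)
    moreover have "filterlim (\<lambda>t. t / a) (at_left 0) (at_left 0)" using a by real_asymp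
    ultimately have "((\<lambda>t. \<Phi> (t / a)) \<longlongrightarrow> 0) (at_left 0)" by (rule filterlim_compose)
    then have l0: "((\<lambda>t. \<Phi> (t / a) / a) \<longlongrightarrow> 0) (at_left 0)" by (rule tendsto_divide_zero)
    have "\<Phi> (a * t / a) / a = f (a * t)"
      by (rule half_line_unique[OF k s u d1 f0 d l0]) (use a t in \<open>simp add: mult_pos_neg\<close>)
    then show ?thesis using a by (simp add: field_simps)
  qed
  have half_uniq: "\<forall>\<tau>\<le>0. \<Psi> \<tau> = f \<tau>" if "half_line_problem m 1 \<Psi>" for \<Psi>
  proof (intro allI impI)
    fix \<tau> :: real assume "\<tau> \<le> 0"
    then show "\<Psi> \<tau> = f \<tau>"
      using uniq[of 1 "{..0}" \<Psi> \<tau>] that f0 unfolding half_line_problem_def by (cases "\<tau> = 0") auto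
  qed
  note full = solves_odeI[OF m0 s[unfolded k_def] UNIV_nb]
  have lyap1: "lyapunov_family m 1 d1 UNIV f"
    using lyapunov_familyI[OF m0 _ d1 full(1), of 1 f] sums by simp
  have main: "\<exists>a \<Phi>.
          whole_line_problem m b a \<Phi> \<and>
          (\<forall>a' \<Phi>'. whole_line_problem m b a' \<Phi>' \<longrightarrow> a' = a \<and> \<Phi>' = \<Phi>) \<and>
          (\<exists>d>0.
             convex_on {..0} \<Phi> \<and> (m \<ge> 1 \<longrightarrow> convex_on UNIV \<Phi>) \<and>
             strict_mono \<Phi> \<and>
             lyapunov_family m a d UNIV \<Phi> \<and>
             (\<forall>\<tau>\<le>0. a * (exp (a * \<tau>) - 1) \<le> \<Phi> \<tau> \<and> \<Phi> \<tau> \<le> a * tanh (a * \<tau> / 2)) \<and>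
             (\<forall>\<tau>>0. a * tanh (a * \<tau> / 2) < \<Phi> \<tau> \<and> \<Phi> \<tau> < a * (exp (a * \<tau>) - 1)) \<and>
             (\<forall>v_par. is_v_par m b v_par \<longrightarrow>
                (\<exists>D \<tau>\<^sub>s r. (r \<longlongrightarrow> 0) at_top \<and>
                   eventually (\<lambda>\<tau>. \<Phi> \<tau> = (\<tau> + \<tau>\<^sub>s) powr m *
                     (b + v_par ((\<tau> + \<tau>\<^sub>s) powr (m + 1) / (m + 1))
                        + D * (\<tau> + \<tau>\<^sub>s) powr ((- 4 * m\<^sup>2 - 6 * m + 4) / (m + 1))
                            * exp (- (b * (\<tau> + \<tau>\<^sub>s) powr (m + 1) / (m + 1)))
                            * (1 + r \<tau>))) at_top)) \<and>
             a = (b / b1) powr (1 / (m + 1)) \<and>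
             (\<forall>\<tau>. \<Phi> \<tau> = a * f (a * \<tau>)) \<and>
             d = a * d1)" if b: "b > 0" for b
  proof -
    define a where "a = (b / b1) powr (1 / (m + 1))"
    have a: "a > 0" using b b1 by (simp add: a_def)
    have "a powr (m + 1) = b / b1" unfolding a_def powr_powr using m0 b b1 by simp
    then have ab: "a powr (m + 1) * b1 = b" using b1 by simp
    define \<Phi> \<Phi>' \<Phi>'' where "\<Phi> = (\<lambda>t. a * f (a * t))" and "\<Phi>' = (\<lambda>t. a\<^sup>2 * g (a * t))" and "\<Phi>'' = (\<lambda>t. a ^ 3 * h (a * t))"
    have S: "ode_sol k UNIV \<Phi> \<Phi>' \<Phi>''"
      using ode_sol_scale[OF s, of a] unfolding \<Phi>_def \<Phi>'_def \<Phi>''_def by simp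
    note so = solves_odeI[OF m0 S[unfolded k_def] UNIV_nb]
    have limb: "((\<lambda>t. \<Phi> t / t powr m) \<longlongrightarrow> b) at_top"
      using scaled_power_limit[OF a lim1] unfolding ab \<Phi>_def .
    have W: "whole_line_problem m b a \<Phi>"
      unfolding whole_line_problem_def
    proof (intro conjI a so(1) limb)
      show "limits_at_minus_infinity a UNIV \<Phi>"
        by (rule limits_at_minus_infinityI[OF a u]) (simp_all add: so \<Phi>_def[symmetric], simp_all add: \<Phi>_def \<Phi>'_def \<Phi>''_def)
      show "\<Phi> 0 = 0" by (simp add: \<Phi>_def f0)
    qed
    \<comment> \<open>On the left half-line the solution is a rescaling of \<open>f\<close> by its
      own \<open>a'\<close>, and the initial value problem extends this to the right. Its growth
      constant is then \<open>a' powr (m + 1) * b1\<close>, which determines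
      \<open>a'\<close>.\<close>
    have U: "a' = a \<and> \<Psi> = \<Phi>" if w: "whole_line_problem m b a' \<Psi>" for a' \<Psi>
    proof -
      have a': "a' > 0" and so': "solves_ode m UNIV \<Psi>" and li': "limits_at_minus_infinity a' UNIV \<Psi>"
        and \<Psi>0: "\<Psi> 0 = 0" and lim': "((\<lambda>t. \<Psi> t / t powr m) \<longlongrightarrow> b) at_top"
        using w unfolding whole_line_problem_def by auto
      have sol': "ode_sol k UNIV \<Psi> (deriv_on UNIV \<Psi>) (deriv_on UNIV (deriv_on UNIV \<Psi>))"
        unfolding ode_sol_def k_def using solves_odeD[OF m0 so' UNIV_I UNIV_nb] by blast
      have scaled: "ode_sol k UNIV (\<lambda>t. a' * f (a' * t)) (\<lambda>t. a'\<^sup>2 * g (a' * t)) (\<lambda>t. a' ^ 3 * h (a' * t))"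
        using ode_sol_scale[OF s, of a'] by simp
      have eq: "\<Psi> t = a' * f (a' * t)" for t
      proof (cases "t < 0")
        case True then show ?thesis using uniq[OF a' so' li' \<Psi>0] by simp
      next
        case False
        show ?thesis
          by (rule ode_sol_unique_extension(1)[OF ode_sol_subset[OF sol' subset_UNIV] ode_sol_subset[OF scaled subset_UNIV], of 0 "t + 1"])
             (use False uniq[OF a' so' li' \<Psi>0] in auto)
      qed
      have "((\<lambda>t. \<Psi> t / t powr m) \<longlongrightarrow> a' powr (m + 1) * b1) at_top"
        using scaled_power_limit[OF a' lim1] by (simp only: eq)
      then have "a' powr (m + 1) * b1 = b" using tendsto_unique[OF _ _ lim'] by simp
      then have "a' powr (m + 1) = a powr (m + 1)" using ab b1 by (metis less_irrefl mult_right_cancel)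
      then have "(a' powr (m + 1)) powr (1 / (m + 1)) = (a powr (m + 1)) powr (1 / (m + 1))" by simp
      then have "a' = a" using a a' m0 by (simp add: powr_powr)
      then show ?thesis using eq by (auto simp: \<Phi>_def)
    qed
    have D: "(\<Phi> has_real_derivative \<Phi>' t) (at t)" "(\<Phi>' has_real_derivative \<Phi>'' t) (at t)" for t
      using ode_solD[OF S UNIV_I] by auto
    note B = normalized_bounds[OF k s u d1 f0]
    have hle: "h t > 0" if "t \<le> 0" for t
    proof -
      have "f t \<le> tanh (t / 2)" using B(1)[OF that] by simp
      also have "\<dots> \<le> 0" using that by simp
      finally have "f t * g t \<le> 0" using gp[of t] by (intro mult_nonpos_nonneg) auto
      then show ?thesis using Jp[of t] by simp
    qed
    have conv: "convex_on {..0} \<Phi>"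
      by (rule f''_ge0_imp_convex[of _ _ \<Phi>' \<Phi>'']) (use D hle a in \<open>auto simp: \<Phi>''_def mult_nonneg_nonpos less_imp_le\<close>)
    have conv': "convex_on UNIV \<Phi>" if "m \<ge> 1"
    proof (rule f''_ge0_imp_convex[of _ _ \<Phi>' \<Phi>''])
      fix x
      have "k \<ge> 0" using that by (simp add: k_def)
      then have "h (a * x) > 0"
        using convex_right_branch[OF _ s hle[of 0], of "a * x"] hle[of "a * x"] by (cases "a * x \<le> 0") auto
      then show "\<Phi>'' x \<ge> 0" using a by (simp add: \<Phi>''_def)
    qed (use D in auto)
    have mono: "strict_mono \<Phi>"
    proof (rule strict_monoI)
      fix x y :: real assume "x < y"
      then show "\<Phi> x < \<Phi> y"
      proof (rule DERIV_pos_imp_increasing)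
        fix z show "\<exists>y. (\<Phi> has_real_derivative y) (at z) \<and> 0 < y"
          using D(1)[of z] gp[of "a * z"] a by (intro exI[of _ "\<Phi>' z"]) (simp add: \<Phi>'_def)
      qed
    qed
    have lyap: "lyapunov_family m a (a * d1) UNIV \<Phi>"
      by (rule lyapunov_familyI[OF m0 a d1 so(1) _ sums]) (simp_all add: \<Phi>_def)
    have left: "a * (exp (a * \<tau>) - 1) \<le> \<Phi> \<tau> \<and> \<Phi> \<tau> \<le> a * tanh (a * \<tau> / 2)" if "\<tau> \<le> 0" for \<tau>
      using B(1)[of "a * \<tau>"] that a by (simp add: \<Phi>_def mult_nonneg_nonpos)
    have right: "a * tanh (a * \<tau> / 2) < \<Phi> \<tau> \<and> \<Phi> \<tau> < a * (exp (a * \<tau>) - 1)" if "\<tau> > 0" for \<tau>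
      using B(2)[of "a * \<tau>"] that a by (simp add: \<Phi>_def)
    have "ode_sol ((m - 1) / m) {0<..} \<Phi> \<Phi>' \<Phi>''" using S unfolding k_def by (rule ode_sol_subset) auto
    note expansion = growing_solution_expansion[OF m b this limb]
    have d: "a * d1 > 0" using a d1 by simp
    show ?thesis
    proof (rule exI[of _ a], rule exI[of _ \<Phi>], intro conjI W)
      show "\<forall>a' \<Phi>'. whole_line_problem m b a' \<Phi>' \<longrightarrow> a' = a \<and> \<Phi>' = \<Phi>" using U by blast
    qed (rule exI[of _ "a * d1"], intro conjI allI impI d conv conv' mono lyap left right expansion,
         simp_all add: a_def \<Phi>_def)
  qed
  show ?thesis
    by (rule exI[of _ f], rule exI[of _ d1], rule exI[of _ b1])
       (intro conjI half_prob full(1) lyap1 lim1 b1 allI impI; (rule main half_uniq[rule_format]; assumption)?)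
qed

end
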